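(* Let $X$ be a geodesic space with basepoint $\bullet$ and let $G$ be an Abelian group. Then there are isomorphisms of persistences $$\{\pi_1(\mathrm{Rips}(X,r),\bullet)\}_{r>0}\cong\{\pi_1(X,\bullet)/\mathcal{D}(X,3r/2,\pi_1)\}_{r>0},$$ $$\{H_1(\mathrm{Rips}(X,r),G)\}_{r>0}\cong\{H_1(X,G)/\mathcal{D}(X,3r/2,G)\}_{r>0}.$$
   Context: A metric space $(X,d)$ is geodesic if any $x,y\in X$ are joined by a path of length $d(x,y)$. $\mathrm{Rips}(X,r)$ is the simplicial complex with vertex set $X$ in which a finite nonempty $\sigma\subset X$ is a simplex iff $\operatorname{diam}(\sigma)<r$. The diameter of a loop $\beta$ is $\max_{x,y\in\beta}d(x,y)$. $\mathcal D(X,r,\pi_1)\le\pi_1(X,\bullet)$ is the subgroup generated by all based loops $\alpha*\beta*\alpha^-$, where $\alpha$ is a path starting at $\bullet$, $\alpha^-$ its reverse, and $\beta$ is a loop based at the endpoint of $\alpha$ with $\operatorname{diam}(\beta)<r$. $\mathcal D(X,r,G)\le H_1(X,G)$ is generated by the classes (with arbitrary coefficients in $G$) of loops of diameter less than $r$. Persistences have bonding maps for $p<q$ induced by inclusions of Rips complexes on the left and natural quotient maps on the right. An isomorphism of persistences is a family of isomorphisms, one for each $r>0$, commuting with the bonding maps. *)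

theory Defs
  imports "HOL-Analysis.Analysis" "HOL-Homology.Homology"
begin

section \<open>Geodesic spaces\<close>

definition path_length :: "(real \<Rightarrow> 'a::metric_space) \<Rightarrow> ennreal" where
  "path_length g =
    (SUP (n, t) \<in> {(n::nat, t::nat \<Rightarrow> real). t 0 = 0 \<and> t n = 1 \<and> (\<forall>i<n. t i \<le> t (Suc i))}.
       ennreal (\<Sum>i<n. dist (g (t i)) (g (t (Suc i)))))"

definition geodesic_space :: "'a::metric_space set \<Rightarrow> bool" where
  "geodesic_space X \<longleftrightarrow>
    (\<forall>x\<in>X. \<forall>y\<in>X. \<exists>g. path g \<and> path_image g \<subseteq> X \<and> pathstart g = x \<and> pathfinish g = y \<and>
        path_length g = ennreal (dist x y))"


section \<open>Rips complexes and geometric realization\<close>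

definition rips :: "'a::metric_space set \<Rightarrow> real \<Rightarrow> 'a set set" where
  "rips X r = {\<sigma>. finite \<sigma> \<and> \<sigma> \<noteq> {} \<and> \<sigma> \<subseteq> X \<and> diameter \<sigma> < r}"

text \<open>Points of the realization are given by their barycentric coordinates.\<close>

definition closed_face :: "'v set \<Rightarrow> ('v \<Rightarrow> real) set" where
  "closed_face \<sigma> = {t. (\<forall>v. 0 \<le> t v) \<and> (\<forall>v. v \<notin> \<sigma> \<longrightarrow> t v = 0) \<and> sum t \<sigma> = 1}"

text \<open>
  The weak (coherent) topology: a set is open iff its trace on every closed face is open.
  On a single face, where only finitely many coordinates are nonzero, the topology of pointwise
  convergence carried by the function type is the Euclidean one.
\<close>

definition realization :: "'v set set \<Rightarrow> ('v \<Rightarrow> real) topology" where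
  "realization K = topology (\<lambda>U. U \<subseteq> (\<Union>\<sigma>\<in>K. closed_face \<sigma>) \<and>
     (\<forall>\<sigma>\<in>K. openin (top_of_set (closed_face \<sigma>)) (U \<inter> closed_face \<sigma>)))"

lemma openin_realization:
  "openin (realization K) U \<longleftrightarrow> U \<subseteq> (\<Union>\<sigma>\<in>K. closed_face \<sigma>) \<and>
     (\<forall>\<sigma>\<in>K. openin (top_of_set (closed_face \<sigma>)) (U \<inter> closed_face \<sigma>))"
proof -
  let ?P = "\<lambda>U. U \<subseteq> (\<Union>\<sigma>\<in>K. closed_face \<sigma>) \<and>
     (\<forall>\<sigma>\<in>K. openin (top_of_set (closed_face \<sigma>)) (U \<inter> closed_face \<sigma>))"
  have "istopology ?P"
    unfolding istopology_def
  proof (rule conjI; intro allI impI)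
    fix S T assume "?P S" "?P T"
    moreover have "(S \<inter> T) \<inter> closed_face \<sigma> = (S \<inter> closed_face \<sigma>) \<inter> (T \<inter> closed_face \<sigma>)" for \<sigma>
      by blast
    ultimately show "?P (S \<inter> T)"
      by (metis (no_types, lifting) le_infI1 openin_Int)
  next
    fix \<K> assume K: "\<forall>U\<in>\<K>. ?P U"
    have "openin (top_of_set (closed_face \<sigma>)) (\<Union>\<K> \<inter> closed_face \<sigma>)" if "\<sigma> \<in> K" for \<sigma>
    proof -
      have "\<Union>\<K> \<inter> closed_face \<sigma> = (\<Union>U\<in>\<K>. U \<inter> closed_face \<sigma>)"
        by blast
      moreover have "openin (top_of_set (closed_face \<sigma>)) (\<Union>U\<in>\<K>. U \<inter> closed_face \<sigma>)"
        using K that by (intro openin_Union) auto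
      ultimately show ?thesis
        by simp
    qed
    moreover have "\<Union>\<K> \<subseteq> (\<Union>\<sigma>\<in>K. closed_face \<sigma>)"
      using K by blast
    ultimately show "?P (\<Union>\<K>)"
      by blast
  qed
  then show ?thesis
    by (simp add: realization_def topology_inverse')
qed

lemma topspace_realization: "topspace (realization K) = (\<Union>\<sigma>\<in>K. closed_face \<sigma>)"
proof -
  have "openin (realization K) (\<Union>\<sigma>\<in>K. closed_face \<sigma>)"
    unfolding openin_realization
  proof (intro conjI ballI)
    fix \<sigma> assume "\<sigma> \<in> K"
    then have "(\<Union>\<sigma>\<in>K. closed_face \<sigma>) \<inter> closed_face \<sigma> = closed_face \<sigma>"
      by blast
    then show "openin (top_of_set (closed_face \<sigma>)) ((\<Union>\<sigma>\<in>K. closed_face \<sigma>) \<inter> closed_face \<sigma>)"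
      by simp
  qed simp
  then show ?thesis
    by (metis openin_realization openin_subset openin_topspace subset_antisym)
qed

definition vertex_point :: "'v \<Rightarrow> 'v \<Rightarrow> real" where
  "vertex_point x = (\<lambda>v. if v = x then 1 else 0)"


section \<open>Fundamental groups\<close>

text \<open>
  This is \<^const>\<open>homotopic_paths\<close> for an arbitrary topology in place of a subset of a type; the class
  constraint below is only what the path operations of the library ask for, and the
  topology of the type plays no role.
\<close>

definition homotopic_pathsin :: "'a topology \<Rightarrow> (real \<Rightarrow> 'a) \<Rightarrow> (real \<Rightarrow> 'a) \<Rightarrow> bool" where
  "homotopic_pathsin T p q \<longleftrightarrow>
    homotopic_with (\<lambda>h. h 0 = p 0 \<and> h 1 = p 1) (top_of_set {0..1}) T p q"

lemma homotopic_pathsin_top_of_set: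
  "homotopic_pathsin (top_of_set S) p q \<longleftrightarrow> homotopic_paths S p q"
  by (simp add: homotopic_pathsin_def homotopic_paths_def pathstart_def pathfinish_def)

definition path_class :: "'a topology \<Rightarrow> (real \<Rightarrow> 'a) \<Rightarrow> (real \<Rightarrow> 'a) set" where
  "path_class T p = {q. homotopic_pathsin T p q}"

definition fundamental_group ::
  "'a::topological_space topology \<Rightarrow> 'a \<Rightarrow> (real \<Rightarrow> 'a) set monoid" where
  "fundamental_group T x =
    \<lparr> carrier = {path_class T p | p. pathin T p \<and> p 0 = x \<and> p 1 = x},
      mult = (\<lambda>A B. \<Union>p\<in>A. \<Union>q\<in>B. path_class T (p +++ q)),
      one = path_class T (\<lambda>_. x) \<rparr>"

text \<open>The map induced by a continuous map \<open>h\<close> into \<open>T\<close>; all members of the union coincide.\<close>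

definition fundamental_group_map ::
  "'b topology \<Rightarrow> ('a \<Rightarrow> 'b) \<Rightarrow> (real \<Rightarrow> 'a) set \<Rightarrow> (real \<Rightarrow> 'b) set" where
  "fundamental_group_map T h A = (\<Union>p\<in>A. path_class T (h \<circ> p))"

definition small_loops_pi1 :: "'a::metric_space set \<Rightarrow> 'a \<Rightarrow> real \<Rightarrow> (real \<Rightarrow> 'a) set set" where
  "small_loops_pi1 X x r = generate (fundamental_group (top_of_set X) x)
    {path_class (top_of_set X) (\<alpha> +++ \<beta> +++ reversepath \<alpha>) | \<alpha> \<beta>.
       path \<alpha> \<and> path_image \<alpha> \<subseteq> X \<and> pathstart \<alpha> = x \<and>
       path \<beta> \<and> path_image \<beta> \<subseteq> X \<and> pathstart \<beta> = pathfinish \<alpha> \<and> pathfinish \<beta> = pathfinish \<alpha> \<and>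
       diameter (path_image \<beta>) < r}"


section \<open>Singular homology with coefficients\<close>

text \<open>
  The library's singular chains with the integers replaced by an abelian group, given as a
  type \<open>'g\<close>.
\<close>

type_synonym ('a, 'g) gchain = "((nat \<Rightarrow> real) \<Rightarrow> 'a) \<Rightarrow>\<^sub>0 'g"

definition gchain_boundary :: "nat \<Rightarrow> ('a, 'g::ab_group_add) gchain \<Rightarrow> ('a, 'g) gchain" where
  "gchain_boundary p c =
    (if p = 0 then 0
     else (\<Sum>f\<in>Poly_Mapping.keys c. \<Sum>k\<le>p. Poly_Mapping.single (singular_face p k f)
             (if even k then Poly_Mapping.lookup c f else - Poly_Mapping.lookup c f)))"

lemma gchain_boundary_int: "gchain_boundary p c = chain_boundary p c"
proof -
  have "frag_cmul m (frag_cmul ((-1) ^ k) (frag_of s)) =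
      Poly_Mapping.single s (if even k then m else - m)" for m k and s :: "(nat \<Rightarrow> real) \<Rightarrow> 'a"
    by (rule poly_mapping_eqI) (auto simp: lookup_single when_def)
  then show ?thesis
    by (simp add: gchain_boundary_def chain_boundary_def frag_extend_def frag_cmul_sum)
qed

definition gchain_set :: "nat \<Rightarrow> 'a topology \<Rightarrow> ('a, 'g::ab_group_add) gchain set" where
  "gchain_set p T = {c. Poly_Mapping.keys c \<subseteq> singular_simplex_set p T}"

definition gcycle_group :: "nat \<Rightarrow> 'a topology \<Rightarrow> ('a, 'g::ab_group_add) gchain monoid" where
  "gcycle_group p T =
    \<lparr> carrier = {c \<in> gchain_set p T. gchain_boundary p c = 0}, mult = (+), one = 0 \<rparr>"

definition gboundary_set :: "nat \<Rightarrow> 'a topology \<Rightarrow> ('a, 'g::ab_group_add) gchain set" where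
  "gboundary_set p T = gchain_boundary (Suc p) ` gchain_set (Suc p) T"

text \<open>The first argument only serves to name the coefficient group: \<open>TYPE('g)\<close>.\<close>

definition homology_with_coeff ::
  "'g itself \<Rightarrow> nat \<Rightarrow> 'a topology \<Rightarrow> ('a, 'g::ab_group_add) gchain set monoid" where
  "homology_with_coeff G p T = gcycle_group p T Mod gboundary_set p T"

definition homology_class ::
  "nat \<Rightarrow> 'a topology \<Rightarrow> ('a, 'g::ab_group_add) gchain \<Rightarrow> ('a, 'g) gchain set" where
  "homology_class p T c = gboundary_set p T #>\<^bsub>gcycle_group p T\<^esub> c"

definition gchain_map ::
  "nat \<Rightarrow> ('a \<Rightarrow> 'b) \<Rightarrow> ('a, 'g::ab_group_add) gchain \<Rightarrow> ('b, 'g) gchain" where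
  "gchain_map p h c =
    (\<Sum>f\<in>Poly_Mapping.keys c. Poly_Mapping.single (simplex_map p h f) (Poly_Mapping.lookup c f))"

text \<open>The map induced by a continuous map \<open>h\<close> into \<open>T\<close>; all members of the union coincide.\<close>

definition homology_map ::
  "nat \<Rightarrow> 'b topology \<Rightarrow> ('a \<Rightarrow> 'b) \<Rightarrow> ('a, 'g::ab_group_add) gchain set \<Rightarrow> ('b, 'g) gchain set" where
  "homology_map p T h C = (\<Union>c\<in>C. homology_class p T (gchain_map p h c))"

text \<open>A loop read as a singular 1-simplex, parametrized by the second barycentric coordinate.\<close>

definition path_simplex :: "(real \<Rightarrow> 'a) \<Rightarrow> (nat \<Rightarrow> real) \<Rightarrow> 'a" where
  "path_simplex \<beta> = restrict (\<lambda>t. \<beta> (t 1)) (standard_simplex 1)"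

definition small_loops_H1 ::
  "'g itself \<Rightarrow> 'a::metric_space set \<Rightarrow> real \<Rightarrow> ('a, 'g::ab_group_add) gchain set set" where
  "small_loops_H1 G X r = generate (homology_with_coeff G 1 (top_of_set X))
    {homology_class 1 (top_of_set X) (Poly_Mapping.single (path_simplex \<beta>) a) | \<beta> a.
       path \<beta> \<and> path_image \<beta> \<subseteq> X \<and> pathstart \<beta> = pathfinish \<beta> \<and> diameter (path_image \<beta>) < r}"


section \<open>Persistences of groups\<close>

text \<open>
  The natural map \<open>G Mod N \<rightarrow> G Mod M\<close> for \<open>N \<subseteq> M\<close>, sending a coset \<open>N #> a\<close> to \<open>M #> a\<close>;
  all members of the union coincide.
\<close>

definition natural_quotient :: "('a, 'b) monoid_scheme \<Rightarrow> 'a set \<Rightarrow> 'a set \<Rightarrow> 'a set" where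
  "natural_quotient G M C = (\<Union>a\<in>C. M #>\<^bsub>G\<^esub> a)"

text \<open>
  A persistence is given by its groups \<open>V r\<close> for \<open>r > 0\<close> and its bonding maps
  \<open>f p q\<close> from \<open>V p\<close> to \<open>V q\<close> for \<open>0 < p < q\<close>.
\<close>

definition persistence_isomorphic ::
  "(real \<Rightarrow> 'a monoid) \<Rightarrow> (real \<Rightarrow> real \<Rightarrow> 'a \<Rightarrow> 'a) \<Rightarrow>
   (real \<Rightarrow> 'b monoid) \<Rightarrow> (real \<Rightarrow> real \<Rightarrow> 'b \<Rightarrow> 'b) \<Rightarrow> bool" where
  "persistence_isomorphic V f W g \<longleftrightarrow>
    (\<exists>\<phi>. (\<forall>r>0. \<phi> r \<in> iso (V r) (W r)) \<and>
         (\<forall>p q. 0 < p \<longrightarrow> p < q \<longrightarrow> (\<forall>v\<in>carrier (V p). \<phi> q (f p q v) = g p q (\<phi> p v))))"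

end

theory Submission
  imports Defs
begin

text \<open>
  A cocycle on an open cover, with values in a discrete group, is trivial over the unit square, so it
  has a holonomy along paths that depends only on the homotopy class. The geodesics \<open>vw\<close>, read in
  \<open>\<pi>\<^sub>1(X) / D(X, 3r/2)\<close>, form a cocycle on the cover of the Rips complex by open stars, because a
  geodesic triangle with sides less than \<open>r\<close> has perimeter less than \<open>3r\<close> and hence diameter less than \<open>3r/2\<close>;
  the edges \<open>vw\<close> of the Rips complex, read in its fundamental group, form a cocycle on the cover of
  \<open>X\<close> by balls of radius \<open>r/2\<close>. The two holonomy maps are inverse to each other. The statement for
  homology follows, since \<open>H\<^sub>1(_, G)\<close> of a path-connected space is the tensor product of the
  abelianized fundamental group with \<open>G\<close>.
\<close>

section \<open>Paths in an abstract topology\<close>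

text \<open>A simplex of the Rips complex need not be filled in \<open>X\<close>, so sending
  vertices to points does not in general extend to a continuous map of the realization into
  \<open>X\<close>. A cocycle asks less: only which charts contain a point, and one group element
  for each pair of meeting charts. Balls of radius \<open>r / 2\<close> are taken because centres of
  balls that meet are less than \<open>r\<close> apart and so span an edge. The constant 3/2 has a
  second source. Every loop of diameter below \<open>3 * r / 2\<close> must have trivial holonomy in
  the Rips complex; this holds because a geodesic of length below \<open>3 * r / 2\<close> splits
  into parts below \<open>r / 2\<close> and below \<open>r\<close>, and the shorter parts all end at
  points less than \<open>r\<close> apart. Open paths enter the groups only through chosen paths
  from the base point. Hence each holonomy map carries one cocycle to the other only up to a gauge
  transformation, which is trivial at the base point. Compatibility with the bonding maps is the
  fact that holonomy commutes with homomorphisms, as the geodesics do not depend on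
  \<open>r\<close>.\<close>

lemma homotopic_pathsin_refl: "pathin T p \<Longrightarrow> homotopic_pathsin T p p"
  by (simp add: homotopic_pathsin_def pathin_def)

lemma homotopic_pathsin_imp:
  assumes "homotopic_pathsin T p q"
  shows "pathin T p" "pathin T q" "q 0 = p 0" "q 1 = p 1"
  using homotopic_with_imp_continuous_maps[OF assms[unfolded homotopic_pathsin_def]]
    homotopic_with_imp_property[OF assms[unfolded homotopic_pathsin_def]]
  by (auto simp: pathin_def)

lemma homotopic_pathsin_sym: "homotopic_pathsin T p q \<Longrightarrow> homotopic_pathsin T q p"
  using homotopic_pathsin_imp(3,4)[of T p q] unfolding homotopic_pathsin_def
  by (simp add: homotopic_with_symD)

lemma homotopic_pathsin_trans [trans]:
  "homotopic_pathsin T p q \<Longrightarrow> homotopic_pathsin T q r \<Longrightarrow> homotopic_pathsin T p r"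
  using homotopic_pathsin_imp(3,4)[of T p q] unfolding homotopic_pathsin_def
  by (metis (mono_tags) homotopic_with_trans)

lemma homotopic_pathsin_eq:
  "pathin T p \<Longrightarrow> (\<And>t. 0 \<le> t \<Longrightarrow> t \<le> 1 \<Longrightarrow> p t = q t) \<Longrightarrow> homotopic_pathsin T p q"
  unfolding homotopic_pathsin_def pathin_def by (rule homotopic_with_equal) auto

lemma path_class_self: "pathin T p \<Longrightarrow> p \<in> path_class T p"
  by (simp add: path_class_def homotopic_pathsin_refl)

lemma path_class_eq: "homotopic_pathsin T p q \<Longrightarrow> path_class T p = path_class T q"
  unfolding path_class_def using homotopic_pathsin_sym homotopic_pathsin_trans by blast

lemma pathin_in_topspace: "pathin T p \<Longrightarrow> 0 \<le> t \<Longrightarrow> t \<le> 1 \<Longrightarrow> p t \<in> topspace T"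
  using path_image_subset_topspace by fastforce

lemma pathin_compose_path:
  assumes "continuous_map (top_of_set S) T M" "path f" "path_image f \<subseteq> S"
  shows "pathin T (M \<circ> f)"
  unfolding pathin_def
  by (rule continuous_map_compose[OF _ assms(1)])
     (use assms(2,3) in \<open>auto simp: continuous_map_in_subtopology path_def path_image_def\<close>)

text \<open>The straight-line homotopy lives in the parameter domain \<open>S\<close> and is carried
  into \<open>T\<close> by \<open>M\<close>, so \<open>T\<close> may be any topology.
  Reparametrizations, cones and singular triangles obtain their homotopies in this way, with
  \<open>S\<close> an interval, a square or a triangle.\<close>

lemma homotopic_pathsin_convex:
  fixes S :: "'c::real_normed_vector set"
  assumes "convex S" and M: "continuous_map (top_of_set S) T M"
    and "path f" "path g" "path_image f \<subseteq> S" "path_image g \<subseteq> S" and ends: "f 0 = g 0" "f 1 = g 1"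
  shows "homotopic_pathsin T (M \<circ> f) (M \<circ> g)"
proof -
  have "homotopic_paths S f g"
  proof (rule homotopic_paths_linear)
    fix t :: real assume "t \<in> {0..1}"
    then have "f t \<in> S" "g t \<in> S"
      using assms by (auto simp: path_image_def)
    then show "closed_segment (f t) (g t) \<subseteq> S"
      by (simp add: closed_segment_subset \<open>convex S\<close>)
  qed (use assms in \<open>auto simp: pathstart_def pathfinish_def\<close>)
  then show ?thesis
    unfolding homotopic_paths_def homotopic_pathsin_def
    by (rule homotopic_with_compose_continuous_map_left[OF _ M])
       (auto simp: pathstart_def pathfinish_def)
qed

lemma homotopic_pathsin_reparam:
  assumes "pathin T p" "path f" "path g" "path_image f \<subseteq> {0..1}" "path_image g \<subseteq> {0..1}"
    "f 0 = g 0" "f 1 = g 1"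
  shows "homotopic_pathsin T (p \<circ> f) (p \<circ> g)"
  using assms homotopic_pathsin_convex[of "{0..1::real}" T p f g] by (simp add: pathin_def)

lemma linepath_image_01: "a \<in> {0..1} \<Longrightarrow> b \<in> {0..1} \<Longrightarrow> path_image (linepath a b) \<subseteq> {0..1::real}"
  by (simp add: closed_segment_subset)

lemma pathin_linepath:
  "pathin T p \<Longrightarrow> a \<in> {0..1} \<Longrightarrow> b \<in> {0..1} \<Longrightarrow> pathin T (p \<circ> linepath a b)"
  by (rule pathin_compose_path[of "{0..1}"])
     (use linepath_image_01 in \<open>auto simp: pathin_def\<close>)

lemma pathin_reversepath: "pathin T p \<Longrightarrow> pathin T (reversepath p)"
  using pathin_linepath[of T p 1 0] by (simp add: reversepath_def o_def linepath_def)

lemma joinpaths_ends [simp]: "(p +++ q) 0 = p 0" "(p +++ q) 1 = q 1"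
  by (auto simp: joinpaths_def)

lemma reversepath_ends [simp]: "reversepath p 0 = p 1" "reversepath p 1 = p 0"
  by (auto simp: reversepath_def)

lemma linepath_ends [simp]: "linepath a b 0 = a" "linepath a b 1 = b"
  by (auto simp: linepath_def)

lemma pathin_joinpaths:
  assumes "pathin T p" "pathin T q" "p 1 = q 0"
  shows "pathin T (p +++ q)"
  unfolding pathin_def joinpaths_def
proof (rule continuous_map_cases_le)
  let ?I = "top_of_set {0..1::real}"
  have *: "continuous_map (subtopology ?I {x \<in> topspace ?I. x \<le> 1/2}) ?I (\<lambda>x. 2 * x)"
    "continuous_map (subtopology ?I {x \<in> topspace ?I. 1/2 \<le> x}) ?I (\<lambda>x. 2 * x - 1)"
    by (auto simp: subtopology_subtopology intro!: continuous_intros)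
  show "continuous_map (subtopology ?I {x \<in> topspace ?I. x \<le> 1/2}) T (\<lambda>x. p (2 * x))"
    using continuous_map_compose[OF *(1), of T p] assms by (simp add: pathin_def o_def)
  show "continuous_map (subtopology ?I {x \<in> topspace ?I. 1/2 \<le> x}) T (\<lambda>x. q (2 * x - 1))"
    using continuous_map_compose[OF *(2), of T q] assms by (simp add: pathin_def o_def)
  show "p (2 * x) = q (2 * x - 1)" if "x = 1/2" for x
    unfolding that using assms(3) by simp
qed auto

text \<open>At the common point both homotopies stand still, so they can be placed side by side and
  glued at time 1/2.\<close>

lemma homotopic_pathsin_join:
  assumes "homotopic_pathsin T p p'" "homotopic_pathsin T q q'" "p 1 = q 0"
  shows "homotopic_pathsin T (p +++ q) (p' +++ q')"
proof -
  let ?I = "top_of_set {0..1::real}"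
  let ?II = "prod_topology ?I ?I"
  obtain h where h: "continuous_map ?II T h" "\<And>x. h (0, x) = p x" "\<And>x. h (1, x) = p' x"
    "\<And>t. t \<in> {0..1} \<Longrightarrow> h (t, 0) = p 0 \<and> h (t, 1) = p 1"
    using assms(1) unfolding homotopic_pathsin_def homotopic_with_def by blast
  obtain k where k: "continuous_map ?II T k" "\<And>x. k (0, x) = q x" "\<And>x. k (1, x) = q' x"
    "\<And>t. t \<in> {0..1} \<Longrightarrow> k (t, 0) = q 0 \<and> k (t, 1) = q 1"
    using assms(2) unfolding homotopic_pathsin_def homotopic_with_def by blast
  let ?H = "\<lambda>z::real\<times>real. if snd z \<le> 1/2 then h (fst z, 2 * snd z) else k (fst z, 2 * snd z - 1)"
  have II: "?II = top_of_set ({0..1} \<times> {0..1})"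
    by (simp add: prod_topology_subtopology subtopology_subtopology Times_Int_Times)
  have "continuous_map ?II T ?H"
  proof (rule continuous_map_cases_le)
    have *: "continuous_map (subtopology ?II {z \<in> topspace ?II. snd z \<le> 1/2}) ?II (\<lambda>z. (fst z, 2 * snd z))"
      "continuous_map (subtopology ?II {z \<in> topspace ?II. 1/2 \<le> snd z}) ?II (\<lambda>z. (fst z, 2 * snd z - 1))"
      unfolding II by (auto simp: subtopology_subtopology intro!: continuous_intros)
    show "continuous_map (subtopology ?II {z \<in> topspace ?II. snd z \<le> 1/2}) T (\<lambda>z. h (fst z, 2 * snd z))"
      using continuous_map_compose[OF *(1) h(1)] by (simp add: o_def)
    show "continuous_map (subtopology ?II {z \<in> topspace ?II. 1/2 \<le> snd z}) T (\<lambda>z. k (fst z, 2 * snd z - 1))"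
      using continuous_map_compose[OF *(2) k(1)] by (simp add: o_def)
    show "h (fst z, 2 * snd z) = k (fst z, 2 * snd z - 1)"
      if "z \<in> topspace ?II" "snd z = 1/2" for z
      unfolding that(2) using that(1) h(4) k(4) assms(3) by auto
  qed (auto simp: II intro!: continuous_intros)
  then show ?thesis
    unfolding homotopic_pathsin_def homotopic_with_def
    by (intro exI[of _ ?H]) (use h k in \<open>auto simp: joinpaths_def\<close>)
qed

text \<open>Both sides are \<open>p\<close> composed with a path in [0,1] from \<open>a\<close> to
  \<open>c\<close>, and such paths are homotopic in the interval. The order of \<open>a\<close>,
  \<open>b\<close>, \<open>c\<close> is arbitrary: the triples (0,1,1), (0,0,1) and (0,1,0) give the
  two unit laws and the inverse law.\<close>

lemma homotopic_pathsin_split: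
  assumes p: "pathin T p" and abc: "a \<in> {0..1}" "b \<in> {0..1}" "c \<in> {0..1}"
  shows "homotopic_pathsin T (p \<circ> linepath a c) ((p \<circ> linepath a b) +++ (p \<circ> linepath b c))"
proof -
  have "path_image (linepath a b +++ linepath b c) \<subseteq> {0..1}"
    by (rule subset_path_image_join) (use abc linepath_image_01 in auto)
  then have "homotopic_pathsin T (p \<circ> linepath a c) (p \<circ> (linepath a b +++ linepath b c))"
    by (intro homotopic_pathsin_reparam[OF p])
       (use abc linepath_image_01 in \<open>auto intro!: path_join_imp\<close>)
  then show ?thesis
    by (simp add: path_compose_join)
qed

lemma homotopic_pathsin_assoc:
  assumes "pathin T p" "pathin T q" "pathin T r" "p 1 = q 0" "q 1 = r 0"
  shows "homotopic_pathsin T ((p +++ q) +++ r) (p +++ (q +++ r))"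
proof -
  let ?m = "p +++ (q +++ r)"
  \<comment> \<open>\<open>?f\<close> moves the breakpoints 1/4 and 1/2 of the left bracketing to
    the breakpoints 1/2 and 3/4 of the right one.\<close>
  let ?f = "(linepath 0 (1/2) +++ linepath (1/2) (3/4)) +++ linepath (3/4) (1::real)"
  have m: "pathin T ?m"
    using assms by (intro pathin_joinpaths) auto
  have "path_image ?f \<subseteq> {0..1}"
    by (intro subset_path_image_join) (use linepath_image_01 in auto)
  then have "homotopic_pathsin T (?m \<circ> ?f) (?m \<circ> linepath 0 1)"
    by (intro homotopic_pathsin_reparam[OF m])
       (use linepath_image_01 in \<open>auto intro!: path_join_imp\<close>)
  moreover have "?m \<circ> linepath 0 1 = ?m"
    by (auto simp: linepath_def)
  moreover have "homotopic_pathsin T ((p +++ q) +++ r) (?m \<circ> ?f)"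
  proof (rule homotopic_pathsin_eq)
    fix t :: real assume "0 \<le> t" "t \<le> 1"
    show "((p +++ q) +++ r) t = (?m \<circ> ?f) t"
      using assms(4,5) arg_cong[of "4 * t - 1" "(t * 32 - 8) / 8" q] arg_cong[of "2 * t - 1" "(t * 8 - 4) / 4" r]
      by (auto simp: joinpaths_def linepath_def field_simps)
  qed (use assms in \<open>auto intro!: pathin_joinpaths\<close>)
  ultimately show ?thesis
    using homotopic_pathsin_trans by metis
qed

lemma homotopic_pathsin_rid:
  assumes "pathin T p"
  shows "homotopic_pathsin T (p +++ (\<lambda>_. p 1)) p"
proof -
  have "homotopic_pathsin T ((p \<circ> linepath 0 1) +++ (p \<circ> linepath 1 1)) (p \<circ> linepath 0 1)"
    by (rule homotopic_pathsin_sym, rule homotopic_pathsin_split[OF assms]) auto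
  then show ?thesis
    by (simp add: linepath_def o_def)
qed

lemma homotopic_pathsin_lid:
  assumes "pathin T p"
  shows "homotopic_pathsin T ((\<lambda>_. p 0) +++ p) p"
proof -
  have "homotopic_pathsin T ((p \<circ> linepath 0 0) +++ (p \<circ> linepath 0 1)) (p \<circ> linepath 0 1)"
    by (rule homotopic_pathsin_sym, rule homotopic_pathsin_split[OF assms]) auto
  then show ?thesis
    by (simp add: linepath_def o_def)
qed

lemma homotopic_pathsin_rinv:
  assumes "pathin T p"
  shows "homotopic_pathsin T (p +++ reversepath p) (\<lambda>_. p 0)"
proof -
  have "homotopic_pathsin T ((p \<circ> linepath 0 1) +++ (p \<circ> linepath 1 0)) (p \<circ> linepath 0 0)"
    by (rule homotopic_pathsin_sym, rule homotopic_pathsin_split[OF assms]) auto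
  then show ?thesis
    by (simp add: linepath_def o_def reversepath_def)
qed

lemma homotopic_pathsin_linv:
  assumes "pathin T p"
  shows "homotopic_pathsin T (reversepath p +++ p) (\<lambda>_. p 1)"
  using homotopic_pathsin_rinv[OF pathin_reversepath[OF assms]] by simp

section \<open>The fundamental group\<close>

lemma fundamental_group_carrier:
  "A \<in> carrier (fundamental_group T x) \<longleftrightarrow> (\<exists>p. A = path_class T p \<and> pathin T p \<and> p 0 = x \<and> p 1 = x)"
  by (auto simp: fundamental_group_def)

lemma path_class_in_carrier:
  "pathin T p \<Longrightarrow> p 0 = x \<Longrightarrow> p 1 = x \<Longrightarrow> path_class T p \<in> carrier (fundamental_group T x)"
  by (auto simp: fundamental_group_def)

text \<open>The product is a union over representatives; homotopy invariance of concatenation makes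
  all its members equal, and reflexivity makes the union nonempty.\<close>

lemma fundamental_group_mult:
  assumes "pathin T p" "pathin T q" "p 1 = q 0"
  shows "path_class T p \<otimes>\<^bsub>fundamental_group T x\<^esub> path_class T q = path_class T (p +++ q)"
proof -
  have "path_class T (p' +++ q') = path_class T (p +++ q)"
    if "p' \<in> path_class T p" "q' \<in> path_class T q" for p' q'
    using homotopic_pathsin_join[of T p p' q q'] that assms(3) path_class_eq[of T "p +++ q" "p' +++ q'"]
    by (simp add: path_class_def)
  then have "(\<Union>p'\<in>path_class T p. \<Union>q'\<in>path_class T q. path_class T (p' +++ q')) =
      (\<Union>p'\<in>path_class T p. \<Union>q'\<in>path_class T q. path_class T (p +++ q))"
    by simp
  also have "\<dots> = path_class T (p +++ q)"
    using path_class_self[OF assms(1)] path_class_self[OF assms(2)] by blast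
  finally show ?thesis
    by (simp add: fundamental_group_def)
qed

lemma fundamental_group_one: "\<one>\<^bsub>fundamental_group T x\<^esub> = path_class T (\<lambda>_. x)"
  by (simp add: fundamental_group_def)

lemma group_fundamental_group:
  assumes x: "x \<in> topspace T"
  shows "group (fundamental_group T x)"
proof (rule groupI; (unfold fundamental_group_carrier)?)
  show "\<exists>p. \<one>\<^bsub>fundamental_group T x\<^esub> = path_class T p \<and> pathin T p \<and> p 0 = x \<and> p 1 = x"
    using x by (intro exI[of _ "\<lambda>_. x"]) (auto simp: fundamental_group_one)
next
  fix A B
  assume "\<exists>p. A = path_class T p \<and> pathin T p \<and> p 0 = x \<and> p 1 = x"
    and "\<exists>p. B = path_class T p \<and> pathin T p \<and> p 0 = x \<and> p 1 = x"
  then obtain p q where *: "A = path_class T p" "pathin T p" "p 0 = x" "p 1 = x"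
    "B = path_class T q" "pathin T q" "q 0 = x" "q 1 = x"
    by blast
  then show "\<exists>p. A \<otimes>\<^bsub>fundamental_group T x\<^esub> B = path_class T p \<and> pathin T p \<and> p 0 = x \<and> p 1 = x"
    by (intro exI[of _ "p +++ q"]) (simp add: fundamental_group_mult pathin_joinpaths)
  fix C
  assume "\<exists>p. C = path_class T p \<and> pathin T p \<and> p 0 = x \<and> p 1 = x"
  then obtain r where "C = path_class T r" "pathin T r" "r 0 = x" "r 1 = x"
    by blast
  with * show "A \<otimes>\<^bsub>fundamental_group T x\<^esub> B \<otimes>\<^bsub>fundamental_group T x\<^esub> C =
      A \<otimes>\<^bsub>fundamental_group T x\<^esub> (B \<otimes>\<^bsub>fundamental_group T x\<^esub> C)"
    by (simp add: fundamental_group_mult pathin_joinpaths path_class_eq homotopic_pathsin_assoc)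
next
  fix A
  assume "\<exists>p. A = path_class T p \<and> pathin T p \<and> p 0 = x \<and> p 1 = x"
  then obtain p where *: "A = path_class T p" "pathin T p" "p 0 = x" "p 1 = x"
    by blast
  then show "\<one>\<^bsub>fundamental_group T x\<^esub> \<otimes>\<^bsub>fundamental_group T x\<^esub> A = A"
    using x homotopic_pathsin_lid[of T p] 
    by (simp add: fundamental_group_one fundamental_group_mult path_class_eq)
  show "\<exists>y\<in>carrier (fundamental_group T x). y \<otimes>\<^bsub>fundamental_group T x\<^esub> A = \<one>\<^bsub>fundamental_group T x\<^esub>"
    using * homotopic_pathsin_linv[of T p] path_class_eq
    by (intro bexI[of _ "path_class T (reversepath p)"])
       (auto simp: fundamental_group_mult pathin_reversepath fundamental_group_one intro!: path_class_in_carrier)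
qed

text \<open>Conjugating by chosen paths from the base point turns every path into an element of the
  fundamental group, so that identities between paths become identities in a group.\<close>

locale based_space =
  fixes T :: "'a::topological_space topology" and x0 :: 'a and \<gamma> :: "'a \<Rightarrow> real \<Rightarrow> 'a"
  assumes base: "x0 \<in> topspace T" "\<gamma> x0 = (\<lambda>_. x0)"
    and tether: "\<And>y. y \<in> topspace T \<Longrightarrow> pathin T (\<gamma> y) \<and> \<gamma> y 0 = x0 \<and> \<gamma> y 1 = y"
begin

abbreviation "\<pi> \<equiv> fundamental_group T x0"

sublocale group \<pi>
  by (rule group_fundamental_group) (rule base)

definition closed_up :: "(real \<Rightarrow> 'a) \<Rightarrow> real \<Rightarrow> 'a" where
  "closed_up p = \<gamma> (p 0) +++ (p +++ reversepath (\<gamma> (p 1)))"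

definition loop_class :: "(real \<Rightarrow> 'a) \<Rightarrow> (real \<Rightarrow> 'a) set" where
  "loop_class p = path_class T (closed_up p)"

lemma closed_up:
  assumes "pathin T p"
  shows "pathin T (closed_up p)" "closed_up p 0 = x0" "closed_up p 1 = x0"
  using assms tether[of "p 0"] tether[of "p 1"] pathin_in_topspace[of T p 0] pathin_in_topspace[of T p 1]
  unfolding closed_up_def by (auto intro!: pathin_joinpaths pathin_reversepath)

lemma loop_class_carrier [simp]: "pathin T p \<Longrightarrow> loop_class p \<in> carrier \<pi>"
  unfolding loop_class_def by (intro path_class_in_carrier closed_up)

lemma loop_class_homotopic:
  assumes "homotopic_pathsin T p q"
  shows "loop_class p = loop_class q"
proof -
  note pq = homotopic_pathsin_imp[OF assms]
  have "homotopic_pathsin T (closed_up p) (closed_up q)"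
    unfolding closed_up_def pq(3,4)
    using tether[of "p 0"] tether[of "p 1"] pathin_in_topspace[OF pq(1), of 0] pathin_in_topspace[OF pq(1), of 1]
    by (intro homotopic_pathsin_join homotopic_pathsin_refl assms pathin_reversepath) auto
  then show ?thesis
    by (simp add: loop_class_def path_class_eq)
qed

lemma loop_class_eq:
  "pathin T p \<Longrightarrow> (\<And>t. 0 \<le> t \<Longrightarrow> t \<le> 1 \<Longrightarrow> p t = q t) \<Longrightarrow> loop_class p = loop_class q"
  using homotopic_pathsin_eq loop_class_homotopic by blast

text \<open>The tether of \<open>x0\<close> is constant, so closing up a based loop only adds
  constant paths. On based loops the two kinds of class therefore agree exactly, without a
  conjugation.\<close>

lemma loop_class_loop:
  assumes "pathin T p" "p 0 = x0" "p 1 = x0"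
  shows "loop_class p = path_class T p"
proof -
  have "homotopic_pathsin T (closed_up p) ((\<lambda>_. p 0) +++ (p +++ (\<lambda>_. p 1)))"
    using assms base by (simp add: closed_up_def reversepath_def homotopic_pathsin_refl pathin_joinpaths)
  also have "homotopic_pathsin T \<dots> ((\<lambda>_. p 0) +++ p)"
    using assms base
    by (intro homotopic_pathsin_join homotopic_pathsin_refl homotopic_pathsin_rid) (auto)
  also have "homotopic_pathsin T \<dots> p"
    using assms by (intro homotopic_pathsin_lid)
  finally show ?thesis
    by (simp add: loop_class_def path_class_eq)
qed

text \<open>The two tethers of the common endpoint cancel in the middle. Thus
  \<open>loop_class\<close> is a homomorphism from the fundamental groupoid to its vertex group at
  \<open>x0\<close>.\<close>

lemma loop_class_join:
  assumes p: "pathin T p" and q: "pathin T q" and pq: "p 1 = q 0"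
  shows "loop_class (p +++ q) = loop_class p \<otimes>\<^bsub>\<pi>\<^esub> loop_class q"
proof -
  let ?a = "\<gamma> (p 0)" and ?b = "\<gamma> (q 0)" and ?c = "\<gamma> (q 1)"
  have *: "pathin T ?a" "?a 1 = p 0" "pathin T ?b" "?b 0 = x0" "?b 1 = q 0" "pathin T ?c" "?c 0 = x0" "?c 1 = q 1"
    using tether pathin_in_topspace[OF p, of 0] pathin_in_topspace[OF q, of 0] pathin_in_topspace[OF q, of 1]
    by auto
  note I = homotopic_pathsin_join homotopic_pathsin_refl homotopic_pathsin_assoc pathin_joinpaths pathin_reversepath
  let ?q = "q +++ reversepath ?c"
  have "homotopic_pathsin T ((\<lambda>_. ?q 0) +++ ?q) ?q"
    by (intro homotopic_pathsin_lid I) (use * q in auto)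
  then have lid: "homotopic_pathsin T ((\<lambda>_. ?b 1) +++ ?q) ?q"
    using * by simp
  have "homotopic_pathsin T (closed_up p +++ closed_up q) (?a +++ ((p +++ reversepath ?b) +++ (?b +++ ?q)))"
    unfolding closed_up_def pq by (intro I) (use * p q pq in auto)
  also have "homotopic_pathsin T \<dots> (?a +++ (p +++ (reversepath ?b +++ (?b +++ ?q))))"
    by (intro I) (use * p q pq in auto)
  also have "homotopic_pathsin T \<dots> (?a +++ (p +++ ((reversepath ?b +++ ?b) +++ ?q)))"
    by (intro I homotopic_pathsin_sym[OF homotopic_pathsin_assoc]) (use * p q pq in auto)
  also have "homotopic_pathsin T \<dots> (?a +++ (p +++ ((\<lambda>_. ?b 1) +++ ?q)))"
    by (intro I homotopic_pathsin_linv) (use * p q pq in auto)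
  also have "homotopic_pathsin T \<dots> (?a +++ (p +++ ?q))"
    by (intro homotopic_pathsin_join homotopic_pathsin_refl pathin_joinpaths lid) (use * p q pq in auto)
  also have "homotopic_pathsin T \<dots> (closed_up (p +++ q))"
    unfolding closed_up_def joinpaths_ends
    by (intro I homotopic_pathsin_sym[OF homotopic_pathsin_assoc]) (use * p q pq in auto)
  finally have "path_class T (closed_up p +++ closed_up q) = path_class T (closed_up (p +++ q))"
    by (rule path_class_eq)
  then show ?thesis
    unfolding loop_class_def by (simp add: fundamental_group_mult closed_up p q)
qed

text \<open>A constant path is its own concatenation, so its class is idempotent and hence trivial,
  at every point of the space.\<close>

lemma loop_class_const [simp]:
  assumes "x \<in> topspace T"
  shows "loop_class (\<lambda>_. x) = \<one>\<^bsub>\<pi>\<^esub>"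
proof -
  have c: "pathin T (\<lambda>_. x)"
    using assms by simp
  have "loop_class ((\<lambda>_. x) +++ (\<lambda>_. x)) = loop_class (\<lambda>_. x)"
    by (simp add: joinpaths_def)
  then have "loop_class (\<lambda>_. x) \<otimes>\<^bsub>\<pi>\<^esub> loop_class (\<lambda>_. x) = loop_class (\<lambda>_. x)"
    using loop_class_join[OF c c] by simp
  then show ?thesis
    using loop_class_carrier[OF c] r_cancel_one by blast
qed

lemma loop_class_reverse:
  assumes "pathin T p"
  shows "loop_class (reversepath p) = inv\<^bsub>\<pi>\<^esub> (loop_class p)"
proof -
  have "loop_class (reversepath p) \<otimes>\<^bsub>\<pi>\<^esub> loop_class p = loop_class (\<lambda>_. p 1)"
    using assms by (simp flip: loop_class_join add: pathin_reversepath homotopic_pathsin_linv loop_class_homotopic)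
  also have "\<dots> = \<one>\<^bsub>\<pi>\<^esub>"
    using assms by (simp add: path_finish_in_topspace)
  finally show ?thesis
    using assms by (simp add: inv_equality pathin_reversepath)
qed

lemma loop_class_split:
  assumes "pathin T p" "a \<in> {0..1}" "b \<in> {0..1}" "c \<in> {0..1}"
  shows "loop_class (p \<circ> linepath a c) = loop_class (p \<circ> linepath a b) \<otimes>\<^bsub>\<pi>\<^esub> loop_class (p \<circ> linepath b c)"
  using loop_class_homotopic[OF homotopic_pathsin_split[OF assms]] assms
  by (simp add: loop_class_join pathin_linepath)

lemma carrier_loop_class:
  assumes "A \<in> carrier \<pi>"
  obtains p where "pathin T p" "p 0 = x0" "p 1 = x0" "A = path_class T p" "A = loop_class p"
  using assms loop_class_loop by (auto simp: fundamental_group_carrier)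

end

section \<open>Cocycles on open covers and their holonomy\<close>

text \<open>A trivialization of the cocycle \<open>g\<close> over \<open>D\<close> is a locally constant section of the
  associated principal bundle with discrete fibre; \<open>N v\<close> is the chart with index \<open>v\<close>.\<close>

definition trivialization ::
  "('g, 'm) monoid_scheme \<Rightarrow> ('v \<Rightarrow> 'z::topological_space set) \<Rightarrow> ('v \<Rightarrow> 'v \<Rightarrow> 'g) \<Rightarrow> 'z set \<Rightarrow> ('z \<Rightarrow> 'v \<Rightarrow> 'g) \<Rightarrow> bool" where
  "trivialization G N g D c \<longleftrightarrow> (\<forall>z\<in>D. (\<exists>v. z \<in> N v) \<and>
     (\<forall>v. z \<in> N v \<longrightarrow> c z v \<in> carrier G \<and>
        (\<exists>S. open S \<and> z \<in> S \<and> (\<forall>z'\<in>S \<inter> D. z' \<in> N v \<and> c z' v = c z v)) \<and>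
        (\<forall>w. z \<in> N w \<longrightarrow> g v w \<in> carrier G \<and> c z w = c z v \<otimes>\<^bsub>G\<^esub> g v w)))"

lemma trivializationI:
  assumes "\<And>z. z \<in> D \<Longrightarrow> \<exists>v. z \<in> N v"
    and "\<And>z v. z \<in> D \<Longrightarrow> z \<in> N v \<Longrightarrow> c z v \<in> carrier G"
    and "\<And>z v w. z \<in> D \<Longrightarrow> z \<in> N v \<Longrightarrow> z \<in> N w \<Longrightarrow> g v w \<in> carrier G"
    and "\<And>z v w. z \<in> D \<Longrightarrow> z \<in> N v \<Longrightarrow> z \<in> N w \<Longrightarrow> c z v \<otimes>\<^bsub>G\<^esub> g v w = c z w"
    and "\<And>z v. z \<in> D \<Longrightarrow> z \<in> N v \<Longrightarrow>
       \<exists>S. open S \<and> z \<in> S \<and> (\<forall>z'. z' \<in> S \<longrightarrow> z' \<in> D \<longrightarrow> z' \<in> N v \<and> c z' v = c z v)"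
  shows "trivialization G N g D c"
  unfolding trivialization_def
proof (intro ballI conjI allI impI)
  fix z v assume "z \<in> D" "z \<in> N v"
  then show "\<exists>S. open S \<and> z \<in> S \<and> (\<forall>z'\<in>S \<inter> D. z' \<in> N v \<and> c z' v = c z v)"
    using assms(5)[of z v] by (simp add: Ball_def imp_conjL)
qed (simp_all add: assms(1-4))

lemma trivializationD:
  assumes "trivialization G N g D c" "z \<in> D"
  shows "\<exists>v. z \<in> N v"
    and "z \<in> N v \<Longrightarrow> c z v \<in> carrier G"
    and "z \<in> N v \<Longrightarrow> z \<in> N w \<Longrightarrow> g v w \<in> carrier G"
    and "z \<in> N v \<Longrightarrow> z \<in> N w \<Longrightarrow> c z v \<otimes>\<^bsub>G\<^esub> g v w = c z w"
    and "z \<in> N v \<Longrightarrow> \<exists>S. open S \<and> z \<in> S \<and> (\<forall>z'\<in>S \<inter> D. z' \<in> N v \<and> c z' v = c z v)"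
  using assms unfolding trivialization_def by metis+

lemma trivialization_pullback:
  assumes c: "trivialization G N g D c" and f: "continuous_on D' f" "f ` D' \<subseteq> D"
    and N: "\<And>z v. z \<in> D' \<Longrightarrow> z \<in> N' v \<longleftrightarrow> f z \<in> N v"
  shows "trivialization G N' g D' (c \<circ> f)"
proof (rule trivializationI)
  fix z v assume z: "z \<in> D'" "z \<in> N' v"
  then have fz: "f z \<in> D" "f z \<in> N v"
    using f N by auto
  obtain S where S: "open S" "f z \<in> S" "\<And>y. y \<in> S \<Longrightarrow> y \<in> D \<Longrightarrow> y \<in> N v \<and> c y v = c (f z) v"
    using trivializationD(5)[OF c fz] by auto
  obtain A where A: "open A" "z \<in> A" "\<And>y. y \<in> D' \<Longrightarrow> y \<in> A \<Longrightarrow> f y \<in> S"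
    using f(1) z(1) S(1,2) unfolding continuous_on_topological by meson
  show "\<exists>S. open S \<and> z \<in> S \<and> (\<forall>z'. z' \<in> S \<longrightarrow> z' \<in> D' \<longrightarrow> z' \<in> N' v \<and> (c \<circ> f) z' v = (c \<circ> f) z v)"
    using A S N f(2) by (intro exI[of _ A]) auto
qed (use f N trivializationD(1-4)[OF c] in \<open>auto simp: image_subset_iff\<close>)

lemma trivialization_subset:
  assumes "trivialization G N g D c" "D' \<subseteq> D"
  shows "trivialization G N g D' c"
proof -
  have "trivialization G N g D' (c \<circ> (\<lambda>z. z))"
    by (rule trivialization_pullback[OF assms(1) continuous_on_id]) (use assms(2) in auto)
  then show ?thesis
    by (simp add: o_def)
qed

text \<open>Inside a single chart a section is an ordinary locally constant function, so
  connectedness applies to it directly.\<close>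

lemma trivialization_const:
  assumes c: "trivialization G N g D c" and D: "connected D" "D \<subseteq> N v" "y \<in> D" "z \<in> D"
  shows "c y v = c z v"
proof (rule connected_local_const[where f = "\<lambda>z. c z v", OF D(1,3,4)], rule ballI)
  fix a assume a: "a \<in> D"
  then have "a \<in> N v"
    using D(2) by blast
  from trivializationD(5)[OF c a this]
  obtain S where "open S" "a \<in> S" "\<forall>z'\<in>S \<inter> D. z' \<in> N v \<and> c z' v = c a v"
    by blast
  then show "\<forall>\<^sub>F b in at a within D. c a v = c b v"
    unfolding eventually_at_topological by (intro exI[of _ S]) auto
qed

section \<open>Gluing sections: uniqueness, unions and the unit square\<close>

context group begin

lemma trivialization_mult_left:
  assumes "trivialization G N g D c" "k \<in> carrier G"
  shows "trivialization G N g D (\<lambda>z v. k \<otimes> c z v)"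
proof (rule trivializationI)
  fix z v assume z: "z \<in> D" "z \<in> N v"
  show "\<exists>S. open S \<and> z \<in> S \<and> (\<forall>z'. z' \<in> S \<longrightarrow> z' \<in> D \<longrightarrow> z' \<in> N v \<and> k \<otimes> c z' v = k \<otimes> c z v)"
    using trivializationD(5)[OF assms(1) z] by fastforce
qed (use assms(2) trivializationD(1-4)[OF assms(1)] in \<open>auto simp: m_assoc\<close>)

text \<open>The ratio of two sections at \<open>z\<close> does not depend on the chart in which it
  is read, because \<open>g v w\<close> cancels. It is therefore a locally constant function of
  \<open>z\<close> alone, and connectedness turns it into the single factor
  \<open>k\<close>.\<close>

lemma trivialization_unique:
  assumes c: "trivialization G N g D c" and c': "trivialization G N g D c'" and "connected D"
  obtains k where "k \<in> carrier G" "\<And>z v. z \<in> D \<Longrightarrow> z \<in> N v \<Longrightarrow> c' z v = k \<otimes> c z v"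
proof (cases "D = {}")
  case True
  then show ?thesis
    using that[of \<one>] by simp
next
  case False
  then obtain z0 where z0: "z0 \<in> D"
    by blast
  define f where "f z = (let v = SOME v. z \<in> N v in c' z v \<otimes> inv (c z v))" for z
  have f: "f z = c' z w \<otimes> inv (c z w)" if z: "z \<in> D" "z \<in> N w" for z w
  proof -
    define v where "v = (SOME v. z \<in> N v)"
    have v: "z \<in> N v"
      unfolding v_def using someI[of "\<lambda>v. z \<in> N v"] z by blast
    note * = trivializationD(2)[OF c z(1) v] trivializationD(2)[OF c' z(1) v] trivializationD(3)[OF c z(1) v z(2)]
    have "c' z w \<otimes> inv (c z w) = c' z v \<otimes> (g v w \<otimes> (inv (g v w) \<otimes> inv (c z v)))"
      using trivializationD(4)[OF c z(1) v z(2), symmetric] trivializationD(4)[OF c' z(1) v z(2), symmetric] *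
      by (simp add: inv_mult_group m_assoc)
    also have "\<dots> = c' z v \<otimes> inv (c z v)"
      using * by (simp flip: m_assoc[of "g v w"])
    finally show ?thesis
      unfolding f_def Let_def v_def[symmetric] by simp
  qed
  have "f z = f z0" if "z \<in> D" for z
  proof (rule connected_local_const[where f = f, OF \<open>connected D\<close> that z0], rule ballI)
    fix a assume a: "a \<in> D"
    then obtain v where v: "a \<in> N v"
      using trivializationD(1)[OF c] by blast
    obtain S where S: "open S" "a \<in> S" "\<forall>z'\<in>S \<inter> D. z' \<in> N v \<and> c z' v = c a v"
      using trivializationD(5)[OF c a v] by blast
    obtain S' where S': "open S'" "a \<in> S'" "\<forall>z'\<in>S' \<inter> D. z' \<in> N v \<and> c' z' v = c' a v"
      using trivializationD(5)[OF c' a v] by blast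
    have "f a = f b" if "b \<in> S" "b \<in> S'" "b \<in> D" for b
      using S S' f[OF a v] f[of b v] that by simp
    then show "\<forall>\<^sub>F b in at a within D. f a = f b"
      unfolding eventually_at_topological
      using S S' by (intro exI[of _ "S \<inter> S'"]) auto
  qed
  then have "c' z v = f z0 \<otimes> c z v" if "z \<in> D" "z \<in> N v" for z v
    using that f[OF that] trivializationD(2)[OF c that] trivializationD(2)[OF c' that] by (simp add: m_assoc)
  moreover have "f z0 \<in> carrier G"
    using trivializationD(1,2)[OF c z0] trivializationD(2)[OF c' z0] f[OF z0] by auto
  ultimately show ?thesis
    using that by blast
qed

text \<open>The overlap is connected, so the sections differ there by one left factor, and
  multiplying \<open>cA\<close> by it makes them agree. Closedness gives a point outside one piece a
  neighbourhood that avoids this piece, so local constancy can be checked within each piece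
  separately.\<close>

lemma trivialization_Un:
  assumes A: "trivialization G N g A cA" and B: "trivialization G N g B cB"
    and closed: "closed A" "closed B" and conn: "connected (A \<inter> B)"
  shows "\<exists>c. trivialization G N g (A \<union> B) c"
proof -
  obtain k where k: "k \<in> carrier G" and eq: "\<And>z v. z \<in> A \<inter> B \<Longrightarrow> z \<in> N v \<Longrightarrow> cB z v = k \<otimes> cA z v"
    using trivialization_unique[OF trivialization_subset[OF A, of "A \<inter> B"] trivialization_subset[OF B, of "A \<inter> B"]] conn
    by auto
  define c where "c z v = (if z \<in> A then k \<otimes> cA z v else cB z v)" for z v
  have cA: "trivialization G N g A (\<lambda>z v. k \<otimes> cA z v)"
    by (rule trivialization_mult_left[OF A k])
  have c1: "c z v = k \<otimes> cA z v" if "z \<in> A" for z v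
    using that by (simp add: c_def)
  have c2: "c z v = cB z v" if "z \<in> B" "z \<in> N v" for z v
    using that eq by (auto simp: c_def)
  have "trivialization G N g (A \<union> B) c"
  proof (rule trivializationI)
    fix z v assume z: "z \<in> A \<union> B" "z \<in> N v"
    have "\<exists>S. open S \<and> z \<in> S \<and> (\<forall>z'\<in>S \<inter> A. z' \<in> N v \<and> c z' v = c z v)"
    proof (cases "z \<in> A")
      case True
      then show ?thesis
        using trivializationD(5)[OF cA True z(2)] by (auto simp: c1)
    next
      case False
      then show ?thesis
        using closed by (intro exI[of _ "- A"]) auto
    qed
    moreover have "\<exists>S. open S \<and> z \<in> S \<and> (\<forall>z'\<in>S \<inter> B. z' \<in> N v \<and> c z' v = c z v)"
    proof (cases "z \<in> B")
      case True
      then show ?thesis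
        using trivializationD(5)[OF B True z(2)] c2[OF _ z(2)] c2[of _ v] by (metis IntD2)
    next
      case False
      then show ?thesis
        using closed by (intro exI[of _ "- B"]) auto
    qed
    ultimately obtain S S' where "open S" "z \<in> S" "\<forall>z'\<in>S \<inter> A. z' \<in> N v \<and> c z' v = c z v"
      "open S'" "z \<in> S'" "\<forall>z'\<in>S' \<inter> B. z' \<in> N v \<and> c z' v = c z v"
      by blast
    then show "\<exists>S. open S \<and> z \<in> S \<and> (\<forall>z'. z' \<in> S \<longrightarrow> z' \<in> A \<union> B \<longrightarrow> z' \<in> N v \<and> c z' v = c z v)"
      by (intro exI[of _ "S \<inter> S'"]) auto
  next
    fix z v w assume "z \<in> A \<union> B" "z \<in> N v" "z \<in> N w"
    then show "c z v \<otimes> g v w = c z w"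
      using trivializationD(4)[OF cA] trivializationD(4)[OF B] by (cases "z \<in> A") (auto simp: c_def)
  qed (use trivializationD(1-4)[OF cA] trivializationD(1-4)[OF B] in \<open>auto simp: c_def\<close>)
  then show ?thesis
    by blast
qed

text \<open>Over a part of one chart \<open>u\<close> the transition elements out of
  \<open>u\<close> are themselves a section: the compatibility required of it is the cocycle
  identity.\<close>

lemma trivialization_chart:
  assumes "D \<subseteq> N u" "\<And>v. openin (top_of_set D) (N v \<inter> D)"
    and "\<And>z u v w. z \<in> D \<Longrightarrow> z \<in> N u \<Longrightarrow> z \<in> N v \<Longrightarrow> z \<in> N w \<Longrightarrow> g u v \<in> carrier G \<and> g u v \<otimes> g v w = g u w"
  shows "trivialization G N g D (\<lambda>z v. g u v)"
proof (rule trivializationI)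
  fix z v assume "z \<in> D" "z \<in> N v"
  then show "\<exists>S. open S \<and> z \<in> S \<and> (\<forall>z'. z' \<in> S \<longrightarrow> z' \<in> D \<longrightarrow> z' \<in> N v \<and> g u v = g u v)"
    using assms(2)[of v] unfolding openin_open by auto
qed (use assms in blast)+

text \<open>Small rectangles lie in one chart, and sections extend over adjacent rectangles because
  these meet in convex, hence connected, sets. Interval bisection in the second coordinate produces
  thin vertical strips; bisection in the first coordinate then produces the square.\<close>

lemma trivialization_square:
  fixes N :: "'v \<Rightarrow> (real \<times> real) set"
  defines "Q \<equiv> {0..1} \<times> {0..1}"
  assumes op: "\<And>v. openin (top_of_set Q) (N v \<inter> Q)" and cover: "Q \<subseteq> (\<Union>v. N v)"
    and cocycle: "\<And>z u v w. z \<in> Q \<Longrightarrow> z \<in> N u \<Longrightarrow> z \<in> N v \<Longrightarrow> z \<in> N w \<Longrightarrow> g u v \<in> carrier G \<and> g u v \<otimes> g v w = g u w"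
  shows "\<exists>c. trivialization G N g Q c"
proof -
  \<comment> \<open>Rectangles may stick out of the square and are cut off by \<open>Q\<close>, so
    points on its sides are treated like all others.\<close>
  define R where "R a b c d = ({a..b} \<times> {c..d}) \<inter> Q" for a b c d :: real
  have R: "closed (R a b c d)" "convex (R a b c d)" for a b c d
    unfolding R_def Q_def by (intro closed_Int closed_Times convex_Int convex_Times; simp)+
  have conn: "connected (R a b c d \<inter> R a' b' c' d')" for a b c d a' b' c' d'
    by (intro convex_connected convex_Int R)
  define P where "P a b c d \<longleftrightarrow> (\<exists>t. trivialization G N g (R a b c d) t)" for a b c d
  have mono: "P a' b' c' d'" if "P a b c d" "a \<le> a'" "b' \<le> b" "c \<le> c'" "d' \<le> d" for a b c d a' b' c' d'
  proof -
    have "R a' b' c' d' \<subseteq> R a b c d"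
      using that by (auto simp: R_def)
    then show ?thesis
      using that(1) trivialization_subset unfolding P_def by blast
  qed
  \<comment> \<open>The horizontal extent around \<open>x\<close> is fixed by \<open>e\<close>,
    while the vertical one ranges over all short intervals around \<open>y\<close>. This is the
    local hypothesis for bisecting the second coordinate.\<close>
  have local: "\<exists>e>0. \<forall>c d. c \<le> y \<and> y \<le> d \<and> d - c < e \<longrightarrow> P (x - e) (x + e) c d"
    if xy: "(x, y) \<in> Q" for x y
  proof -
    obtain v where v: "(x, y) \<in> N v"
      using cover xy by blast
    obtain S where S: "open S" "N v \<inter> Q = Q \<inter> S"
      using op[of v] unfolding openin_open by blast
    then obtain e where e: "e > 0" "ball (x, y) e \<subseteq> S"
      using v xy by (metis IntD2 IntI openE)
    \<comment> \<open>With \<open>e / 2\<close> in each coordinate the two differences add up to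
      less than \<open>e\<close>, which bounds the distance in the plane.\<close>
    have "P (x - e/2) (x + e/2) c d" if "c \<le> y" "y \<le> d" "d - c < e/2" for c d
    proof -
      have sub: "R (x - e/2) (x + e/2) c d \<subseteq> N v"
      proof
        fix z assume z: "z \<in> R (x - e/2) (x + e/2) c d"
        obtain x' y' where [simp]: "z = (x', y')"
          by (cases z)
        have "\<bar>x - x'\<bar> \<le> e/2" "\<bar>y - y'\<bar> < e/2"
          using z that unfolding R_def by (auto simp: abs_if)
        moreover have "dist (x, y) (x', y') \<le> \<bar>x - x'\<bar> + \<bar>y - y'\<bar>"
          by (simp add: dist_Pair_Pair dist_real_def) (metis power2_abs sqrt_sum_squares_le_sum_abs)
        ultimately have "z \<in> ball (x, y) e"
          by simp
        then show "z \<in> N v"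
          using e S z by (auto simp: R_def)
      qed
      have "openin (top_of_set (R (x - e/2) (x + e/2) c d)) (N w \<inter> R (x - e/2) (x + e/2) c d)" for w
      proof -
        have "R (x - e/2) (x + e/2) c d \<subseteq> Q"
          by (auto simp: R_def)
        then show ?thesis
          using op[of w] unfolding openin_open by blast
      qed
      then have "trivialization G N g (R (x - e/2) (x + e/2) c d) (\<lambda>z w. g v w)"
        by (intro trivialization_chart[where N = N and u = v, OF sub] cocycle) (auto simp: R_def)
      then show ?thesis
        unfolding P_def by blast
    qed
    then show ?thesis
      using e(1) by (intro exI[of _ "e/2"]) auto
  qed
  have strip: "\<exists>e>0. P (x - e) (x + e) 0 1" if x: "x \<in> {0..1}" for x
  proof (rule Bolzano[of 0 1 "\<lambda>c d. \<exists>e>0. P (x - e) (x + e) c d"])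
    fix a b c :: real
    assume "\<exists>e>0. P (x - e) (x + e) a b" "\<exists>e>0. P (x - e) (x + e) b c" and abc: "a \<le> b" "b \<le> c"
    then obtain e1 e2 where e: "e1 > 0" "P (x - e1) (x + e1) a b" "e2 > 0" "P (x - e2) (x + e2) b c"
      by blast
    \<comment> \<open>The two stacked pieces come with different widths; both are cut down to the
      smaller one.\<close>
    define e where "e = min e1 e2"
    have "P (x - e) (x + e) a b" "P (x - e) (x + e) b c"
      by (rule mono[OF e(2)] mono[OF e(4)]; simp add: e_def)+
    moreover have "R (x - e) (x + e) a b \<union> R (x - e) (x + e) b c = R (x - e) (x + e) a c"
      using abc by (auto simp: R_def)
    ultimately have "P (x - e) (x + e) a c"
      using trivialization_Un[OF _ _ R(1) R(1) conn] unfolding P_def by metis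
    then show "\<exists>e>0. P (x - e) (x + e) a c"
      using e by (intro exI[of _ e]) (auto simp: e_def)
  next
    fix y :: real assume "0 \<le> y" "y \<le> 1"
    then obtain e where "e > 0" "\<And>c d. c \<le> y \<and> y \<le> d \<and> d - c < e \<Longrightarrow> P (x - e) (x + e) c d"
      using local[of x y] x unfolding Q_def by auto
    then show "\<exists>e>0. \<forall>c d. c \<le> y \<and> y \<le> d \<and> d - c < e \<longrightarrow> (\<exists>e>0. P (x - e) (x + e) c d)"
      by blast
  qed simp
  have "P 0 1 0 1"
  proof (rule Bolzano[of 0 1 "\<lambda>a b. P a b 0 1"])
    fix a b c :: real
    assume P: "P a b 0 1" "P b c 0 1" and abc: "a \<le> b" "b \<le> c"
    have "R a b 0 1 \<union> R b c 0 1 = R a c 0 1"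
      using abc by (auto simp: R_def)
    then show "P a c 0 1"
      using P trivialization_Un[OF _ _ R(1) R(1) conn] unfolding P_def by metis
  next
    fix x :: real assume "0 \<le> x" "x \<le> 1"
    then obtain e where e: "e > 0" "P (x - e) (x + e) 0 1"
      using strip[of x] by auto
    then have "P a b 0 1" if "a \<le> x" "x \<le> b" "b - a < e" for a b
      by (intro mono[OF e(2)]) (use that in auto)
    then show "\<exists>e>0. \<forall>a b. a \<le> x \<and> x \<le> b \<and> b - a < e \<longrightarrow> P a b 0 1"
      using e by blast
  qed simp
  moreover have "R 0 1 0 1 = Q"
    by (auto simp: R_def Q_def)
  ultimately show ?thesis
    by (simp add: P_def)
qed

end

text \<open>The holonomy along \<open>p\<close> is read in the chart \<open>u\<close> at the start and in the chart \<open>w\<close> at the end. It does not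
  depend on the trivialization, since any two of them differ by a constant left factor.\<close>

definition holonomy ::
  "('g, 'm) monoid_scheme \<Rightarrow> ('v \<Rightarrow> 'a set) \<Rightarrow> ('v \<Rightarrow> 'v \<Rightarrow> 'g) \<Rightarrow> (real \<Rightarrow> 'a) \<Rightarrow> 'v \<Rightarrow> 'v \<Rightarrow> 'g" where
  "holonomy G U g p u w =
    (let c = SOME c. trivialization G (\<lambda>v. p -` U v) g {0..1} c in inv\<^bsub>G\<^esub> (c 0 u) \<otimes>\<^bsub>G\<^esub> c 1 w)"

lemma (in group) holonomy_eq:
  assumes c: "trivialization G (\<lambda>v. p -` U v) g {0..1} c" and ends: "p 0 \<in> U u" "p 1 \<in> U w"
  shows "holonomy G U g p u w = inv (c 0 u) \<otimes> c 1 w"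
proof -
  define c' where "c' = (SOME c. trivialization G (\<lambda>v. p -` U v) g {0..1} c)"
  have c': "trivialization G (\<lambda>v. p -` U v) g {0..1} c'"
    unfolding c'_def by (rule someI[where P = "trivialization G (\<lambda>v. p -` U v) g {0..1}"]) (rule c)
  obtain k where k: "k \<in> carrier G" "\<And>z v. z \<in> {0..1} \<Longrightarrow> z \<in> p -` U v \<Longrightarrow> c' z v = k \<otimes> c z v"
    using trivialization_unique[OF c c'] by auto
  have *: "c 0 u \<in> carrier G" "c 1 w \<in> carrier G"
    using trivializationD(2)[OF c] ends by auto
  have "inv (c' 0 u) \<otimes> c' 1 w = inv (c 0 u) \<otimes> (inv k \<otimes> (k \<otimes> c 1 w))"
    using k ends * by (simp add: inv_mult_group m_assoc)
  also have "\<dots> = inv (c 0 u) \<otimes> c 1 w"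
    using k * by (simp flip: m_assoc[of _ k])
  finally show ?thesis
    by (simp add: holonomy_def c'_def)
qed

locale cocycle = group G for G :: "('b, 'm) monoid_scheme" (structure) +
  fixes T :: "'a::topological_space topology" and U :: "'v \<Rightarrow> 'a set" and g :: "'v \<Rightarrow> 'v \<Rightarrow> 'b"
  assumes chart_open: "\<And>v. openin T (U v)"
    and charts_cover: "topspace T \<subseteq> (\<Union>v. U v)"
    and transition_closed: "\<And>x u v. x \<in> U u \<Longrightarrow> x \<in> U v \<Longrightarrow> g u v \<in> carrier G"
    and transition: "\<And>x u v w. x \<in> U u \<Longrightarrow> x \<in> U v \<Longrightarrow> x \<in> U w \<Longrightarrow> g u v \<otimes> g v w = g u w"
begin

lemma transition_same: "x \<in> U u \<Longrightarrow> g u u = \<one>"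
  using transition[of x u u u] transition_closed[of x u u] r_cancel_one by blast

lemma vimage_chart_open:
  assumes "continuous_map (top_of_set D) T H"
  shows "openin (top_of_set D) (H -` U v \<inter> D)"
  using openin_continuous_map_preimage[OF assms chart_open[of v]] by (simp add: vimage_def Int_def conj_commute)

lemma trivialization_square_map:
  assumes H: "continuous_map (top_of_set ({0..1::real} \<times> {0..1::real})) T H"
  shows "\<exists>c. trivialization G (\<lambda>v. H -` U v) g ({0..1::real} \<times> {0..1::real}) c"
proof (rule trivialization_square)
  show "{0..1} \<times> {0..1} \<subseteq> (\<Union>v. H -` U v)"
  proof
    fix z :: "real \<times> real" assume "z \<in> {0..1} \<times> {0..1}"
    then have "H z \<in> topspace T"
      using H unfolding continuous_map_def by auto
    then show "z \<in> (\<Union>v. H -` U v)"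
      using charts_cover by auto
  qed
qed (use vimage_chart_open[OF H] transition_closed transition in auto)

text \<open>The path is extended to the square, constant in the first variable, and the section over
  the square is restricted to a slice.\<close>

lemma trivialization_path:
  assumes p: "pathin T p"
  shows "\<exists>c. trivialization G (\<lambda>v. p -` U v) g {0..1} c"
proof -
  have "continuous_map (top_of_set ({0..1::real} \<times> {0..1::real})) T (p \<circ> snd)"
    by (rule continuous_map_compose[OF _ p[unfolded pathin_def]]) (auto intro!: continuous_intros)
  then obtain c where c: "trivialization G (\<lambda>v. (p \<circ> snd) -` U v) g ({0..1::real} \<times> {0..1::real}) c"
    using trivialization_square_map by blast
  have "trivialization G (\<lambda>v. p -` U v) g {0..1} (c \<circ> (\<lambda>t. (0, t)))"
    by (rule trivialization_pullback[OF c]) (auto intro!: continuous_intros)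
  then show ?thesis
    by blast
qed

lemma holonomy_closed [simp]:
  assumes p: "pathin T p" "p 0 \<in> U u" "p 1 \<in> U w"
  shows "holonomy G U g p u w \<in> carrier G"
proof -
  obtain c where "trivialization G (\<lambda>v. p -` U v) g {0..1} c"
    using trivialization_path[OF p(1)] by blast
  then show ?thesis
    using holonomy_eq[of p U g c u w] p(2,3) trivializationD(2)[of G "\<lambda>v. p -` U v" g "{0..1}" c] by auto
qed

lemma holonomy_chart:
  assumes p: "pathin T p" and "\<And>t. t \<in> {0..1} \<Longrightarrow> p t \<in> U u" and w: "p 1 \<in> U w"
  shows "holonomy G U g p u w = g u w"
proof -
  have "trivialization G (\<lambda>v. p -` U v) g {0..1} (\<lambda>t v. g u v)"
  proof (rule trivialization_chart)
    show "openin (top_of_set {0..1}) (p -` U v \<inter> {0..1})" for v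
      using vimage_chart_open[OF p[unfolded pathin_def]] .
  qed (use assms transition transition_closed in auto)
  then have "holonomy G U g p u w = inv (g u u) \<otimes> g u w"
    by (rule holonomy_eq) (use assms in auto)
  then show ?thesis
    using transition_same[of "p 1" u] transition_closed[of "p 1" u w] assms by simp
qed

text \<open>One section along the whole path restricts to sections along both halves. Its value at
  time 1/2, read in the chart \<open>v\<close>, cancels in the product.\<close>

lemma holonomy_join:
  assumes p: "pathin T p" and q: "pathin T q" and pq: "p 1 = q 0"
    and ends: "p 0 \<in> U u" "p 1 \<in> U v" "q 1 \<in> U w"
  shows "holonomy G U g (p +++ q) u w = holonomy G U g p u v \<otimes> holonomy G U g q v w"
proof -
  obtain c where c: "trivialization G (\<lambda>v. (p +++ q) -` U v) g {0..1} c"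
    using trivialization_path[OF pathin_joinpaths[OF p q pq]] by blast
  have half: "(2 * z + 2) / 2 - 1 = z" for z :: real
    by (simp add: field_simps)
  have 1: "trivialization G (\<lambda>v. p -` U v) g {0..1} (c \<circ> (\<lambda>t. t / 2))"
    by (rule trivialization_pullback[OF c]) (auto intro!: continuous_intros simp: joinpaths_def)
  have 2: "trivialization G (\<lambda>v. q -` U v) g {0..1} (c \<circ> (\<lambda>t. (t + 1) / 2))"
    by (rule trivialization_pullback[OF c]) (use pq in \<open>auto intro!: continuous_intros simp: joinpaths_def half\<close>)
  have mem: "c 0 u \<in> carrier G" "c (1/2) v \<in> carrier G" "c 1 w \<in> carrier G"
    using trivializationD(2)[OF c, of 0 u] trivializationD(2)[OF c, of "1/2" v] trivializationD(2)[OF c, of 1 w] ends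
    by (auto simp: joinpaths_def)
  have "holonomy G U g (p +++ q) u w = inv (c 0 u) \<otimes> c 1 w"
    by (rule holonomy_eq[OF c]) (use ends in auto)
  moreover have "holonomy G U g p u v = inv (c 0 u) \<otimes> c (1/2) v"
    using holonomy_eq[OF 1 ends(1,2)] by simp
  moreover have "holonomy G U g q v w = inv (c (1/2) v) \<otimes> c 1 w"
    using holonomy_eq[OF 2 _ ends(3), of v] pq ends by simp
  ultimately show ?thesis
    using mem by (simp add: m_assoc) (simp flip: m_assoc)
qed

text \<open>A section over the square of the homotopy restricts to sections along \<open>p\<close>
  and \<open>q\<close> on two opposite sides. On the other two sides the homotopy stands still, so
  the section is constant there and both holonomies are formed from the same end values.\<close>

lemma holonomy_homotopic:
  assumes pq: "homotopic_pathsin T p q" and ends: "p 0 \<in> U u" "p 1 \<in> U w"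
  shows "holonomy G U g p u w = holonomy G U g q u w"
proof -
  obtain h where h: "continuous_map (prod_topology (top_of_set {0..1}) (top_of_set {0..1::real})) T h"
    "\<And>x. h (0::real, x) = p x" "\<And>x. h (1, x) = q x" "\<And>t. t \<in> {0..1} \<Longrightarrow> h (t, 0) = p 0 \<and> h (t, 1) = p 1"
    using pq unfolding homotopic_pathsin_def homotopic_with_def by blast
  then have "continuous_map (top_of_set ({0..1} \<times> {0..1})) T h"
    by (simp add: prod_topology_subtopology subtopology_subtopology Times_Int_Times)
  then obtain c where c: "trivialization G (\<lambda>v. h -` U v) g ({0..1::real} \<times> {0..1::real}) c"
    using trivialization_square_map by blast
  have 1: "trivialization G (\<lambda>v. p -` U v) g {0..1} (c \<circ> (\<lambda>t. (0, t)))"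
    by (rule trivialization_pullback[OF c]) (auto intro!: continuous_intros simp: h)
  have 2: "trivialization G (\<lambda>v. q -` U v) g {0..1} (c \<circ> (\<lambda>t. (1, t)))"
    by (rule trivialization_pullback[OF c]) (auto intro!: continuous_intros simp: h)
  have side: "c (0, i) v = c (1, i) v" if "i = 0 \<or> i = 1" "h (0, i) \<in> U v" for i v
  proof -
    have "trivialization G (\<lambda>v. (\<lambda>t. h (t, i)) -` U v) g {0..1} (c \<circ> (\<lambda>t. (t, i)))"
      by (rule trivialization_pullback[OF c]) (use that in \<open>auto intro!: continuous_intros\<close>)
    moreover have "{0..1} \<subseteq> (\<lambda>t. h (t, i)) -` U v"
      using that h(4) h(4)[of 0] h(2) by auto
    ultimately show ?thesis
      using trivialization_const[where v = v and y = 0 and z = 1] by fastforce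
  qed
  have "q 0 = p 0" "q 1 = p 1"
    using homotopic_pathsin_imp[OF pq] by auto
  then show ?thesis
    using holonomy_eq[OF 1 ends] holonomy_eq[OF 2, of u w] ends side[of 0 u] side[of 1 w] h(2) by simp
qed

text \<open>A section followed by \<open>\<phi>\<close> is a section for the image cocycle. With
  \<open>\<phi>\<close> a comparison homomorphism this computes the composites; with
  \<open>\<phi>\<close> a natural quotient map it gives the compatibility with bonding maps.\<close>

lemma holonomy_hom:
  assumes "group H" and \<phi>: "\<phi> \<in> hom G H" and p: "pathin T p" and ends: "p 0 \<in> U u" "p 1 \<in> U w"
  shows "holonomy H U (\<lambda>u v. \<phi> (g u v)) p u w = \<phi> (holonomy G U g p u w)"
proof -
  interpret H: group H
    by fact
  interpret group_hom G H \<phi>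
    by unfold_locales (rule \<phi>)
  obtain c where c: "trivialization G (\<lambda>v. p -` U v) g {0..1} c"
    using trivialization_path[OF p] by blast
  have "trivialization H (\<lambda>v. p -` U v) (\<lambda>u v. \<phi> (g u v)) {0..1} (\<lambda>t v. \<phi> (c t v))"
  proof (rule trivializationI)
    fix z v assume z: "z \<in> {0..1}" "z \<in> p -` U v"
    show "\<exists>S. open S \<and> z \<in> S \<and> (\<forall>z'. z' \<in> S \<longrightarrow> z' \<in> {0..1} \<longrightarrow> z' \<in> p -` U v \<and> \<phi> (c z' v) = \<phi> (c z v))"
      using trivializationD(5)[OF c z] by (metis IntI)
  next
    fix z v w assume z: "z \<in> {0..1}" "z \<in> p -` U v" "z \<in> p -` U w"
    then show "\<phi> (c z v) \<otimes>\<^bsub>H\<^esub> \<phi> (g v w) = \<phi> (c z w)"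
      using trivializationD(2,3)[OF c] by (simp flip: trivializationD(4)[OF c, of z v w])
  qed (use trivializationD(1-3)[OF c] in auto)
  from H.holonomy_eq[OF this ends] show ?thesis
    using holonomy_eq[OF c ends] trivializationD(2)[OF c] ends by simp
qed

text \<open>Multiplying \<open>c t v\<close> on the right by the inverse of \<open>k v\<close> gives
  a section for the transformed cocycle. Such a change of frame, one group element for each chart,
  will absorb the choice of tethers.\<close>

lemma holonomy_gauge:
  assumes k: "\<And>v. k v \<in> carrier G" and p: "pathin T p" and ends: "p 0 \<in> U u" "p 1 \<in> U w"
  shows "holonomy G U (\<lambda>u v. k u \<otimes> g u v \<otimes> inv (k v)) p u w = k u \<otimes> holonomy G U g p u w \<otimes> inv (k w)"
proof -
  obtain c where c: "trivialization G (\<lambda>v. p -` U v) g {0..1} c"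
    using trivialization_path[OF p] by blast
  have "trivialization G (\<lambda>v. p -` U v) (\<lambda>u v. k u \<otimes> g u v \<otimes> inv (k v)) {0..1} (\<lambda>t v. c t v \<otimes> inv (k v))"
  proof (rule trivializationI)
    fix z v assume z: "z \<in> {0..1}" "z \<in> p -` U v"
    show "\<exists>S. open S \<and> z \<in> S \<and> (\<forall>z'. z' \<in> S \<longrightarrow> z' \<in> {0..1} \<longrightarrow> z' \<in> p -` U v \<and> c z' v \<otimes> inv (k v) = c z v \<otimes> inv (k v))"
      using trivializationD(5)[OF c z] by (metis IntI)
  next
    fix z v w assume z: "z \<in> {0..1}" "z \<in> p -` U v" "z \<in> p -` U w"
    note * = trivializationD(2)[OF c z(1,2)] trivializationD(3)[OF c z]
    show "(c z v \<otimes> inv (k v)) \<otimes> (k v \<otimes> g v w \<otimes> inv (k w)) = c z w \<otimes> inv (k w)"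
      using trivializationD(4)[OF c z, symmetric] * k by (simp add: m_assoc) (simp flip: m_assoc)
  qed (use trivializationD(1-4)[OF c] k in auto)
  from holonomy_eq[OF this ends] have "holonomy G U (\<lambda>u v. k u \<otimes> g u v \<otimes> inv (k v)) p u w =
      inv (c 0 u \<otimes> inv (k u)) \<otimes> (c 1 w \<otimes> inv (k w))" .
  moreover have "c 0 u \<in> carrier G" "c 1 w \<in> carrier G"
    using trivializationD(2)[OF c] ends by auto
  ultimately show ?thesis
    using holonomy_eq[OF c ends] k by (simp add: inv_mult_group m_assoc)
qed

end

locale cocycle_pi1 = cocycle G T U g for G :: "('b, 'm) monoid_scheme" (structure) and T :: "'a::topological_space topology" and U :: "'v \<Rightarrow> 'a set" and g +
  fixes x0 u0 assumes base_chart: "x0 \<in> U u0"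
begin

definition holonomy_map :: "(real \<Rightarrow> 'a) set \<Rightarrow> 'b" where
  "holonomy_map A = holonomy G U g (SOME p. p \<in> A) u0 u0"

lemma holonomy_map:
  assumes "pathin T p" "p 0 = x0" "p 1 = x0"
  shows "holonomy_map (path_class T p) = holonomy G U g p u0 u0"
proof -
  have "(SOME q. q \<in> path_class T p) \<in> path_class T p"
    by (rule someI[of _ p]) (rule path_class_self[OF assms(1)])
  then show ?thesis
    unfolding holonomy_map_def path_class_def
    using holonomy_homotopic assms base_chart by fastforce
qed

lemma holonomy_map_hom: "holonomy_map \<in> hom (fundamental_group T x0) G"
proof (rule homI)
  fix A assume "A \<in> carrier (fundamental_group T x0)"
  then obtain p where p: "A = path_class T p" "pathin T p" "p 0 = x0" "p 1 = x0"
    by (auto simp: fundamental_group_carrier)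
  then show "holonomy_map A \<in> carrier G"
    using base_chart by (simp add: holonomy_map)
  fix B assume "B \<in> carrier (fundamental_group T x0)"
  then obtain q where q: "B = path_class T q" "pathin T q" "q 0 = x0" "q 1 = x0"
    by (auto simp: fundamental_group_carrier)
  show "holonomy_map (A \<otimes>\<^bsub>fundamental_group T x0\<^esub> B) = holonomy_map A \<otimes> holonomy_map B"
    using p q base_chart by (simp add: holonomy_map fundamental_group_mult pathin_joinpaths holonomy_join)
qed

end

lemma trivialization_cong:
  assumes c: "trivialization G N g D c" and N: "\<And>z v. z \<in> D \<Longrightarrow> z \<in> N' v \<longleftrightarrow> z \<in> N v"
    and g: "\<And>z u v. z \<in> D \<Longrightarrow> z \<in> N u \<Longrightarrow> z \<in> N v \<Longrightarrow> g' u v = g u v"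
  shows "trivialization G N' g' D c"
proof (rule trivializationI)
  fix z v assume z: "z \<in> D" "z \<in> N' v"
  then show "\<exists>S. open S \<and> z \<in> S \<and> (\<forall>z'. z' \<in> S \<longrightarrow> z' \<in> D \<longrightarrow> z' \<in> N' v \<and> c z' v = c z v)"
    using trivializationD(5)[OF c, of z v] N by (metis IntI)
qed (use trivializationD(1-4)[OF c] N g in auto)

text \<open>A section sees a chart only through its points on the path. The case of interest is the
  star of one vertex in two complexes, one contained in the other.\<close>

lemma holonomy_chart_cong:
  assumes "\<And>t v. t \<in> {0..1} \<Longrightarrow> p t \<in> U' v \<longleftrightarrow> p t \<in> U v"
  shows "holonomy G U' g p u w = holonomy G U g p u w"
proof -
  have "trivialization G (\<lambda>v. p -` U' v) g {0..1} c \<longleftrightarrow> trivialization G (\<lambda>v. p -` U v) g {0..1} c" for c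
    by (rule iffI; erule trivialization_cong) (use assms in auto)
  then show ?thesis
    by (simp add: holonomy_def)
qed

context cocycle begin

text \<open>Values of \<open>c\<close> are constrained only in charts that contain the point, and
  local constancy is tested only at nearby points of the chart. That nearby points do remain in the
  chart is supplied by its openness.\<close>

lemma holonomyI:
  assumes p: "pathin T p"
    and closed: "\<And>t v. t \<in> {0..1} \<Longrightarrow> p t \<in> U v \<Longrightarrow> c t v \<in> carrier G"
    and trans: "\<And>t v w. t \<in> {0..1} \<Longrightarrow> p t \<in> U v \<Longrightarrow> p t \<in> U w \<Longrightarrow> c t v \<otimes> g v w = c t w"
    and const: "\<And>t v. t \<in> {0..1} \<Longrightarrow> p t \<in> U v \<Longrightarrow>
       \<exists>S. open S \<and> t \<in> S \<and> (\<forall>s\<in>S. s \<in> {0..1} \<longrightarrow> p s \<in> U v \<longrightarrow> c s v = c t v)"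
    and ends: "p 0 \<in> U u" "p 1 \<in> U w"
  shows "holonomy G U g p u w = inv (c 0 u) \<otimes> c 1 w"
proof (rule holonomy_eq[where p = p and U = U, OF _ ends], rule trivializationI)
  fix t v assume t: "t \<in> {0..1}" "t \<in> p -` U v"
  obtain S where S: "open S" "t \<in> S" "\<And>s. s \<in> S \<Longrightarrow> s \<in> {0..1} \<Longrightarrow> p s \<in> U v \<Longrightarrow> c s v = c t v"
    using const[of t v] t by auto
  obtain S' where S': "open S'" "p -` U v \<inter> {0..1} = {0..1} \<inter> S'"
    using vimage_chart_open[OF p[unfolded pathin_def], of v] unfolding openin_open by blast
  have "t \<in> S'"
    using S'(2) t by blast
  moreover have "s \<in> p -` U v" if "s \<in> S'" "s \<in> {0..1}" for s
    using S'(2) that by blast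
  ultimately show "\<exists>S. open S \<and> t \<in> S \<and> (\<forall>s. s \<in> S \<longrightarrow> s \<in> {0..1} \<longrightarrow> s \<in> p -` U v \<and> c s v = c t v)"
    using S S'(1) by (intro exI[of _ "S \<inter> S'"]) auto
next
  fix t assume "t \<in> {0..1::real}"
  then have "p t \<in> topspace T"
    using pathin_in_topspace[OF p] by simp
  then show "\<exists>v. t \<in> p -` U v"
    using charts_cover by auto
qed (use closed trans transition_closed in auto)

lemma holonomy_reverse:
  assumes p: "pathin T p" and ends: "p 0 \<in> U u" "p 1 \<in> U w"
  shows "holonomy G U g (reversepath p) w u = inv (holonomy G U g p u w)"
proof -
  have "holonomy G U g (reversepath p) w u \<otimes> holonomy G U g p u w = holonomy G U g (reversepath p +++ p) w w"
    using assms by (intro holonomy_join[symmetric] pathin_reversepath) auto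
  also have "\<dots> = holonomy G U g (\<lambda>_. p 1) w w"
    by (rule holonomy_homotopic[OF homotopic_pathsin_linv[OF p]]) (use ends in auto)
  also have "\<dots> = g w w"
    by (rule holonomy_chart) (use ends path_finish_in_topspace[OF p] in auto)
  also have "\<dots> = \<one>"
    using transition_same ends by blast
  finally show ?thesis
    using assms by (simp add: inv_equality pathin_reversepath)
qed

end

lemma holonomy_cong:
  assumes "\<And>x u v. x \<in> U u \<Longrightarrow> x \<in> U v \<Longrightarrow> g u v = g' u v"
  shows "holonomy G U g p u w = holonomy G U g' p u w"
proof -
  have "trivialization G (\<lambda>v. p -` U v) g {0..1} c \<longleftrightarrow> trivialization G (\<lambda>v. p -` U v) g' {0..1} c" for c
    unfolding trivialization_def using assms by (intro ball_cong conj_cong all_cong1 imp_cong refl) auto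
  then show ?thesis
    by (simp add: holonomy_def)
qed

locale based_cocycle = B: based_space T x0 \<gamma> + cocycle_pi1 G T U g x0 u0
  for T :: "'a::topological_space topology" and x0 \<gamma> and G :: "('b, 'm) monoid_scheme" (structure)
    and U :: "'v \<Rightarrow> 'a set" and g u0
begin

text \<open>The holonomies along the tethers surround the one along \<open>p\<close>. As functions
  of the endpoint and its chart, these outer factors will become the gauge transformations between
  the two cocycles.\<close>

lemma holonomy_map_loop_class:
  assumes p: "pathin T p" and v: "p 0 \<in> U v" "p 1 \<in> U w"
  shows "holonomy_map (B.loop_class p) =
    holonomy G U g (\<gamma> (p 0)) u0 v \<otimes> holonomy G U g p v w \<otimes> inv (holonomy G U g (\<gamma> (p 1)) u0 w)"
proof -
  have 0: "pathin T (\<gamma> (p 0))" "\<gamma> (p 0) 0 = x0" "\<gamma> (p 0) 1 = p 0"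
    using B.tether path_start_in_topspace[OF p] by auto
  have 1: "pathin T (\<gamma> (p 1))" "\<gamma> (p 1) 0 = x0" "\<gamma> (p 1) 1 = p 1"
    using B.tether path_finish_in_topspace[OF p] by auto
  have "holonomy_map (B.loop_class p) = holonomy G U g (B.closed_up p) u0 u0"
    unfolding B.loop_class_def using B.closed_up[OF p] by (rule holonomy_map)
  also have "\<dots> = holonomy G U g (\<gamma> (p 0)) u0 v \<otimes> holonomy G U g (p +++ reversepath (\<gamma> (p 1))) v u0"
    unfolding B.closed_up_def
    by (rule holonomy_join) (use 0 1 p v base_chart in \<open>auto intro!: pathin_joinpaths pathin_reversepath\<close>)
  also have "holonomy G U g (p +++ reversepath (\<gamma> (p 1))) v u0 =
      holonomy G U g p v w \<otimes> holonomy G U g (reversepath (\<gamma> (p 1))) w u0"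
    by (rule holonomy_join) (use 1 p v base_chart in \<open>auto intro!: pathin_reversepath\<close>)
  also have "holonomy G U g (reversepath (\<gamma> (p 1))) w u0 = inv (holonomy G U g (\<gamma> (p 1)) u0 w)"
    by (rule holonomy_reverse) (use 1 v base_chart in auto)
  finally show ?thesis
    using 0 1 p v base_chart by (simp add: m_assoc)
qed

text \<open>\<open>E z v\<close> stands for the class of a path from \<open>z\<close> to the centre of the chart \<open>v\<close>; the section
  trivializing the cocycle follows \<open>p\<close> up to time \<open>t\<close> and then runs to the centre.\<close>

lemma holonomy_self:
  assumes p: "pathin T p" and ends: "p 0 \<in> U u" "p 1 \<in> U w"
    and \<kappa>: "\<kappa> \<in> hom B.\<pi> G"
    and E: "\<And>z v. z \<in> U v \<Longrightarrow> E z v \<in> carrier G"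
    and E_trans: "\<And>z v w. z \<in> U v \<Longrightarrow> z \<in> U w \<Longrightarrow> E z v \<otimes> g v w = E z w"
    and E_local: "\<And>q v. pathin T q \<Longrightarrow> (\<And>t. t \<in> {0..1} \<Longrightarrow> q t \<in> U v) \<Longrightarrow>
       \<kappa> (B.loop_class q) \<otimes> E (q 1) v = E (q 0) v"
  shows "holonomy G U g p u w = inv (E (p 0) u) \<otimes> (\<kappa> (B.loop_class p) \<otimes> E (p 1) w)"
proof -
  have \<kappa>_closed: "\<kappa> (B.loop_class q) \<in> carrier G" if "pathin T q" for q
    using hom_in_carrier[OF \<kappa>] that B.loop_class_carrier by blast
  define c where "c t v = \<kappa> (B.loop_class (p \<circ> linepath 0 t)) \<otimes> E (p t) v" for t v
  have pl: "pathin T (p \<circ> linepath s t)" if "s \<in> {0..1}" "t \<in> {0..1}" for s t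
    using pathin_linepath[OF p that] .
  have "holonomy G U g p u w = inv (c 0 u) \<otimes> c 1 w"
  proof (rule holonomyI[OF p _ _ _ ends])
    fix t v assume t: "t \<in> {0..1}" "p t \<in> U v"
    show "c t v \<in> carrier G"
      unfolding c_def using t E \<kappa>_closed pl by auto
    show "c t v \<otimes> g v w = c t w" if "p t \<in> U w" for w
      unfolding c_def using t that E E_trans[of "p t" v w] \<kappa>_closed[OF pl[of 0 t]] transition_closed[of "p t" v w]
      by (simp add: m_assoc)
    obtain S where S: "open S" "p -` U v \<inter> {0..1} = {0..1} \<inter> S"
      using vimage_chart_open[OF p[unfolded pathin_def], of v] unfolding openin_open by blast
    then have "t \<in> S"
      using t by blast
    then obtain e where e: "e > 0" "ball t e \<subseteq> S"
      using S(1) openE by blast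
    have "c s v = c t v" if s: "s \<in> ball t e" "s \<in> {0..1}" "p s \<in> U v" for s
    proof -
      \<comment> \<open>The piece of \<open>p\<close> between the times \<open>t\<close> and
        \<open>s\<close> stays in the chart because the ball is convex. \<open>E_local\<close> then
        trades this piece against the two paths to the centre.\<close>
      let ?q = "p \<circ> linepath t s"
      have "?q i \<in> U v" if "i \<in> {0..1}" for i
      proof -
        have "linepath t s i \<in> closed_segment t s"
          using that linepath_image_01 by (metis imageI path_image_def path_image_linepath)
        moreover have "closed_segment t s \<subseteq> ball t e \<inter> {0..1}"
          using s t e by (intro closed_segment_subset) (auto intro: convex_Int)
        ultimately have "linepath t s i \<in> p -` U v \<inter> {0..1}"
          unfolding S(2) using e(2) by blast
        then show ?thesis
          by simp
      qed
      then have "\<kappa> (B.loop_class ?q) \<otimes> E (p s) v = E (p t) v"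
        using E_local[OF pl[of t s], of v] s t by simp
      moreover have "B.loop_class (p \<circ> linepath 0 s) = B.loop_class (p \<circ> linepath 0 t) \<otimes>\<^bsub>B.\<pi>\<^esub> B.loop_class ?q"
        using s t by (intro B.loop_class_split[OF p]) auto
      moreover have "pathin T (p \<circ> linepath 0 t)" "pathin T ?q"
        using s t pl by auto
      ultimately show ?thesis
        unfolding c_def using hom_mult[OF \<kappa>] B.loop_class_carrier \<kappa>_closed E s t
        by (simp add: m_assoc)
    qed
    then show "\<exists>S. open S \<and> t \<in> S \<and> (\<forall>s\<in>S. s \<in> {0..1} \<longrightarrow> p s \<in> U v \<longrightarrow> c s v = c t v)"
      using e by (intro exI[of _ "ball t e"]) auto
  qed
  moreover have "p \<circ> linepath 0 1 = p" "p \<circ> linepath 0 0 = (\<lambda>_. p 0)"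
    by (auto simp: linepath_def)
  moreover have "\<kappa> \<one>\<^bsub>B.\<pi>\<^esub> = \<one>"
    using hom_one[OF \<kappa>] group_axioms B.group_axioms by simp
  ultimately show ?thesis
    using E[OF ends(1)] path_start_in_topspace[OF p] by (simp add: c_def)
qed

end

section \<open>Geometric realizations\<close>

definition support :: "('v \<Rightarrow> real) \<Rightarrow> 'v set" where
  "support z = {v. z v \<noteq> 0}"

definition segment_path :: "('v \<Rightarrow> real) \<Rightarrow> 'v \<Rightarrow> real \<Rightarrow> 'v \<Rightarrow> real" where
  "segment_path z v s = (\<lambda>u. (1 - s) * z u + s * vertex_point v u)"

lemma segment_path_ends [simp]: "segment_path z v 0 = z" "segment_path z v 1 = vertex_point v"
  by (auto simp: segment_path_def)

lemma segment_path_vertex [simp]: "segment_path (vertex_point v) v = (\<lambda>_. vertex_point v)"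
  by (auto simp: segment_path_def algebra_simps)

lemma support_vertex_point [simp]: "support (vertex_point v) = {v}"
  by (auto simp: support_def vertex_point_def)

lemma support_segment_path: "support (segment_path z v s) \<subseteq> insert v (support z)"
  by (auto simp: support_def segment_path_def vertex_point_def split: if_splits)

lemma support_closed_face: "z \<in> closed_face \<sigma> \<Longrightarrow> support z \<subseteq> \<sigma>"
  by (auto simp: closed_face_def support_def)

lemma closed_face_mono:
  assumes "z \<in> closed_face \<sigma>" "finite \<tau>" "\<sigma> \<subseteq> \<tau>"
  shows "z \<in> closed_face \<tau>"
  using assms sum.mono_neutral_left[of \<tau> \<sigma> z] by (auto simp: closed_face_def)

lemma closed_face_support:
  assumes "z \<in> closed_face \<sigma>" "finite \<sigma>"
  shows "z \<in> closed_face (support z)"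
proof -
  have "sum z \<sigma> = sum z (support z)"
    by (rule sum.mono_neutral_right[OF assms(2) support_closed_face[OF assms(1)]]) (simp add: support_def)
  moreover have "\<forall>v. v \<notin> support z \<longrightarrow> z v = 0"
    by (simp add: support_def)
  ultimately show ?thesis
    using assms(1) unfolding closed_face_def by simp
qed

lemma support_nonempty: "z \<in> closed_face \<sigma> \<Longrightarrow> support z \<noteq> {}"
  using sum.neutral[of \<sigma> z] by (fastforce simp: closed_face_def support_def)

lemma segment_path_closed_face:
  assumes "z \<in> closed_face \<sigma>" "finite \<sigma>" "v \<in> \<sigma>" "0 \<le> s" "s \<le> 1"
  shows "segment_path z v s \<in> closed_face \<sigma>"
proof -
  have "(\<Sum>u\<in>\<sigma>. vertex_point v u) = 1"
    using assms by (simp add: vertex_point_def)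
  then have "(\<Sum>u\<in>\<sigma>. segment_path z v s u) = 1"
    using assms by (simp add: segment_path_def sum.distrib closed_face_def flip: sum_distrib_left)
  then show ?thesis
    using assms by (auto simp: closed_face_def segment_path_def vertex_point_def)
qed

lemma closed_closed_face: "closed (closed_face (\<sigma> :: 'v set))"
proof -
  have c: "continuous_on UNIV (\<lambda>t::'v \<Rightarrow> real. t v)" for v
    by (rule continuous_on_product_coordinates)
  have "closed_face \<sigma> = (\<Inter>v. {t. 0 \<le> t v}) \<inter> (\<Inter>v\<in>-\<sigma>. {t. t v = 0}) \<inter> {t. sum t \<sigma> = 1}"
    by (auto simp: closed_face_def)
  moreover have "closed \<dots>"
    by (intro closed_Int closed_INT ballI closed_Collect_le closed_Collect_eq c continuous_on_const continuous_on_sum)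
  ultimately show ?thesis
    by simp
qed

text \<open>Used to recognize a set as closed in the weak topology when it meets every face in
  finitely many points.\<close>

lemma closed_finite_functions:
  assumes "finite A"
  shows "closed (A :: ('v \<Rightarrow> real) set)"
proof -
  have "closed {z}" for z :: "'v \<Rightarrow> real"
  proof -
    have "closed (\<Inter>v. {t. t v = z v})"
      by (intro closed_INT ballI closed_Collect_eq continuous_on_product_coordinates continuous_on_const)
    moreover have "(\<Inter>v. {t. t v = z v}) = {z}"
      by auto
    ultimately show ?thesis
      by simp
  qed
  then have "closed (\<Union>z\<in>A. {z})"
    using assms by (intro closed_UN) auto
  then show ?thesis
    by simp
qed

lemma continuous_map_realization_euclidean:
  "continuous_map (realization K) (euclidean :: ('v \<Rightarrow> real) topology) id"
  unfolding continuous_map_def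
proof (intro conjI allI impI)
  fix W :: "('v \<Rightarrow> real) set" assume "openin euclidean W"
  then have "openin (top_of_set (closed_face \<sigma>)) (W \<inter> closed_face \<sigma>)" for \<sigma>
    by (metis inf_commute open_openin openin_open_Int)
  moreover have "{z \<in> topspace (realization K). id z \<in> W} \<inter> closed_face \<sigma> = W \<inter> closed_face \<sigma>" if "\<sigma> \<in> K" for \<sigma>
    using that by (auto simp: topspace_realization)
  ultimately show "openin (realization K) {z \<in> topspace (realization K). id z \<in> W}"
    unfolding openin_realization by (auto simp: topspace_realization)
qed auto

definition open_star :: "'v set set \<Rightarrow> 'v \<Rightarrow> ('v \<Rightarrow> real) set" where
  "open_star K v = {z \<in> topspace (realization K). z v \<noteq> 0}"

text \<open>Nonvanishing of a coordinate is an open condition for pointwise convergence, and the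
  weak topology is at least as fine.\<close>

lemma openin_open_star: "openin (realization K) (open_star K (v::'v))"
proof -
  have "open {z :: 'v \<Rightarrow> real. z v \<noteq> 0}" for v :: 'v
    by (intro open_Collect_neq continuous_on_product_coordinates continuous_on_const)
  then show ?thesis
    using openin_continuous_map_preimage[OF continuous_map_realization_euclidean, of "{z. z v \<noteq> 0}" K]
    by (simp add: open_star_def)
qed

text \<open>Each closed face is itself closed for pointwise convergence, so closedness relative to a
  face is closedness outright.\<close>

lemma closedin_realization_iff:
  "closedin (realization K) C \<longleftrightarrow> C \<subseteq> topspace (realization K) \<and> (\<forall>\<sigma>\<in>K. closed (C \<inter> closed_face \<sigma>))"
proof -
  have "openin (top_of_set (closed_face \<sigma>)) ((topspace (realization K) - C) \<inter> closed_face \<sigma>) \<longleftrightarrow> closed (C \<inter> closed_face \<sigma>)"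
    if "\<sigma> \<in> K" for \<sigma>
  proof -
    have "closed_face \<sigma> - (C \<inter> closed_face \<sigma>) = (topspace (realization K) - C) \<inter> closed_face \<sigma>"
      using that by (auto simp: topspace_realization)
    moreover have "closedin (top_of_set (closed_face \<sigma>)) (C \<inter> closed_face \<sigma>) \<longleftrightarrow> closed (C \<inter> closed_face \<sigma>)"
      by (metis closed_closed_face closedin_closed_trans closed_closedin closed_subset inf_le2)
    ultimately show ?thesis
      unfolding closedin_def by auto
  qed
  then show ?thesis
    unfolding closedin_def[of "realization K"] openin_realization[of K] topspace_realization[symmetric] by auto
qed

text \<open>On finitely many faces the weak topology is the Euclidean one.\<close>

lemma continuous_map_into_realization:
  assumes f: "continuous_map Z euclidean f" and F: "finite F" "F \<subseteq> K"
    and im: "\<And>z. z \<in> topspace Z \<Longrightarrow> \<exists>\<sigma>\<in>F. f z \<in> closed_face \<sigma>"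
  shows "continuous_map Z (realization K) f"
  unfolding continuous_map_closedin
proof (intro conjI allI impI)
  show "f \<in> topspace Z \<rightarrow> topspace (realization K)"
    using im F by (auto simp: topspace_realization)
  fix C assume "closedin (realization K) C"
  then have "closed (C \<inter> closed_face \<sigma>)" if "\<sigma> \<in> F" for \<sigma>
    using that F by (auto simp: closedin_realization_iff)
  then have "closedin Z {z \<in> topspace Z. f z \<in> C \<inter> closed_face \<sigma>}" if "\<sigma> \<in> F" for \<sigma>
    using closedin_continuous_map_preimage[OF f, of "C \<inter> closed_face \<sigma>"] that by simp
  then have "closedin Z (\<Union>\<sigma>\<in>F. {z \<in> topspace Z. f z \<in> C \<inter> closed_face \<sigma>})"
    using F by (intro closedin_Union) auto
  moreover have "(\<Union>\<sigma>\<in>F. {z \<in> topspace Z. f z \<in> C \<inter> closed_face \<sigma>}) = {z \<in> topspace Z. f z \<in> C}"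
    using im by auto
  ultimately show "closedin Z {z \<in> topspace Z. f z \<in> C}"
    by simp
qed

locale simplicial_complex =
  fixes K :: "'v set set"
  assumes finite_simplex: "\<sigma> \<in> K \<Longrightarrow> finite \<sigma>"
    and face_closed: "\<sigma> \<in> K \<Longrightarrow> \<tau> \<subseteq> \<sigma> \<Longrightarrow> \<tau> \<noteq> {} \<Longrightarrow> \<tau> \<in> K"
begin

abbreviation "R \<equiv> realization K"

lemma support_in: "z \<in> topspace R \<Longrightarrow> support z \<in> K \<and> z \<in> closed_face (support z)"
  unfolding topspace_realization
  using support_closed_face support_nonempty closed_face_support face_closed finite_simplex by (metis UN_E)

lemma vertex_point_in: "v \<in> \<sigma> \<Longrightarrow> \<sigma> \<in> K \<Longrightarrow> vertex_point v \<in> topspace R"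
  unfolding topspace_realization
  by (rule UN_I[of \<sigma>]) (auto simp: closed_face_def vertex_point_def finite_simplex)

text \<open>A compact set in the weak topology meets few open simplices. One point is chosen for
  each support that occurs; any set of such points meets a face in finitely many points, since a
  simplex has finitely many subsets, and is therefore closed. An infinite set of them would have no
  limit point in the compact image of the path.\<close>

lemma finite_supports:
  assumes p: "pathin R p"
  shows "finite ((\<lambda>t. support (p t)) ` {0..1})"
proof -
  let ?S = "(\<lambda>t. support (p t)) ` {0..1}" and ?I = "p ` {0..1}"
  define q where "q s = (SOME z. z \<in> ?I \<and> support z = s)" for s
  have q: "q s \<in> ?I" "support (q s) = s" if "s \<in> ?S" for s
  proof -
    have "\<exists>z. z \<in> ?I \<and> support z = s"
      using that by auto
    from someI_ex[OF this] show "q s \<in> ?I" "support (q s) = s"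
      unfolding q_def by auto
  qed
  have inj: "inj_on q ?S"
  proof (rule inj_onI)
    fix s s' assume *: "s \<in> ?S" "s' \<in> ?S" "q s = q s'"
    have "s = support (q s)"
      by (rule q(2)[OF *(1), symmetric])
    also have "\<dots> = support (q s')"
      unfolding *(3) ..
    also have "\<dots> = s'"
      by (rule q(2)[OF *(2)])
    finally show "s = s'" .
  qed
  have I: "?I \<subseteq> topspace R"
    using pathin_in_topspace[OF p] by auto
  have closed: "closedin R A" if A: "A \<subseteq> q ` ?S" for A
    unfolding closedin_realization_iff
  proof (intro conjI ballI)
    show "A \<subseteq> topspace R"
      using A I q(1) by (meson image_subsetI order_trans)
    fix \<sigma> assume "\<sigma> \<in> K"
    have "A \<inter> closed_face \<sigma> \<subseteq> q ` Pow \<sigma>"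
    proof
      fix x assume x: "x \<in> A \<inter> closed_face \<sigma>"
      then obtain s where s: "s \<in> ?S" "x = q s"
        using A by (meson IntD1 imageE subsetD)
      then have "s \<subseteq> \<sigma>"
        using q(2)[OF s(1)] support_closed_face[of x \<sigma>] x by simp
      then show "x \<in> q ` Pow \<sigma>"
        using s by auto
    qed
    then have "finite (A \<inter> closed_face \<sigma>)"
      using finite_simplex[OF \<open>\<sigma> \<in> K\<close>] by (meson finite_Pow_iff finite_imageI finite_subset)
    then show "closed (A \<inter> closed_face \<sigma>)"
      by (rule closed_finite_functions)
  qed
  have "finite (q ` ?S)"
  proof (rule ccontr)
    assume inf: "infinite (q ` ?S)"
    have "compactin R ?I"
      by (rule image_compactin[OF _ p[unfolded pathin_def]]) (simp add: compactin_subtopology)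
    moreover have "q ` ?S \<subseteq> ?I"
      by (rule image_subsetI) (rule q(1))
    ultimately have "?I \<inter> R derived_set_of (q ` ?S) \<noteq> {}"
      by (intro compactin_imp_Bolzano_Weierstrass conjI inf)
    then obtain x where x: "x \<in> ?I" "x \<in> R derived_set_of (q ` ?S)"
      by blast
    have "openin R (topspace R - (q ` ?S - {x}))"
      by (intro openin_diff openin_topspace closed) auto
    moreover have "x \<in> topspace R - (q ` ?S - {x})"
      using x I by auto
    ultimately obtain y where "y \<noteq> x" "y \<in> q ` ?S" "y \<in> topspace R - (q ` ?S - {x})"
      using x(2) unfolding in_derived_set_of by metis
    then show False
      by simp
  qed
  then show ?thesis
    using inj finite_imageD by blast
qed

text \<open>The cone stays in the finitely many simplices spanned by \<open>v\<close> and the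
  supports along the path. On finitely many faces continuity into the realization can be checked
  coordinatewise.\<close>

lemma continuous_map_cone:
  assumes p: "pathin R p" and v: "\<And>t. t \<in> {0..1} \<Longrightarrow> insert v (support (p t)) \<in> K"
  shows "continuous_map (top_of_set ({0..1} \<times> {0..1})) R (\<lambda>z. segment_path (p (snd z)) v (fst z))"
proof (rule continuous_map_into_realization)
  have "continuous_map (top_of_set {0..1}) euclidean p"
    using continuous_map_compose[OF p[unfolded pathin_def] continuous_map_realization_euclidean] by simp
  then have "continuous_on {0..1} p"
    by simp
  then have "continuous_on {0..1} (\<lambda>t. p t u)" for u
    by (rule continuous_on_product_then_coordinatewise)
  then have "continuous_on ({0..1} \<times> {0..1}) (\<lambda>z. p (snd z) u)" for u
    by (rule continuous_on_compose2) (auto intro!: continuous_intros)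
  then have "continuous_on ({0..1} \<times> {0..1}) (\<lambda>z. segment_path (p (snd z)) v (fst z))"
    unfolding segment_path_def by (intro continuous_on_coordinatewise_then_product continuous_intros)
  then show "continuous_map (top_of_set ({0..1} \<times> {0..1})) euclidean (\<lambda>z. segment_path (p (snd z)) v (fst z))"
    by simp
  have "(\<lambda>t. insert v (support (p t))) ` {0..1} = insert v ` (\<lambda>t. support (p t)) ` {0..1}"
    by auto
  then show "finite ((\<lambda>t. insert v (support (p t))) ` {0..1})"
    using finite_supports[OF p] by simp
  show "(\<lambda>t. insert v (support (p t))) ` {0..1} \<subseteq> K"
    using v by auto
next
  fix z :: "real \<times> real" assume "z \<in> topspace (top_of_set ({0..1} \<times> {0..1}))"
  then have z: "fst z \<in> {0..1}" "snd z \<in> {0..1}"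
    by auto
  note s = v[OF z(2)]
  have "p (snd z) \<in> closed_face (support (p (snd z)))"
    using pathin_in_topspace[OF p] support_in z by auto
  then have "p (snd z) \<in> closed_face (insert v (support (p (snd z))))"
    by (rule closed_face_mono) (use finite_simplex[OF s] in auto)
  then have "segment_path (p (snd z)) v (fst z) \<in> closed_face (insert v (support (p (snd z))))"
    by (rule segment_path_closed_face) (use finite_simplex[OF s] z in auto)
  then show "\<exists>\<sigma>\<in>(\<lambda>t. insert v (support (p t))) ` {0..1}. segment_path (p (snd z)) v (fst z) \<in> closed_face \<sigma>"
    using z by blast
qed

text \<open>A segment is a slice of the cone over a constant path.\<close>

lemma pathin_segment_path:
  assumes "z \<in> topspace R" "insert v (support z) \<in> K"
  shows "pathin R (segment_path z v)"
proof -
  have "pathin R ((\<lambda>x. segment_path z v (fst x)) \<circ> (\<lambda>t. (t, 0::real)))"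
    by (rule pathin_compose_path[OF continuous_map_cone[of "\<lambda>_. z" v]])
       (use assms in \<open>auto simp: path_def path_image_def intro!: continuous_intros\<close>)
  then show ?thesis
    by (simp add: o_def)
qed

text \<open>The two paths are the images of the two ways around the unit square under the cone map.
  At height 1 the cone has collapsed to the vertex \<open>v\<close>, which accounts for the constant
  path.\<close>

lemma homotopic_cone:
  assumes p: "pathin R p" and v: "\<And>t. t \<in> {0..1} \<Longrightarrow> insert v (support (p t)) \<in> K"
  shows "homotopic_pathsin R (p +++ segment_path (p 1) v) (segment_path (p 0) v +++ (\<lambda>_. vertex_point v))"
proof -
  let ?M = "\<lambda>z. segment_path (p (snd z)) v (fst z)"
  let ?f = "linepath (0, 0) (0, 1) +++ linepath (0, 1) (1, 1::real) :: real \<Rightarrow> real \<times> real"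
  let ?g = "linepath (0, 0) (1, 0) +++ linepath (1, 0) (1, 1::real) :: real \<Rightarrow> real \<times> real"
  have conv: "convex ({0..1::real} \<times> {0..1::real})"
    by (intro convex_Times) auto
  have "path_image ?f \<subseteq> {0..1} \<times> {0..1}" "path_image ?g \<subseteq> {0..1} \<times> {0..1}"
    by (rule subset_path_image_join; unfold path_image_linepath; rule closed_segment_subset[OF _ _ conv]; simp)+
  then have "homotopic_pathsin R (?M \<circ> ?f) (?M \<circ> ?g)"
    by (intro homotopic_pathsin_convex[OF conv continuous_map_cone[OF p v]]) (auto intro!: path_join_imp)
  moreover have "?M \<circ> ?f = p +++ segment_path (p 1) v" "?M \<circ> ?g = segment_path (p 0) v +++ (\<lambda>_. vertex_point v)"
    by (auto simp: joinpaths_def linepath_def fun_eq_iff)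
  ultimately show ?thesis
    by simp
qed

end

locale based_complex = simplicial_complex K + based_space "realization K" y0 \<gamma>
  for K :: "'v set set" and y0 \<gamma>
begin

lemma loop_class_cone:
  assumes p: "pathin R p" and v: "\<And>t. t \<in> {0..1} \<Longrightarrow> insert v (support (p t)) \<in> K"
  shows "loop_class p \<otimes>\<^bsub>\<pi>\<^esub> loop_class (segment_path (p 1) v) = loop_class (segment_path (p 0) v)"
proof -
  have *: "pathin R (segment_path (p t) v)" if "t \<in> {0..1}" for t
    using pathin_segment_path[OF _ v[OF that]] pathin_in_topspace[OF p] that by auto
  have "vertex_point v \<in> topspace R"
    using vertex_point_in[OF insertI1 v[of 0]] by simp
  then show ?thesis
    using loop_class_homotopic[OF homotopic_cone[OF p v]] *[of 0] *[of 1] p by (simp add: loop_class_join)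
qed

end

section \<open>Geodesic spaces\<close>

text \<open>A compact set attains its diameter, so a strict bound on all distances remains strict
  for the supremum.\<close>

lemma diameter_less_iff:
  assumes "compact S" "S \<noteq> {}"
  shows "diameter S < d \<longleftrightarrow> (\<forall>x\<in>S. \<forall>y\<in>S. dist x y < d)"
  using diameter_compact_attained[OF assms] diameter_bounded_bound[OF compact_imp_bounded[OF assms(1)]]
  by (metis le_less_trans)

lemma pathin_top_of_set: "pathin (top_of_set X) p \<longleftrightarrow> path p \<and> path_image p \<subseteq> X"
  by (auto simp: pathin_def path_def path_image_def continuous_map_in_subtopology)

text \<open>The speed of a geodesic is not prescribed, so the metric information is drawn from the
  partition 0, \<open>a\<close>, \<open>b\<close>, 1. The case \<open>a = b\<close> gives
  betweenness, and the middle term bounds the diameter of the image.\<close>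

lemma path_length_ge:
  assumes g: "path_length g = ennreal d" "0 \<le> d" and ab: "0 \<le> a" "a \<le> b" "b \<le> 1"
  shows "dist (g 0) (g a) + dist (g a) (g b) + dist (g b) (g 1) \<le> d"
proof -
  define t where "t i = (if i = 0 then 0 else if i = 1 then a else if i = 2 then b else 1)" for i :: nat
  have 3: "{..<3} = {0, 1, 2::nat}"
    by auto
  have "ennreal (\<Sum>i<3. dist (g (t i)) (g (t (Suc i)))) \<le> path_length g"
    unfolding path_length_def
    by (rule SUP_upper2[of "(3, t)"]) (use ab in \<open>auto simp: t_def\<close>)
  also have "(\<Sum>i<3. dist (g (t i)) (g (t (Suc i)))) = dist (g 0) (g a) + dist (g a) (g b) + dist (g b) (g 1)"
    unfolding 3 by (simp add: t_def)
  finally show ?thesis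
    using g by (simp add: ennreal_plus_if flip: ennreal_plus)
qed

text \<open>Metric betweenness; the reverse inequality is the triangle inequality.\<close>

definition between :: "'a::metric_space \<Rightarrow> 'a \<Rightarrow> 'a \<Rightarrow> bool" where
  "between x y a \<longleftrightarrow> dist x a + dist a y \<le> dist x y"

text \<open>There are two ways from \<open>a\<close> to \<open>b\<close> around the triangle, one
  through \<open>y\<close> and one through \<open>x\<close> and \<open>z\<close>; together they make
  up the perimeter.\<close>

lemma between_triangle:
  assumes "between x y a" "between y z b"
  shows "2 * dist a b \<le> dist x y + dist y z + dist x z"
  using assms dist_triangle[of a b y] dist_triangle[of a b x] dist_triangle[of x b z] unfolding between_def
  by (simp add: dist_commute)

lemma between_commute: "between x y a \<longleftrightarrow> between y x a"
  by (simp add: between_def dist_commute add.commute)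

locale geodesic =
  fixes X :: "'a::metric_space set" and x0 :: 'a
  assumes geodesic: "geodesic_space X" and x0: "x0 \<in> X"
begin

abbreviation "TX \<equiv> top_of_set X"

text \<open>Equal ends are treated apart because the tether of the base point has to be the constant
  function on the whole real line, whereas a path of length zero is determined only on
  [0,1].\<close>

definition geo :: "'a \<Rightarrow> 'a \<Rightarrow> real \<Rightarrow> 'a" where
  "geo x y = (if x = y then (\<lambda>_. x) else
     (SOME g. path g \<and> path_image g \<subseteq> X \<and> pathstart g = x \<and> pathfinish g = y \<and> path_length g = ennreal (dist x y)))"

lemma geo:
  assumes "x \<in> X" "y \<in> X"
  shows "pathin TX (geo x y)" "geo x y 0 = x" "geo x y 1 = y"
    and "0 \<le> a \<Longrightarrow> a \<le> b \<Longrightarrow> b \<le> 1 \<Longrightarrow> dist x (geo x y a) + dist (geo x y a) (geo x y b) + dist (geo x y b) y \<le> dist x y"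
proof -
  have "pathin TX (geo x y) \<and> geo x y 0 = x \<and> geo x y 1 = y \<and>
    (0 \<le> a \<longrightarrow> a \<le> b \<longrightarrow> b \<le> 1 \<longrightarrow> dist x (geo x y a) + dist (geo x y a) (geo x y b) + dist (geo x y b) y \<le> dist x y)"
  proof (cases "x = y")
    case True
    then show ?thesis
      using assms by (simp add: geo_def)
  next
    case False
    have "\<exists>g. path g \<and> path_image g \<subseteq> X \<and> pathstart g = x \<and> pathfinish g = y \<and> path_length g = ennreal (dist x y)"
      using geodesic assms unfolding geodesic_space_def by blast
    from someI_ex[OF this] False have *: "path (geo x y) \<and> path_image (geo x y) \<subseteq> X \<and> pathstart (geo x y) = x \<and>
        pathfinish (geo x y) = y \<and> path_length (geo x y) = ennreal (dist x y)"
      unfolding geo_def by simp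
    then show ?thesis
      using path_length_ge[of "geo x y" "dist x y" a b] by (auto simp: pathin_top_of_set pathstart_def pathfinish_def)
  qed
  then show "pathin TX (geo x y)" "geo x y 0 = x" "geo x y 1 = y"
    "0 \<le> a \<Longrightarrow> a \<le> b \<Longrightarrow> b \<le> 1 \<Longrightarrow> dist x (geo x y a) + dist (geo x y a) (geo x y b) + dist (geo x y b) y \<le> dist x y"
    by auto
qed

lemma geo_same [simp]: "geo x x = (\<lambda>_. x)"
  by (simp add: geo_def)

lemma geo_in: "x \<in> X \<Longrightarrow> y \<in> X \<Longrightarrow> t \<in> {0..1} \<Longrightarrow> geo x y t \<in> X"
  using pathin_in_topspace[OF geo(1)] by auto

lemma geo_between: "x \<in> X \<Longrightarrow> y \<in> X \<Longrightarrow> t \<in> {0..1} \<Longrightarrow> between x y (geo x y t)"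
  using geo(4)[of x y t t] by (simp add: between_def)

lemma geo_dist:
  assumes "x \<in> X" "y \<in> X" "s \<in> {0..1}" "t \<in> {0..1}"
  shows "dist (geo x y s) (geo x y t) \<le> dist x y"
proof (cases "s \<le> t")
  case True
  with assms have "dist x (geo x y s) + dist (geo x y s) (geo x y t) + dist (geo x y t) y \<le> dist x y"
    by (intro geo(4)) auto
  then show ?thesis
    using zero_le_dist[of x "geo x y s"] zero_le_dist[of "geo x y t" y] by linarith
next
  case False
  with assms have "dist x (geo x y t) + dist (geo x y t) (geo x y s) + dist (geo x y s) y \<le> dist x y"
    by (intro geo(4)) auto
  then show ?thesis
    using zero_le_dist[of x "geo x y t"] zero_le_dist[of "geo x y s" y] dist_commute[of "geo x y s" "geo x y t"]
    by linarith
qed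

text \<open>The distance from \<open>x\<close> varies continuously along a geodesic, so the
  intermediate value theorem finds the point whatever the parametrization.\<close>

lemma geo_point:
  assumes "x \<in> X" "y \<in> X" "0 \<le> d" "d \<le> dist x y"
  obtains m where "m \<in> X" "dist x m = d" "dist m y = dist x y - d"
proof -
  have "continuous_on {0..1} (geo x y)"
    using geo(1)[OF assms(1,2)] by (simp add: pathin_def)
  then have "continuous_on {0..1} (\<lambda>t. dist x (geo x y t))"
    by (intro continuous_intros)
  then obtain t where t: "0 \<le> t" "t \<le> 1" "dist x (geo x y t) = d"
    using IVT'[of "\<lambda>t. dist x (geo x y t)" 0 d 1] assms geo by auto
  then have "dist (geo x y t) y = dist x y - d"
    using geo_between[of x y t] dist_triangle[of x y "geo x y t"] assms by (auto simp: between_def dist_commute)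
  then show ?thesis
    using that t geo_in assms by auto
qed

definition tether_X :: "'a \<Rightarrow> real \<Rightarrow> 'a" where
  "tether_X = geo x0"

sublocale X: based_space TX x0 tether_X
  by unfold_locales (use x0 geo in \<open>auto simp: tether_X_def\<close>)

section \<open>The normal subgroup generated by small loops\<close>

abbreviation "D \<rho> \<equiv> small_loops_pi1 X x0 \<rho>"

definition conj_small_loops :: "real \<Rightarrow> (real \<Rightarrow> 'a) set set" where
  "conj_small_loops \<rho> = {path_class TX (\<alpha> +++ \<beta> +++ reversepath \<alpha>) | \<alpha> \<beta>.
       path \<alpha> \<and> path_image \<alpha> \<subseteq> X \<and> pathstart \<alpha> = x0 \<and>
       path \<beta> \<and> path_image \<beta> \<subseteq> X \<and> pathstart \<beta> = pathfinish \<alpha> \<and> pathfinish \<beta> = pathfinish \<alpha> \<and>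
       diameter (path_image \<beta>) < \<rho>}"

lemma D_eq: "D \<rho> = generate X.\<pi> (conj_small_loops \<rho>)"
  by (simp add: small_loops_pi1_def conj_small_loops_def)

lemma diameter_loop_less_iff:
  "pathin TX p \<Longrightarrow> diameter (path_image p) < \<rho> \<longleftrightarrow> (\<forall>s\<in>{0..1}. \<forall>t\<in>{0..1}. dist (p s) (p t) < \<rho>)"
  using diameter_less_iff[OF compact_path_image path_image_nonempty, of p \<rho>]
  by (auto simp: pathin_top_of_set path_image_def)

text \<open>The tethers of the endpoint of \<open>\<alpha>\<close> cancel, so a generator becomes a
  conjugate, inside the group, of the class of the free loop \<open>\<beta>\<close>.\<close>

lemma conj_small_loops_iff:
  "A \<in> conj_small_loops \<rho> \<longleftrightarrow> (\<exists>\<alpha> \<beta>. pathin TX \<alpha> \<and> pathin TX \<beta> \<and> \<alpha> 0 = x0 \<and> \<beta> 0 = \<alpha> 1 \<and> \<beta> 1 = \<alpha> 1 \<and>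
     (\<forall>s\<in>{0..1}. \<forall>t\<in>{0..1}. dist (\<beta> s) (\<beta> t) < \<rho>) \<and>
     A = X.loop_class \<alpha> \<otimes>\<^bsub>X.\<pi>\<^esub> X.loop_class \<beta> \<otimes>\<^bsub>X.\<pi>\<^esub> inv\<^bsub>X.\<pi>\<^esub> (X.loop_class \<alpha>))"
proof -
  have *: "path_class TX (\<alpha> +++ \<beta> +++ reversepath \<alpha>) =
      X.loop_class \<alpha> \<otimes>\<^bsub>X.\<pi>\<^esub> X.loop_class \<beta> \<otimes>\<^bsub>X.\<pi>\<^esub> inv\<^bsub>X.\<pi>\<^esub> (X.loop_class \<alpha>)"
    if "pathin TX \<alpha>" "pathin TX \<beta>" "\<alpha> 0 = x0" "\<beta> 0 = \<alpha> 1" "\<beta> 1 = \<alpha> 1" for \<alpha> \<beta>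
  proof -
    have "path_class TX (\<alpha> +++ \<beta> +++ reversepath \<alpha>) = X.loop_class (\<alpha> +++ \<beta> +++ reversepath \<alpha>)"
      by (rule X.loop_class_loop[symmetric]) (use that in \<open>auto intro!: pathin_joinpaths pathin_reversepath\<close>)
    then show ?thesis
      using that by (simp add: X.loop_class_join X.loop_class_reverse pathin_joinpaths pathin_reversepath X.m_assoc)
  qed
  show ?thesis
    unfolding conj_small_loops_def mem_Collect_eq
  proof (intro iff_exI)
    fix \<alpha> \<beta>
    show "(A = path_class TX (\<alpha> +++ \<beta> +++ reversepath \<alpha>) \<and>
       path \<alpha> \<and> path_image \<alpha> \<subseteq> X \<and> pathstart \<alpha> = x0 \<and>
       path \<beta> \<and> path_image \<beta> \<subseteq> X \<and> pathstart \<beta> = pathfinish \<alpha> \<and> pathfinish \<beta> = pathfinish \<alpha> \<and>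
       diameter (path_image \<beta>) < \<rho>) \<longleftrightarrow>
      (pathin TX \<alpha> \<and> pathin TX \<beta> \<and> \<alpha> 0 = x0 \<and> \<beta> 0 = \<alpha> 1 \<and> \<beta> 1 = \<alpha> 1 \<and>
     (\<forall>s\<in>{0..1}. \<forall>t\<in>{0..1}. dist (\<beta> s) (\<beta> t) < \<rho>) \<and>
     A = X.loop_class \<alpha> \<otimes>\<^bsub>X.\<pi>\<^esub> X.loop_class \<beta> \<otimes>\<^bsub>X.\<pi>\<^esub> inv\<^bsub>X.\<pi>\<^esub> (X.loop_class \<alpha>))"
      using *[of \<alpha> \<beta>] diameter_loop_less_iff[of \<beta> \<rho>]
      by (auto simp: pathin_top_of_set pathstart_def pathfinish_def)
  qed
qed

lemma conj_small_loops_carrier: "conj_small_loops \<rho> \<subseteq> carrier X.\<pi>"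
proof
  fix A assume "A \<in> conj_small_loops \<rho>"
  then obtain \<alpha> \<beta> where "pathin TX \<alpha>" "pathin TX \<beta>"
     "A = X.loop_class \<alpha> \<otimes>\<^bsub>X.\<pi>\<^esub> X.loop_class \<beta> \<otimes>\<^bsub>X.\<pi>\<^esub> inv\<^bsub>X.\<pi>\<^esub> (X.loop_class \<alpha>)"
    unfolding conj_small_loops_iff by blast
  then show "A \<in> carrier X.\<pi>"
    by simp
qed

text \<open>Conjugating a generator by a loop amounts to prefixing this loop to
  \<open>\<alpha>\<close>, so the generating set is itself closed under conjugation.\<close>

lemma D_normal: "D \<rho> \<lhd> X.\<pi>"
  unfolding D_eq
proof (rule X.normal_generateI[OF conj_small_loops_carrier])
  fix A k assume A: "A \<in> conj_small_loops \<rho>" and k: "k \<in> carrier X.\<pi>"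
  obtain \<alpha> \<beta> where *: "pathin TX \<alpha>" "pathin TX \<beta>" "\<alpha> 0 = x0" "\<beta> 0 = \<alpha> 1" "\<beta> 1 = \<alpha> 1"
     "\<forall>s\<in>{0..1}. \<forall>t\<in>{0..1}. dist (\<beta> s) (\<beta> t) < \<rho>"
     "A = X.loop_class \<alpha> \<otimes>\<^bsub>X.\<pi>\<^esub> X.loop_class \<beta> \<otimes>\<^bsub>X.\<pi>\<^esub> inv\<^bsub>X.\<pi>\<^esub> (X.loop_class \<alpha>)"
    using A unfolding conj_small_loops_iff by blast
  obtain q where q: "pathin TX q" "q 0 = x0" "q 1 = x0" "k = X.loop_class q"
    using X.carrier_loop_class[OF k] by blast
  have "X.loop_class (q +++ \<alpha>) = k \<otimes>\<^bsub>X.\<pi>\<^esub> X.loop_class \<alpha>"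
    using q * by (simp add: X.loop_class_join)
  then have "k \<otimes>\<^bsub>X.\<pi>\<^esub> A \<otimes>\<^bsub>X.\<pi>\<^esub> inv\<^bsub>X.\<pi>\<^esub> k =
      X.loop_class (q +++ \<alpha>) \<otimes>\<^bsub>X.\<pi>\<^esub> X.loop_class \<beta> \<otimes>\<^bsub>X.\<pi>\<^esub> inv\<^bsub>X.\<pi>\<^esub> (X.loop_class (q +++ \<alpha>))"
    using * k by (simp add: X.m_assoc X.inv_mult_group)
  then show "k \<otimes>\<^bsub>X.\<pi>\<^esub> A \<otimes>\<^bsub>X.\<pi>\<^esub> inv\<^bsub>X.\<pi>\<^esub> k \<in> conj_small_loops \<rho>"
    unfolding conj_small_loops_iff using * q
    by (intro exI[of _ "q +++ \<alpha>"] exI[of _ \<beta>]) (auto intro!: pathin_joinpaths)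
qed

text \<open>The tether of the base point of \<open>\<beta>\<close> serves as
  \<open>\<alpha>\<close>. Closed up by itself it has trivial class, so the conjugating factors
  disappear.\<close>

lemma small_loop_in_D:
  assumes "pathin TX \<beta>" "\<beta> 0 = \<beta> 1" "\<And>s t. s \<in> {0..1} \<Longrightarrow> t \<in> {0..1} \<Longrightarrow> dist (\<beta> s) (\<beta> t) < \<rho>"
  shows "X.loop_class \<beta> \<in> D \<rho>"
proof -
  have y: "\<beta> 1 \<in> X"
    using path_finish_in_topspace[OF assms(1)] by simp
  have "X.loop_class (tether_X (\<beta> 1)) = \<one>\<^bsub>X.\<pi>\<^esub>"
  proof -
    have t: "pathin TX (tether_X (\<beta> 1))" "tether_X (\<beta> 1) 0 = x0" "tether_X (\<beta> 1) 1 = \<beta> 1"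
      using X.tether y by auto
    have "homotopic_pathsin TX (X.closed_up (tether_X (\<beta> 1))) ((\<lambda>_. x0) +++ (\<lambda>_. x0))"
      unfolding X.closed_up_def t X.base(2)
      using homotopic_pathsin_rinv[OF t(1)] t y by (intro homotopic_pathsin_join homotopic_pathsin_refl) (auto simp: x0)
    then have "X.loop_class (tether_X (\<beta> 1)) = path_class TX ((\<lambda>_. x0) +++ (\<lambda>_. x0))"
      unfolding X.loop_class_def by (rule path_class_eq)
    then show ?thesis
      by (simp add: fundamental_group_one joinpaths_def)
  qed
  then have "X.loop_class \<beta> \<in> conj_small_loops \<rho>"
    unfolding conj_small_loops_iff using assms X.tether[of "\<beta> 1"] y
    by (intro exI[of _ "tether_X (\<beta> 1)"] exI[of _ \<beta>]) auto
  then show ?thesis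
    unfolding D_eq by (rule generate.incl)
qed

end

section \<open>Rips complexes of geodesic spaces\<close>

lemma rips_iff:
  "\<sigma> \<in> rips X r \<longleftrightarrow> finite \<sigma> \<and> \<sigma> \<noteq> {} \<and> \<sigma> \<subseteq> X \<and> (\<forall>x\<in>\<sigma>. \<forall>y\<in>\<sigma>. dist x y < r)"
  unfolding rips_def using diameter_less_iff[of \<sigma> r] finite_imp_compact[of \<sigma>] by auto

lemma joinpaths_range: "(p +++ q) ` {0..1} \<subseteq> p ` {0..1} \<union> q ` {0..1}"
  using path_image_join_subset[of p q] by (simp add: path_image_def)

lemma reversepath_range: "reversepath p ` {0..1} = p ` {0..1}"
  using path_image_reversepath[of p] by (simp add: path_image_def)

locale rips_scale = geodesic X x0 for X :: "'a::metric_space set" and x0 +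
  fixes r :: real
  assumes r: "r > 0"
begin

abbreviation "K \<equiv> rips X r"
abbreviation "RK \<equiv> realization K"

definition near :: "'a \<Rightarrow> 'a \<Rightarrow> bool" where
  "near u v \<longleftrightarrow> u \<in> X \<and> v \<in> X \<and> dist u v < r"

lemma near_refl: "u \<in> X \<Longrightarrow> near u u"
  using r by (simp add: near_def)

lemma near_simplex2: "near u v \<Longrightarrow> {u, v} \<in> K"
  using r by (auto simp: near_def rips_iff dist_commute)

text \<open>A Rips complex is a flag complex: pairwise near points span a simplex.\<close>

lemma near_simplex3: "near u v \<Longrightarrow> near v w \<Longrightarrow> near u w \<Longrightarrow> {u, v, w} \<in> K"
  using r by (auto simp: near_def rips_iff dist_commute)

lemma simplex_near: "\<sigma> \<in> K \<Longrightarrow> u \<in> \<sigma> \<Longrightarrow> v \<in> \<sigma> \<Longrightarrow> near u v"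
  by (auto simp: near_def rips_iff)

sublocale S: simplicial_complex K
  by unfold_locales (auto simp: rips_iff intro: finite_subset)

lemma pathin_edge: "near u v \<Longrightarrow> pathin RK (segment_path (vertex_point u) v)"
  using S.pathin_segment_path[of "vertex_point u" v] S.vertex_point_in[of u "{u, v}"] near_simplex2[of u v]
  by (simp add: insert_commute)

lemma vertex_connected:
  "v \<in> X \<Longrightarrow> dist x0 v \<le> real n * (r / 2) \<Longrightarrow> \<exists>q. pathin RK q \<and> q 0 = vertex_point x0 \<and> q 1 = vertex_point v"
proof (induction n arbitrary: v)
  case 0
  then have "v = x0"
    by simp
  moreover have "vertex_point x0 \<in> topspace RK"
    using S.vertex_point_in[of x0 "{x0, x0}"] near_simplex2[OF near_refl[OF x0]] by simp
  ultimately show ?case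
    by (intro exI[of _ "\<lambda>_. vertex_point x0"]) simp
next
  case (Suc n)
  \<comment> \<open>If \<open>v\<close> is already within \<open>n\<close> steps, the minimum makes
    \<open>m\<close> equal to \<open>v\<close>; otherwise a step of length at most
    \<open>r / 2\<close>, hence less than \<open>r\<close>, remains.\<close>
  define d where "d = min (dist x0 v) (real n * (r / 2))"
  obtain m where m: "m \<in> X" "dist x0 m = d" "dist m v = dist x0 v - d"
    using geo_point[OF x0 Suc.prems(1), of d] r by (auto simp: d_def)
  obtain q where q: "pathin RK q" "q 0 = vertex_point x0" "q 1 = vertex_point m"
    using Suc.IH[OF m(1)] m(2) unfolding d_def by (metis min.cobounded2)
  have "near m v"
    using m Suc.prems r by (auto simp: near_def d_def min_def field_simps split: if_splits)
  then show ?case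
    using q by (intro exI[of _ "q +++ segment_path (vertex_point m) v"]) (auto intro!: pathin_joinpaths pathin_edge)
qed

lemma realization_connected:
  assumes z: "z \<in> topspace RK"
  shows "\<exists>q. pathin RK q \<and> q 0 = vertex_point x0 \<and> q 1 = z"
proof -
  have s: "support z \<in> K"
    using S.support_in[OF z] by blast
  then obtain v where v: "v \<in> support z" "v \<in> X"
    by (auto simp: rips_iff)
  obtain n :: nat where "dist x0 v / (r / 2) \<le> real n"
    using real_arch_simple by blast
  then have "dist x0 v \<le> real n * (r / 2)"
    using r by (simp add: field_simps)
  then obtain q where q: "pathin RK q" "q 0 = vertex_point x0" "q 1 = vertex_point v"
    using vertex_connected v by blast
  have "pathin RK (segment_path z v)"
    using S.pathin_segment_path[OF z] s v by (simp add: insert_absorb)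
  then show ?thesis
    using q by (intro exI[of _ "q +++ reversepath (segment_path z v)"]) (auto intro!: pathin_joinpaths pathin_reversepath)
qed

definition tether_K :: "('a \<Rightarrow> real) \<Rightarrow> real \<Rightarrow> 'a \<Rightarrow> real" where
  "tether_K z = (if z = vertex_point x0 then (\<lambda>_. vertex_point x0)
     else (SOME q. pathin RK q \<and> q 0 = vertex_point x0 \<and> q 1 = z))"

sublocale K: based_complex K "vertex_point x0" tether_K
proof unfold_locales
  show x0': "vertex_point x0 \<in> topspace RK"
    using S.vertex_point_in[of x0 "{x0, x0}"] near_simplex2[OF near_refl[OF x0]] by simp
  show "tether_K (vertex_point x0) = (\<lambda>_. vertex_point x0)"
    by (simp add: tether_K_def)
  fix y assume "y \<in> topspace RK"
  from someI_ex[OF realization_connected[OF this]]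
  show "pathin RK (tether_K y) \<and> tether_K y 0 = vertex_point x0 \<and> tether_K y 1 = y"
    using x0' by (auto simp: tether_K_def)
qed

section \<open>The quotient group, the two cocycles and the two covers\<close>

abbreviation "N \<equiv> D (3 * r / 2)"
abbreviation "Q \<equiv> X.\<pi> Mod N"

definition q :: "(real \<Rightarrow> 'a) set \<Rightarrow> (real \<Rightarrow> 'a) set set" where
  "q a = N #>\<^bsub>X.\<pi>\<^esub> a"

sublocale q: group_hom X.\<pi> Q q
proof -
  interpret normal N X.\<pi>
    by (rule D_normal)
  show "group_hom X.\<pi> Q q"
    using r_coset_hom_Mod factorgroup_is_group unfolding q_def
    by (intro group_hom.intro group_hom_axioms.intro) (auto intro: X.group_axioms)
qed

lemma q_small: "a \<in> N \<Longrightarrow> q a = \<one>\<^bsub>Q\<^esub>"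
  unfolding q_def
  using D_normal[of "3 * r / 2"] normal_imp_subgroup X.coset_join2 subgroup.mem_carrier one_FactGroup by metis

text \<open>The loop around the three paths has diameter less than \<open>3 * r / 2\<close> and dies
  in the quotient. Only the union of the three images matters, so the sides may be arbitrary paths
  as well as geodesics.\<close>

lemma q_triangle:
  assumes p: "pathin TX a" "pathin TX b" "pathin TX c" and ends: "a 1 = b 0" "c 0 = a 0" "c 1 = b 1"
    and small: "\<And>x y. x \<in> a ` {0..1} \<union> b ` {0..1} \<union> c ` {0..1} \<Longrightarrow> y \<in> a ` {0..1} \<union> b ` {0..1} \<union> c ` {0..1} \<Longrightarrow>
      dist x y < 3 * r / 2"
  shows "q (X.loop_class a) \<otimes>\<^bsub>Q\<^esub> q (X.loop_class b) = q (X.loop_class c)"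
proof -
  let ?\<beta> = "a +++ (b +++ reversepath c)"
  have "?\<beta> t \<in> a ` {0..1} \<union> b ` {0..1} \<union> c ` {0..1}" if "t \<in> {0..1}" for t
    using joinpaths_range[of a "b +++ reversepath c"] joinpaths_range[of b "reversepath c"]
      imageI[OF that, of ?\<beta>] unfolding reversepath_range by blast
  then have "X.loop_class ?\<beta> \<in> N"
    using p ends small by (intro small_loop_in_D) (auto intro!: pathin_joinpaths pathin_reversepath)
  then have "q (X.loop_class ?\<beta>) = \<one>\<^bsub>Q\<^esub>"
    by (rule q_small)
  moreover have "X.loop_class ?\<beta> = (X.loop_class a \<otimes>\<^bsub>X.\<pi>\<^esub> X.loop_class b) \<otimes>\<^bsub>X.\<pi>\<^esub> inv\<^bsub>X.\<pi>\<^esub> (X.loop_class c)"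
    using p ends by (simp add: X.loop_class_join X.loop_class_reverse pathin_joinpaths pathin_reversepath X.m_assoc)
  ultimately have "(q (X.loop_class a) \<otimes>\<^bsub>Q\<^esub> q (X.loop_class b)) \<otimes>\<^bsub>Q\<^esub> inv\<^bsub>Q\<^esub> (q (X.loop_class c)) = \<one>\<^bsub>Q\<^esub>"
    using p by (simp del: mult_FactGroup one_FactGroup)
  then show ?thesis
    using p q.H.inv_solve_right'[of "\<one>\<^bsub>Q\<^esub>" "q (X.loop_class a) \<otimes>\<^bsub>Q\<^esub> q (X.loop_class b)" "q (X.loop_class c)"]
    by (simp del: mult_FactGroup one_FactGroup)
qed

definition G :: "'a \<Rightarrow> 'a \<Rightarrow> (real \<Rightarrow> 'a) set set" where
  "G u v = q (X.loop_class (geo u v))"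

lemma G_closed: "u \<in> X \<Longrightarrow> v \<in> X \<Longrightarrow> G u v \<in> carrier Q"
  unfolding G_def by (intro q.hom_closed X.loop_class_carrier geo)

lemma G_trans:
  assumes "near u v" "near v w" "near u w"
  shows "G u v \<otimes>\<^bsub>Q\<^esub> G v w = G u w"
  unfolding G_def
proof (rule q_triangle)
  have X: "u \<in> X" "v \<in> X" "w \<in> X" and P: "dist u v + dist v w + dist u w < 3 * r"
    using assms by (auto simp: near_def)
  then show "pathin TX (geo u v)" "pathin TX (geo v w)" "pathin TX (geo u w)"
    "geo u v 1 = geo v w 0" "geo u w 0 = geo u v 0" "geo u w 1 = geo v w 1"
    using geo by auto
  let ?P = "dist u v + dist v w + dist u w"
  have same: "2 * dist x y \<le> ?P" if "x \<in> geo a b ` {0..1}" "y \<in> geo a b ` {0..1}" "a \<in> X" "b \<in> X" "2 * dist a b \<le> ?P" for x y a b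
    using that geo_dist[of a b] by fastforce
  \<comment> \<open>The triangle inequality bounds each side by half the perimeter, which settles
    two points on the same side.\<close>
  have per: "2 * dist u v \<le> ?P" "2 * dist v w \<le> ?P" "2 * dist u w \<le> ?P"
    using dist_triangle[of u v w] dist_triangle[of v w u] dist_triangle[of u w v] by (auto simp: dist_commute)
  have 12: "2 * dist x y \<le> ?P" if "x \<in> geo u v ` {0..1}" "y \<in> geo v w ` {0..1}" for x y
    using that between_triangle[of u v x w y] geo_between X by auto
  have 13: "2 * dist x y \<le> ?P" if "x \<in> geo u v ` {0..1}" "y \<in> geo u w ` {0..1}" for x y
    using that between_triangle[of v u x w y] geo_between[of u v] geo_between[of u w] X
    by (auto simp: between_commute[of v u] dist_commute)
  have 23: "2 * dist x y \<le> ?P" if "x \<in> geo v w ` {0..1}" "y \<in> geo u w ` {0..1}" for x y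
    using that between_triangle[of v w x u y] geo_between[of v w] geo_between[of u w] X
    by (auto simp: between_commute[of w u] dist_commute)
  fix x y assume "x \<in> geo u v ` {0..1} \<union> geo v w ` {0..1} \<union> geo u w ` {0..1}" "y \<in> geo u v ` {0..1} \<union> geo v w ` {0..1} \<union> geo u w ` {0..1}"
  then have "2 * dist x y \<le> ?P"
  proof (elim UnE)
  \<comment> \<open>Nine cases: both points on one side, or on two different sides in either
    order.\<close>
  qed ((rule same[OF _ _ X(1,2) per(1)] same[OF _ _ X(2,3) per(2)] same[OF _ _ X(1,3) per(3)]; assumption) |
       (rule 12 13 23; assumption) | (subst dist_commute, rule 12 13 23; assumption))+
  then show "dist x y < 3 * r / 2"
    using P by simp
qed

definition g :: "'a \<Rightarrow> 'a \<Rightarrow> (real \<Rightarrow> 'a \<Rightarrow> real) set" where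
  "g u v = K.loop_class (segment_path (vertex_point u) v)"

lemma g_closed: "near u v \<Longrightarrow> g u v \<in> carrier K.\<pi>"
  unfolding g_def by (intro K.loop_class_carrier pathin_edge)

text \<open>The edge from \<open>u\<close> to \<open>v\<close> is coned off to \<open>w\<close>
  inside the simplex spanned by the three vertices.\<close>

lemma g_trans:
  assumes "near u v" "near v w" "near u w"
  shows "g u v \<otimes>\<^bsub>K.\<pi>\<^esub> g v w = g u w"
proof -
  have "insert w (support (segment_path (vertex_point u) v t)) \<in> K" for t
    by (rule S.face_closed[OF near_simplex3[OF assms]]) (use support_segment_path[of "vertex_point u" v t] in auto)
  from K.loop_class_cone[OF pathin_edge[OF assms(1)] this] show ?thesis
    by (simp add: g_def)
qed

lemma g_same: "u \<in> X \<Longrightarrow> g u u = \<one>\<^bsub>K.\<pi>\<^esub>"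
  using g_trans[of u u u] g_closed[of u u] near_refl K.r_cancel_one by metis

lemma G_same: "u \<in> X \<Longrightarrow> G u u = \<one>\<^bsub>Q\<^esub>"
  by (simp add: G_def del: one_FactGroup)

lemma open_star_iff: "z \<in> open_star K v \<longleftrightarrow> z \<in> topspace RK \<and> v \<in> support z"
  by (auto simp: open_star_def support_def)

lemma open_star_near: "z \<in> open_star K u \<Longrightarrow> z \<in> open_star K v \<Longrightarrow> near u v"
  using S.support_in simplex_near unfolding open_star_iff by blast

lemma vertex_in_star [simp]: "v \<in> X \<Longrightarrow> vertex_point v \<in> open_star K v"
  unfolding open_star_iff using S.vertex_point_in[of v "{v, v}"] near_simplex2[OF near_refl] by auto

lemma topspace_stars: "topspace RK \<subseteq> (\<Union>v. open_star K v)"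
proof
  fix z assume z: "z \<in> topspace RK"
  then obtain v where "v \<in> support z"
    using S.support_in by (fastforce simp: rips_iff)
  then show "z \<in> (\<Union>v. open_star K v)"
    using z by (auto simp: open_star_iff)
qed

text \<open>Charts are indexed by the whole type; the empty value outside \<open>X\<close> ensures
  that every index of an inhabited chart is a vertex.\<close>

definition B :: "'a \<Rightarrow> 'a set" where
  "B v = (if v \<in> X then X \<inter> ball v (r / 2) else {})"

lemma B_iff: "x \<in> B v \<longleftrightarrow> v \<in> X \<and> x \<in> X \<and> dist v x < r / 2"
  by (auto simp: B_def)

lemma B_near: "x \<in> B u \<Longrightarrow> x \<in> B v \<Longrightarrow> near u v"
  using dist_triangle_half_r[of x u r v] by (auto simp: B_iff near_def dist_commute)

lemma B_self [simp]: "x \<in> X \<Longrightarrow> x \<in> B x"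
  using r by (simp add: B_iff)

lemma topspace_B: "topspace TX \<subseteq> (\<Union>v. B v)"
proof
  fix x assume "x \<in> topspace TX"
  then have "x \<in> B x"
    by simp
  then show "x \<in> (\<Union>v. B v)"
    by blast
qed

lemma openin_B: "openin TX (B v)"
  by (auto simp: B_def openin_open_Int)

sublocale KQ: based_cocycle RK "vertex_point x0" tether_K Q "open_star K" G x0
proof unfold_locales
  fix x u v w assume *: "x \<in> open_star K u" "x \<in> open_star K v"
  then show "G u v \<in> carrier Q"
    using open_star_near[OF *] by (auto simp: near_def intro: G_closed)
  assume "x \<in> open_star K w"
  then show "G u v \<otimes>\<^bsub>Q\<^esub> G v w = G u w"
    using G_trans open_star_near * by blast
qed (use openin_open_star topspace_stars x0 in auto)

text \<open>The edge cocycle over the stars takes values in the fundamental group of the space in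
  which the loops run. Its holonomy returns the loop, which identifies one of the
  composites.\<close>

sublocale KK: based_cocycle RK "vertex_point x0" tether_K K.\<pi> "open_star K" g x0
proof unfold_locales
  fix x u v w assume *: "x \<in> open_star K u" "x \<in> open_star K v"
  then show "g u v \<in> carrier K.\<pi>"
    using open_star_near[OF *] by (auto intro: g_closed)
  assume "x \<in> open_star K w"
  then show "g u v \<otimes>\<^bsub>K.\<pi>\<^esub> g v w = g u w"
    using g_trans open_star_near * by blast
qed (use openin_open_star topspace_stars x0 in auto)

sublocale XK: based_cocycle TX x0 tether_X K.\<pi> B g x0
proof unfold_locales
  fix x u v w assume *: "x \<in> B u" "x \<in> B v"
  then show "g u v \<in> carrier K.\<pi>"
    using B_near[OF *] by (auto intro: g_closed)
  assume "x \<in> B w"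
  then show "g u v \<otimes>\<^bsub>K.\<pi>\<^esub> g v w = g u w"
    using g_trans B_near * by blast
qed (simp_all only: openin_B topspace_B B_self x0)

text \<open>The counterpart on \<open>X\<close>: the geodesic cocycle over the balls returns the
  class of a loop modulo small loops, which identifies the other composite.\<close>

sublocale XQ: based_cocycle TX x0 tether_X Q B G x0
proof unfold_locales
  fix x u v w assume *: "x \<in> B u" "x \<in> B v"
  then show "G u v \<in> carrier Q"
    using B_near[OF *] by (auto simp: near_def intro: G_closed)
  assume "x \<in> B w"
  then show "G u v \<otimes>\<^bsub>Q\<^esub> G v w = G u w"
    using G_trans B_near * by blast
qed (simp_all only: openin_B topspace_B B_self x0)

section \<open>The comparison homomorphisms and their composites\<close>

abbreviation "\<Psi> \<equiv> KQ.holonomy_map"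
abbreviation "\<Phi> \<equiv> XK.holonomy_map"

text \<open>Every star met by the edge has index \<open>v\<close> or \<open>w\<close>, so the
  transition elements \<open>G v u\<close> form a section along it that is constant in time.\<close>

lemma holonomy_edge:
  assumes vw: "near v w"
  shows "holonomy Q (open_star K) G (segment_path (vertex_point v) w) v w = G v w"
proof -
  let ?p = "segment_path (vertex_point v) w"
  have X: "v \<in> X" "w \<in> X"
    using vw by (auto simp: near_def)
  have near: "near v u" if "?p t \<in> open_star K u" for t u
    using that support_segment_path[of "vertex_point v" w t] vw near_refl[OF X(1)]
    by (auto simp: open_star_iff)
  have "holonomy Q (open_star K) G ?p v w = inv\<^bsub>Q\<^esub> (G v v) \<otimes>\<^bsub>Q\<^esub> G v w"
  proof (rule KQ.holonomyI[OF pathin_edge[OF vw]])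
    fix t u u' assume "?p t \<in> open_star K u" "?p t \<in> open_star K u'"
    then show "G v u \<otimes>\<^bsub>Q\<^esub> G u u' = G v u'"
      using near open_star_near by (intro G_trans) blast+
  next
    fix t :: real and u
    show "\<exists>S. open S \<and> t \<in> S \<and> (\<forall>s\<in>S. s \<in> {0..1} \<longrightarrow> ?p s \<in> open_star K u \<longrightarrow> G v u = G v u)"
      by (intro exI[of _ UNIV]) auto
  next
    fix t u assume "?p t \<in> open_star K u"
    from near[OF this] show "G v u \<in> carrier Q"
      by (auto simp: near_def intro: G_closed)
  qed (use X in auto)
  also have "\<dots> = G v w"
    using X G_same G_closed by (simp del: one_FactGroup mult_FactGroup)
  finally show ?thesis .
qed

text \<open>The centre \<open>u\<close> of a ball met by the geodesic need not be near
  \<open>v\<close>, so the section goes through the moving point: from \<open>v\<close> to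
  \<open>?p t\<close> and then to \<open>u\<close>. Points of the geodesic are pairwise near, so the
  product is the same for all times at which it is read in \<open>u\<close>.\<close>

lemma holonomy_geo:
  assumes vw: "near v w"
  shows "holonomy K.\<pi> B g (geo v w) v w = g v w"
proof -
  let ?p = "geo v w"
  have X: "v \<in> X" "w \<in> X"
    using vw by (auto simp: near_def)
  have pX: "?p t \<in> X" if "t \<in> {0..1}" for t
    using geo_in[OF X that] .
  have near: "near (?p s) (?p t)" if "s \<in> {0..1}" "t \<in> {0..1}" for s t
    using geo_dist[OF X that] vw pX that by (auto simp: near_def)
  have near0: "near v (?p t)" if "t \<in> {0..1}" for t
    using near[of 0 t] that geo[OF X] by simp
  have nearB: "near (?p t) u" if "t \<in> {0..1}" "?p t \<in> B u" for t u
    using that B_near[OF B_self] pX by blast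
  have "holonomy K.\<pi> B g ?p v w = inv\<^bsub>K.\<pi>\<^esub> (g v (?p 0) \<otimes>\<^bsub>K.\<pi>\<^esub> g (?p 0) v) \<otimes>\<^bsub>K.\<pi>\<^esub> (g v (?p 1) \<otimes>\<^bsub>K.\<pi>\<^esub> g (?p 1) w)"
  proof (rule XK.holonomyI[OF geo(1)[OF X]])
    fix t u assume t: "t \<in> {0..1}" "?p t \<in> B u"
    show "g v (?p t) \<otimes>\<^bsub>K.\<pi>\<^esub> g (?p t) u \<in> carrier K.\<pi>"
      using near0 nearB t by (intro K.m_closed g_closed) auto
    obtain e where e: "e > 0" "\<And>s. s \<in> {0..1} \<Longrightarrow> dist s t < e \<Longrightarrow> ?p s \<in> B u"
    proof -
      obtain S where "open S" "?p -` B u \<inter> {0..1} = {0..1} \<inter> S"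
        using XK.vimage_chart_open[OF geo(1)[OF X, unfolded pathin_def], of u] unfolding openin_open by blast
      moreover from this obtain e where "e > 0" "ball t e \<subseteq> S"
        using t openE by (metis IntD2 IntI vimageI)
      ultimately show ?thesis
        by (intro that[of e]) (auto simp: dist_commute subset_iff)
    qed
    have "g v (?p s) \<otimes>\<^bsub>K.\<pi>\<^esub> g (?p s) u = g v (?p t) \<otimes>\<^bsub>K.\<pi>\<^esub> g (?p t) u"
      if s: "s \<in> {0..1}" "?p s \<in> B u" for s
    proof -
      have "g v (?p t) = g v (?p s) \<otimes>\<^bsub>K.\<pi>\<^esub> g (?p s) (?p t)"
        using s t near near0 by (intro g_trans[symmetric]) auto
      moreover have "g (?p s) u = g (?p s) (?p t) \<otimes>\<^bsub>K.\<pi>\<^esub> g (?p t) u"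
        using s t near nearB by (intro g_trans[symmetric]) auto
      ultimately show ?thesis
        using s t near near0 nearB g_closed by (simp add: K.m_assoc)
    qed
    then show "\<exists>S. open S \<and> t \<in> S \<and> (\<forall>s\<in>S. s \<in> {0..1} \<longrightarrow> ?p s \<in> B u \<longrightarrow>
        g v (?p s) \<otimes>\<^bsub>K.\<pi>\<^esub> g (?p s) u = g v (?p t) \<otimes>\<^bsub>K.\<pi>\<^esub> g (?p t) u)"
      by (intro exI[of _ UNIV]) auto
  next
    fix t u u' assume t: "t \<in> {0..1}" "?p t \<in> B u" "?p t \<in> B u'"
    then have "g (?p t) u \<otimes>\<^bsub>K.\<pi>\<^esub> g u u' = g (?p t) u'"
      using nearB B_near by (intro g_trans) auto
    then show "g v (?p t) \<otimes>\<^bsub>K.\<pi>\<^esub> g (?p t) u \<otimes>\<^bsub>K.\<pi>\<^esub> g u u' = g v (?p t) \<otimes>\<^bsub>K.\<pi>\<^esub> g (?p t) u'"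
      using t near0 nearB B_near g_closed by (simp add: K.m_assoc)
  qed (use X geo in auto)
  also have "\<dots> = g v w"
    using X geo[OF X] g_same g_closed[OF vw] by simp
  finally show ?thesis .
qed

text \<open>The holonomy along the tether of a vertex. The value one outside \<open>X\<close> is a
  default that makes the gauge total, since the gauge law asks for a group element at every
  index.\<close>

definition gauge_Q :: "'a \<Rightarrow> (real \<Rightarrow> 'a) set set" where
  "gauge_Q v = (if v \<in> X then holonomy Q (open_star K) G (tether_K (vertex_point v)) x0 v else \<one>\<^bsub>Q\<^esub>)"

definition gauge_K :: "'a \<Rightarrow> (real \<Rightarrow> 'a \<Rightarrow> real) set" where
  "gauge_K v = (if v \<in> X then holonomy K.\<pi> B g (tether_X v) x0 v else \<one>\<^bsub>K.\<pi>\<^esub>)"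

lemma vertex_in_RK: "v \<in> X \<Longrightarrow> vertex_point v \<in> topspace RK"
  using vertex_in_star open_star_iff by blast

lemma gauge_Q_closed: "gauge_Q v \<in> carrier Q"
  unfolding gauge_Q_def using K.tether[OF vertex_in_RK] x0
  by (auto intro!: KQ.holonomy_closed simp del: one_FactGroup)

lemma gauge_K_closed: "gauge_K v \<in> carrier K.\<pi>"
  unfolding gauge_K_def using X.tether x0 by (auto intro!: XK.holonomy_closed)

lemma gauge_Q_base: "gauge_Q x0 = \<one>\<^bsub>Q\<^esub>"
  unfolding gauge_Q_def K.base(2) using x0 vertex_in_RK[OF x0] G_same[OF x0]
  by (simp del: one_FactGroup) (subst KQ.holonomy_chart; simp del: one_FactGroup)

lemma gauge_K_base: "gauge_K x0 = \<one>\<^bsub>K.\<pi>\<^esub>"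
  unfolding gauge_K_def X.base(2) using x0 g_same[OF x0]
  by simp (subst XK.holonomy_chart; simp)

text \<open>The edge is not a loop, and its class in the group includes the tethers of its ends;
  their holonomies are the gauge factors. So \<open>\<Psi>\<close> takes \<open>g\<close> to a
  cocycle gauge equivalent to \<open>G\<close>, with the same holonomy on based loops.\<close>

lemma \<Psi>_g: "near v w \<Longrightarrow> \<Psi> (g v w) = gauge_Q v \<otimes>\<^bsub>Q\<^esub> G v w \<otimes>\<^bsub>Q\<^esub> inv\<^bsub>Q\<^esub> (gauge_Q w)"
  using KQ.holonomy_map_loop_class[OF pathin_edge[of v w], of v w] holonomy_edge[of v w]
  by (simp add: g_def gauge_Q_def near_def del: mult_FactGroup one_FactGroup)

lemma \<Phi>_geo: "near v w \<Longrightarrow> \<Phi> (X.loop_class (geo v w)) = gauge_K v \<otimes>\<^bsub>K.\<pi>\<^esub> g v w \<otimes>\<^bsub>K.\<pi>\<^esub> inv\<^bsub>K.\<pi>\<^esub> (gauge_K w)"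
  using XK.holonomy_map_loop_class[OF geo(1)[of v w], of v w] holonomy_geo[of v w] geo[of v w]
  by (simp add: gauge_K_def near_def)

text \<open>Geodesics to the centres of the balls provide the paths \<open>E\<close>, so the cocycle
  built from geodesics is integrated back to the path itself.\<close>

lemma holonomy_X:
  assumes p: "pathin TX p" "p 0 = x0" "p 1 = x0"
  shows "holonomy Q B G p x0 x0 = q (X.loop_class p)"
proof -
  have "holonomy Q B G p x0 x0 = inv\<^bsub>Q\<^esub> (G (p 0) x0) \<otimes>\<^bsub>Q\<^esub> (q (X.loop_class p) \<otimes>\<^bsub>Q\<^esub> G (p 1) x0)"
  proof (rule XQ.holonomy_self[where E = G and \<kappa> = q, OF p(1)])
    fix b v assume b: "pathin TX b" "\<And>t. t \<in> {0..1} \<Longrightarrow> b t \<in> B v"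
    have v: "v \<in> X" and bX: "b 0 \<in> X" "b 1 \<in> X"
      using b(2)[of 0] b(2)[of 1] by (auto simp: B_iff)
    \<comment> \<open>A geodesic to the centre of a ball does not leave the ball. Each local
      triangle therefore has diameter less than \<open>r\<close>, within the bound
      \<open>3 * r / 2\<close>.\<close>
    have in_B: "geo (b i) v t \<in> B v" if "i \<in> {0..1}" "t \<in> {0..1}" for i t
    proof -
      have "b i \<in> X" "dist v (b i) < r / 2"
        using b(2)[OF that(1)] by (auto simp: B_iff)
      then show ?thesis
        using geo_dist[of "b i" v 1 t] geo(3)[of "b i" v] geo_in[of "b i" v t] v that
        by (auto simp: B_iff dist_commute)
    qed
    show "q (X.loop_class b) \<otimes>\<^bsub>Q\<^esub> G (b 1) v = G (b 0) v"
      unfolding G_def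
    proof (rule q_triangle)
      fix x y assume "x \<in> b ` {0..1} \<union> geo (b 1) v ` {0..1} \<union> geo (b 0) v ` {0..1}"
        "y \<in> b ` {0..1} \<union> geo (b 1) v ` {0..1} \<union> geo (b 0) v ` {0..1}"
      then have "x \<in> B v" "y \<in> B v"
        using b(2) in_B[of 0] in_B[of 1] by auto
      then have "dist x y < r"
        using dist_triangle_half_r[of v x r y] by (auto simp: B_iff)
      then show "dist x y < 3 * r / 2"
        using r by simp
    qed (use b geo v bX in auto)
  next
    fix z v w assume "z \<in> B v" "z \<in> B w"
    then show "G z v \<otimes>\<^bsub>Q\<^esub> G v w = G z w"
      using B_near[of z z v] B_near[of z z w] B_near[of z v w] r by (intro G_trans) (auto simp: B_iff)
  next
    show "q \<in> hom X.\<pi> Q"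
      by (rule q.homh)
  qed (use p x0 r G_closed in \<open>auto simp: B_iff\<close>)
  then show ?thesis
    using p G_same[OF x0] by (simp del: one_FactGroup mult_FactGroup)
qed

text \<open>Straight segments to the vertices of the support provide the paths \<open>E\<close>. The
  cone over a path inside one star gives the local condition, and the cone over a segment gives the
  compatibility with \<open>g\<close>.\<close>

lemma holonomy_K:
  assumes p: "pathin RK p" "p 0 = vertex_point x0" "p 1 = vertex_point x0"
  shows "holonomy K.\<pi> (open_star K) g p x0 x0 = K.loop_class p"
proof -
  have star: "insert w (support z) \<in> K" if "z \<in> open_star K w" for z w
    using that S.support_in[of z] by (simp add: open_star_iff insert_absorb)
  have seg: "pathin RK (segment_path z w)" if "z \<in> open_star K w" for z w
    using S.pathin_segment_path[of z w] star[OF that] that by (simp add: open_star_iff)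
  have "holonomy K.\<pi> (open_star K) g p x0 x0 = inv\<^bsub>K.\<pi>\<^esub> (K.loop_class (segment_path (p 0) x0)) \<otimes>\<^bsub>K.\<pi>\<^esub>
      (id (K.loop_class p) \<otimes>\<^bsub>K.\<pi>\<^esub> K.loop_class (segment_path (p 1) x0))"
  proof (rule KK.holonomy_self[where E = "\<lambda>z v. K.loop_class (segment_path z v)" and \<kappa> = id, OF p(1)])
    fix b v assume "pathin RK b" "\<And>t. t \<in> {0..1} \<Longrightarrow> b t \<in> open_star K v"
    then show "id (K.loop_class b) \<otimes>\<^bsub>K.\<pi>\<^esub> K.loop_class (segment_path (b 1) v) = K.loop_class (segment_path (b 0) v)"
      using K.loop_class_cone[of b v] star by simp
  next
    fix z v w assume z: "z \<in> open_star K v" "z \<in> open_star K w"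
    have "insert w (support (segment_path z v t)) \<in> K" for t
      by (rule S.face_closed[OF star[OF z(2)]])
         (use support_segment_path[of z v t] z in \<open>auto simp: open_star_iff\<close>)
    from K.loop_class_cone[OF seg[OF z(1)] this]
    show "K.loop_class (segment_path z v) \<otimes>\<^bsub>K.\<pi>\<^esub> g v w = K.loop_class (segment_path z w)"
      by (simp add: g_def)
  next
    show "id \<in> hom K.\<pi> K.\<pi>"
      by (auto simp: hom_def)
  qed (use p x0 seg in auto)
  then show ?thesis
    using p vertex_in_RK[OF x0] by simp
qed

text \<open>\<open>\<Psi>\<close> is moved inside the holonomy, where it replaces \<open>g\<close>
  by a gauge transform of \<open>G\<close>. The gauge is one at the base point, and the holonomy of
  \<open>G\<close> over the balls returns the class of \<open>p\<close>.\<close>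

lemma \<Psi>_\<Phi>:
  assumes "a \<in> carrier X.\<pi>"
  shows "\<Psi> (\<Phi> a) = q a"
proof -
  obtain p where p: "pathin TX p" "p 0 = x0" "p 1 = x0" "a = path_class TX p" "a = X.loop_class p"
    using X.carrier_loop_class[OF assms] by blast
  have B: "p 0 \<in> B x0" "p 1 \<in> B x0"
    using p x0 by auto
  have "\<Psi> (\<Phi> a) = \<Psi> (holonomy K.\<pi> B g p x0 x0)"
    using p XK.holonomy_map by simp
  also have "\<dots> = holonomy Q B (\<lambda>u v. \<Psi> (g u v)) p x0 x0"
    by (rule XK.holonomy_hom[symmetric]) (use p B KQ.holonomy_map_hom q.H.group_axioms in auto)
  also have "\<dots> = holonomy Q B (\<lambda>u v. gauge_Q u \<otimes>\<^bsub>Q\<^esub> G u v \<otimes>\<^bsub>Q\<^esub> inv\<^bsub>Q\<^esub> (gauge_Q v)) p x0 x0"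
    by (rule holonomy_cong) (use B_near \<Psi>_g in blast)
  also have "\<dots> = gauge_Q x0 \<otimes>\<^bsub>Q\<^esub> holonomy Q B G p x0 x0 \<otimes>\<^bsub>Q\<^esub> inv\<^bsub>Q\<^esub> (gauge_Q x0)"
    by (rule XQ.holonomy_gauge[OF gauge_Q_closed p(1) B])
  also have "\<dots> = q a"
    using holonomy_X[OF p(1-3)] p assms gauge_Q_base by (simp del: one_FactGroup mult_FactGroup)
  finally show ?thesis .
qed

text \<open>A loop of diameter less than \<open>3r/2\<close> is coned off to its base point \<open>x\<close>: every \<open>\<beta> t\<close> is joined to
  \<open>x\<close> through a point \<open>m t\<close> on a geodesic, at distance less than \<open>r/2\<close> from \<open>x\<close> and less than \<open>r\<close> from \<open>\<beta> t\<close>.\<close>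

lemma holonomy_small_loop:
  assumes \<beta>: "pathin TX \<beta>" "\<beta> 1 = \<beta> 0" and small: "\<And>s t. s \<in> {0..1} \<Longrightarrow> t \<in> {0..1} \<Longrightarrow> dist (\<beta> s) (\<beta> t) < 3 * r / 2"
  shows "holonomy K.\<pi> B g \<beta> (\<beta> 0) (\<beta> 0) = \<one>\<^bsub>K.\<pi>\<^esub>"
proof -
  let ?x = "\<beta> 0"
  have \<beta>X: "\<beta> t \<in> X" if "t \<in> {0..1}" for t
    using pathin_in_topspace[OF \<beta>(1)] that by auto
  have "\<exists>m\<in>X. dist ?x m < r / 2 \<and> dist m (\<beta> t) < r" if t: "t \<in> {0..1}" for t
  proof -
    \<comment> \<open>One third is the ratio in which \<open>3 * r / 2\<close> splits into
      \<open>r / 2\<close> and \<open>r\<close>. The first bound makes any two of the points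
      \<open>m t\<close> near each other, the second makes \<open>m t\<close> near
      \<open>\<beta> t\<close>.\<close>
    obtain m where "m \<in> X" "dist ?x m = dist ?x (\<beta> t) / 3" "dist m (\<beta> t) = dist ?x (\<beta> t) - dist ?x (\<beta> t) / 3"
      by (rule geo_point[of ?x "\<beta> t" "dist ?x (\<beta> t) / 3"]) (use \<beta>X[of 0] \<beta>X[OF t] in auto)
    then show ?thesis
      using small[of 0 t] t by (intro bexI[of _ m]) auto
  qed
  then obtain m where m: "\<And>t. t \<in> {0..1} \<Longrightarrow> m t \<in> X \<and> dist ?x (m t) < r / 2 \<and> dist (m t) (\<beta> t) < r"
    by metis
  have xm: "near ?x (m t)" if "t \<in> {0..1}" for t
    using m[OF that] \<beta>X[of 0] r by (auto simp: near_def)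
  have mb: "near (m t) (\<beta> t)" if "t \<in> {0..1}" for t
    using m[OF that] \<beta>X[OF that] by (auto simp: near_def)
  have mm: "near (m s) (m t)" if "s \<in> {0..1}" "t \<in> {0..1}" for s t
    using m[OF that(1)] m[OF that(2)] dist_triangle_half_r[of ?x "m s" r "m t"] by (auto simp: near_def)
  have bB: "near (\<beta> t) u" if "t \<in> {0..1}" "\<beta> t \<in> B u" for t u
    using that B_near[OF B_self] \<beta>X by blast
  \<comment> \<open>\<open>h t\<close> is the class of the edge path from \<open>?x\<close> through
    \<open>m t\<close> to \<open>\<beta> t\<close>.\<close>
  define h where "h t = g ?x (m t) \<otimes>\<^bsub>K.\<pi>\<^esub> g (m t) (\<beta> t)" for t
  have h_closed: "h t \<in> carrier K.\<pi>" if "t \<in> {0..1}" for t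
    unfolding h_def using that xm mb by (intro K.m_closed g_closed)
  \<comment> \<open>The edge path is slid across three simplices: \<open>?x\<close>,
    \<open>m s\<close>, \<open>m t\<close>; then \<open>m s\<close>, \<open>m t\<close>,
    \<open>\<beta> s\<close>; then \<open>m t\<close>, \<open>\<beta> s\<close>,
    \<open>\<beta> t\<close>.\<close>
  have h_move: "h s \<otimes>\<^bsub>K.\<pi>\<^esub> g (\<beta> s) (\<beta> t) = h t"
    if s: "s \<in> {0..1}" "t \<in> {0..1}" "near (\<beta> s) (\<beta> t)" "near (m t) (\<beta> s)" for s t
  proof -
    have "g ?x (m t) = g ?x (m s) \<otimes>\<^bsub>K.\<pi>\<^esub> g (m s) (m t)"
      using s xm mm by (intro g_trans[symmetric]) auto
    moreover have "g (m s) (\<beta> s) = g (m s) (m t) \<otimes>\<^bsub>K.\<pi>\<^esub> g (m t) (\<beta> s)"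
      using s mb mm by (intro g_trans[symmetric]) auto
    moreover have "g (m t) (\<beta> t) = g (m t) (\<beta> s) \<otimes>\<^bsub>K.\<pi>\<^esub> g (\<beta> s) (\<beta> t)"
      using s mb by (intro g_trans[symmetric]) auto
    ultimately show ?thesis
      unfolding h_def using s xm mm mb g_closed by (simp add: K.m_assoc)
  qed
  have cont: "continuous_on {0..1} \<beta>"
    using \<beta>(1) by (simp add: pathin_def)
  have "holonomy K.\<pi> B g \<beta> ?x ?x = inv\<^bsub>K.\<pi>\<^esub> (h 0 \<otimes>\<^bsub>K.\<pi>\<^esub> g (\<beta> 0) ?x) \<otimes>\<^bsub>K.\<pi>\<^esub> (h 1 \<otimes>\<^bsub>K.\<pi>\<^esub> g (\<beta> 1) ?x)"
  proof (rule XK.holonomyI[OF \<beta>(1)])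
    fix t u assume t: "t \<in> {0..1}" "\<beta> t \<in> B u"
    show "h t \<otimes>\<^bsub>K.\<pi>\<^esub> g (\<beta> t) u \<in> carrier K.\<pi>"
      using h_closed bB t by (intro K.m_closed g_closed) auto
    \<comment> \<open>The choice of \<open>m\<close> need not be continuous. The slack
      \<open>e\<close> keeps \<open>\<beta> s\<close> near the fixed point \<open>m t\<close> for
      \<open>s\<close> close to \<open>t\<close>, which is what \<open>h_move\<close>
      requires.\<close>
    define e where "e = r - dist (m t) (\<beta> t)"
    have "e > 0"
      using m[OF t(1)] by (simp add: e_def)
    then obtain d where d: "d > 0" "\<And>s. s \<in> {0..1} \<Longrightarrow> dist s t < d \<Longrightarrow> dist (\<beta> s) (\<beta> t) < e"
      using cont t(1) unfolding continuous_on_iff by blast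
    have "h s \<otimes>\<^bsub>K.\<pi>\<^esub> g (\<beta> s) u = h t \<otimes>\<^bsub>K.\<pi>\<^esub> g (\<beta> t) u"
      if s: "s \<in> ball t d" "s \<in> {0..1}" "\<beta> s \<in> B u" for s
    proof -
      have e: "dist (\<beta> s) (\<beta> t) < e"
        using d s by (simp add: dist_commute)
      then have 1: "near (\<beta> s) (\<beta> t)"
        using \<beta>X[OF s(2)] \<beta>X[OF t(1)] zero_le_dist[of "m t" "\<beta> t"] unfolding near_def e_def by linarith
      have 2: "near (m t) (\<beta> s)"
        using e dist_triangle[of "m t" "\<beta> s" "\<beta> t"] \<beta>X s m[OF t(1)] by (auto simp: near_def e_def dist_commute)
      have "g (\<beta> s) u = g (\<beta> s) (\<beta> t) \<otimes>\<^bsub>K.\<pi>\<^esub> g (\<beta> t) u"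
        using 1 bB s t by (intro g_trans[symmetric]) auto
      then show ?thesis
        using h_move[OF s(2) t(1) 1 2] h_closed[OF s(2)] g_closed[OF 1] g_closed[OF bB[OF t]]
        by (simp add: K.m_assoc[symmetric])
    qed
    then show "\<exists>S. open S \<and> t \<in> S \<and> (\<forall>s\<in>S. s \<in> {0..1} \<longrightarrow> \<beta> s \<in> B u \<longrightarrow>
        h s \<otimes>\<^bsub>K.\<pi>\<^esub> g (\<beta> s) u = h t \<otimes>\<^bsub>K.\<pi>\<^esub> g (\<beta> t) u)"
      using d(1) by (intro exI[of _ "ball t d"]) auto
  next
    fix t u u' assume t: "t \<in> {0..1}" "\<beta> t \<in> B u" "\<beta> t \<in> B u'"
    then have "g (\<beta> t) u \<otimes>\<^bsub>K.\<pi>\<^esub> g u u' = g (\<beta> t) u'"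
      using bB B_near by (intro g_trans) auto
    then show "h t \<otimes>\<^bsub>K.\<pi>\<^esub> g (\<beta> t) u \<otimes>\<^bsub>K.\<pi>\<^esub> g u u' = h t \<otimes>\<^bsub>K.\<pi>\<^esub> g (\<beta> t) u'"
      using t h_closed bB B_near g_closed by (simp add: K.m_assoc)
  qed (use \<beta>X[of 0] \<beta>(2) in auto)
  \<comment> \<open>The points \<open>m 0\<close> and \<open>m 1\<close> were chosen independently
    and may differ. Since \<open>\<beta>\<close> is closed, \<open>h_move\<close> passes directly
    from time 0 to time 1 along a trivial edge.\<close>
  moreover have "h 0 = h 1"
    using h_move[of 0 1] \<beta>(2) mb[of 1] near_refl[OF \<beta>X[of 0]] g_same[OF \<beta>X[of 0]] h_closed[of 0] by simp
  ultimately show ?thesis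
    using \<beta>(2) h_closed[of 1] g_same[OF \<beta>X[of 0]] by simp
qed

sublocale \<Phi>: group_hom X.\<pi> K.\<pi> \<Phi>
  by unfold_locales (rule XK.holonomy_map_hom)

lemma \<Phi>_small_loop:
  assumes \<beta>: "pathin TX \<beta>" "\<beta> 1 = \<beta> 0" and small: "\<And>s t. s \<in> {0..1} \<Longrightarrow> t \<in> {0..1} \<Longrightarrow> dist (\<beta> s) (\<beta> t) < 3 * r / 2"
  shows "\<Phi> (X.loop_class \<beta>) = \<one>\<^bsub>K.\<pi>\<^esub>"
proof -
  have x: "\<beta> 0 \<in> X"
    using path_start_in_topspace[OF \<beta>(1)] by simp
  have "\<Phi> (X.loop_class \<beta>) = gauge_K (\<beta> 0) \<otimes>\<^bsub>K.\<pi>\<^esub> holonomy K.\<pi> B g \<beta> (\<beta> 0) (\<beta> 0) \<otimes>\<^bsub>K.\<pi>\<^esub> inv\<^bsub>K.\<pi>\<^esub> (gauge_K (\<beta> 0))"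
    using XK.holonomy_map_loop_class[OF \<beta>(1), of "\<beta> 0" "\<beta> 0"] \<beta>(2) x by (simp add: gauge_K_def)
  then show ?thesis
    using holonomy_small_loop[OF assms] gauge_K_closed by simp
qed

lemma N_kernel: "N \<subseteq> kernel X.\<pi> K.\<pi> \<Phi>"
  unfolding D_eq
proof (rule X.generate_subgroup_incl[OF _ \<Phi>.subgroup_kernel], rule subsetI)
  fix A assume A: "A \<in> conj_small_loops (3 * r / 2)"
  then obtain \<alpha> \<beta> where *: "pathin TX \<alpha>" "pathin TX \<beta>" "\<beta> 0 = \<alpha> 1" "\<beta> 1 = \<alpha> 1"
     "\<forall>s\<in>{0..1}. \<forall>t\<in>{0..1}. dist (\<beta> s) (\<beta> t) < 3 * r / 2"
     "A = X.loop_class \<alpha> \<otimes>\<^bsub>X.\<pi>\<^esub> X.loop_class \<beta> \<otimes>\<^bsub>X.\<pi>\<^esub> inv\<^bsub>X.\<pi>\<^esub> (X.loop_class \<alpha>)"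
    unfolding conj_small_loops_iff by blast
  have "\<Phi> (X.loop_class \<beta>) = \<one>\<^bsub>K.\<pi>\<^esub>"
    using * by (intro \<Phi>_small_loop) auto
  then show "A \<in> kernel X.\<pi> K.\<pi> \<Phi>"
    using * by (simp add: kernel_def)
qed

text \<open>\<open>G\<close> has values in the quotient, so the inverse has to be the map induced by
  \<open>\<Phi>\<close>, which exists because small loops lie in the kernel. It takes
  \<open>G\<close> to a gauge transform of \<open>g\<close>, whose holonomy over the stars returns
  the loop.\<close>

lemma \<Phi>_\<Psi>:
  obtains \<Phi>' where "\<Phi>' \<in> hom Q K.\<pi>" "\<And>a. a \<in> carrier X.\<pi> \<Longrightarrow> \<Phi>' (q a) = \<Phi> a"
    "\<And>u. u \<in> carrier K.\<pi> \<Longrightarrow> \<Phi>' (\<Psi> u) = u"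
proof -
  obtain \<Phi>' where \<Phi>': "\<Phi>' \<in> hom Q K.\<pi>" "\<And>a. a \<in> carrier X.\<pi> \<Longrightarrow> \<Phi>' (q a) = \<Phi> a"
    using \<Phi>.FactGroup_universal_kernel[OF D_normal N_kernel] unfolding q_def by blast
  have "\<Phi>' (\<Psi> u) = u" if u: "u \<in> carrier K.\<pi>" for u
  proof -
    obtain p where p: "pathin RK p" "p 0 = vertex_point x0" "p 1 = vertex_point x0" "u = path_class RK p" "u = K.loop_class p"
      using K.carrier_loop_class[OF u] by blast
    have S: "p 0 \<in> open_star K x0" "p 1 \<in> open_star K x0"
      using p x0 by auto
    have "\<Phi>' (\<Psi> u) = \<Phi>' (holonomy Q (open_star K) G p x0 x0)"
      using p KQ.holonomy_map by simp
    also have "\<dots> = holonomy K.\<pi> (open_star K) (\<lambda>u v. \<Phi>' (G u v)) p x0 x0"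
      by (rule KQ.holonomy_hom[symmetric]) (use p S \<Phi>' K.group_axioms in auto)
    also have "\<dots> = holonomy K.\<pi> (open_star K) (\<lambda>u v. gauge_K u \<otimes>\<^bsub>K.\<pi>\<^esub> g u v \<otimes>\<^bsub>K.\<pi>\<^esub> inv\<^bsub>K.\<pi>\<^esub> (gauge_K v)) p x0 x0"
    proof (rule holonomy_cong)
      fix x u v assume "x \<in> open_star K u" "x \<in> open_star K v"
      then have n: "near u v"
        by (rule open_star_near)
      then have "X.loop_class (geo u v) \<in> carrier X.\<pi>"
        by (auto simp: near_def intro!: X.loop_class_carrier geo)
      then show "\<Phi>' (G u v) = gauge_K u \<otimes>\<^bsub>K.\<pi>\<^esub> g u v \<otimes>\<^bsub>K.\<pi>\<^esub> inv\<^bsub>K.\<pi>\<^esub> (gauge_K v)"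
        using \<Phi>'(2) \<Phi>_geo[OF n] by (simp add: G_def)
    qed
    also have "\<dots> = gauge_K x0 \<otimes>\<^bsub>K.\<pi>\<^esub> holonomy K.\<pi> (open_star K) g p x0 x0 \<otimes>\<^bsub>K.\<pi>\<^esub> inv\<^bsub>K.\<pi>\<^esub> (gauge_K x0)"
      by (rule KK.holonomy_gauge[OF gauge_K_closed p(1) S])
    also have "\<dots> = u"
      using holonomy_K[OF p(1-3)] p u gauge_K_base by simp
    finally show ?thesis .
  qed
  then show ?thesis
    using that \<Phi>' by blast
qed

text \<open>The induced map is a left inverse, and \<open>\<Psi>\<close> after \<open>\<Phi>\<close>
  is the quotient map, hence onto.\<close>

theorem \<Psi>_iso: "\<Psi> \<in> iso K.\<pi> Q"
proof -
  obtain \<Phi>' where \<Phi>': "\<And>u. u \<in> carrier K.\<pi> \<Longrightarrow> \<Phi>' (\<Psi> u) = u"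
    using \<Phi>_\<Psi> by metis
  then have "inj_on \<Psi> (carrier K.\<pi>)"
    by (rule inj_on_inverseI)
  moreover have "\<Psi> ` carrier K.\<pi> = carrier Q"
  proof
    show "\<Psi> ` carrier K.\<pi> \<subseteq> carrier Q"
      using KQ.holonomy_map_hom by (auto simp: hom_def)
    show "carrier Q \<subseteq> \<Psi> ` carrier K.\<pi>"
    proof
      fix A assume "A \<in> carrier Q"
      then obtain a where "a \<in> carrier X.\<pi>" "A = q a"
        by (auto simp: carrier_FactGroup q_def)
      then show "A \<in> \<Psi> ` carrier K.\<pi>"
        using \<Psi>_\<Phi>[of a] \<Phi>.hom_closed[of a] by (metis imageI)
    qed
  qed
  ultimately show ?thesis
    using KQ.holonomy_map_hom by (simp add: iso_def bij_betw_def)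
qed

end

section \<open>Bonding maps\<close>

lemma natural_quotient_rcoset:
  assumes "group G" "N \<lhd> G" "M \<lhd> G" "N \<subseteq> M" "a \<in> carrier G"
  shows "natural_quotient G M (N #>\<^bsub>G\<^esub> a) = M #>\<^bsub>G\<^esub> a"
proof -
  interpret group G by fact
  have N: "subgroup N G" and M: "subgroup M G"
    using assms normal_imp_subgroup by auto
  have "M #>\<^bsub>G\<^esub> b = M #>\<^bsub>G\<^esub> a" if "b \<in> N #>\<^bsub>G\<^esub> a" for b
  proof -
    have "b \<in> M #>\<^bsub>G\<^esub> a"
      using that \<open>N \<subseteq> M\<close> unfolding r_coset_def by blast
    then show ?thesis
      by (rule repr_independence[OF _ \<open>a \<in> carrier G\<close> M, symmetric])
  qed
  then have "natural_quotient G M (N #>\<^bsub>G\<^esub> a) = (\<Union>b\<in>N #>\<^bsub>G\<^esub> a. M #>\<^bsub>G\<^esub> a)"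
    unfolding natural_quotient_def by (rule SUP_cong[OF refl])
  also have "\<dots> = M #>\<^bsub>G\<^esub> a"
    using rcos_self[OF assms(5) N] by blast
  finally show ?thesis .
qed

lemma natural_quotient_hom:
  assumes "group G" "N \<lhd> G" "M \<lhd> G" "N \<subseteq> M"
  shows "natural_quotient G M \<in> hom (G Mod N) (G Mod M)"
proof -
  interpret group G by fact
  have N: "(\<lambda>a. N #>\<^bsub>G\<^esub> a) \<in> hom G (G Mod N)" and M: "(\<lambda>a. M #>\<^bsub>G\<^esub> a) \<in> hom G (G Mod M)"
    using assms normal.r_coset_hom_Mod by blast+
  show ?thesis
  proof (rule homI)
    fix A assume "A \<in> carrier (G Mod N)"
    then obtain a where a: "a \<in> carrier G" "A = N #>\<^bsub>G\<^esub> a"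
      by (auto simp: carrier_FactGroup)
    then show "natural_quotient G M A \<in> carrier (G Mod M)"
      using assms by (simp add: natural_quotient_rcoset carrier_FactGroup)
    fix B assume "B \<in> carrier (G Mod N)"
    then obtain b where b: "b \<in> carrier G" "B = N #>\<^bsub>G\<^esub> b"
      by (auto simp: carrier_FactGroup)
    have "natural_quotient G M (N #>\<^bsub>G\<^esub> (a \<otimes>\<^bsub>G\<^esub> b)) = M #>\<^bsub>G\<^esub> (a \<otimes>\<^bsub>G\<^esub> b)"
      using assms a b by (simp add: natural_quotient_rcoset)
    then show "natural_quotient G M (A \<otimes>\<^bsub>G Mod N\<^esub> B) = natural_quotient G M A \<otimes>\<^bsub>G Mod M\<^esub> natural_quotient G M B"
      using hom_mult[OF N a(1) b(1)] hom_mult[OF M a(1) b(1)] a b assms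
      by (simp add: natural_quotient_rcoset del: mult_FactGroup)
  qed
qed

lemma fundamental_group_map_id:
  assumes h: "continuous_map S T id" and p: "pathin S p"
  shows "fundamental_group_map T id (path_class S p) = path_class T p" "pathin T p"
proof -
  have "path_class T q = path_class T p" if "q \<in> path_class S p" for q
  proof -
    have "homotopic_pathsin T (id \<circ> p) (id \<circ> q)"
      using that unfolding path_class_def homotopic_pathsin_def mem_Collect_eq
      by (rule homotopic_with_compose_continuous_map_left[OF _ h]) simp
    then show ?thesis
      using path_class_eq[of T p q] by simp
  qed
  then show "fundamental_group_map T id (path_class S p) = path_class T p"
    unfolding fundamental_group_map_def id_comp using path_class_self[OF p] by blast
  show "pathin T p"
    using pathin_compose[OF p h] by simp
qed

lemma continuous_map_realization_mono:
  assumes "K \<subseteq> L"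
  shows "continuous_map (realization K) (realization L) id"
  unfolding continuous_map_def
proof (intro conjI allI impI)
  show "id \<in> topspace (realization K) \<rightarrow> topspace (realization L)"
    using assms by (auto simp: topspace_realization)
  fix U assume "openin (realization L) U"
  then have "openin (top_of_set (closed_face \<sigma>)) (U \<inter> closed_face \<sigma>)" if "\<sigma> \<in> K" for \<sigma>
    using that assms by (auto simp: openin_realization)
  moreover have "{z \<in> topspace (realization K). id z \<in> U} \<inter> closed_face \<sigma> = U \<inter> closed_face \<sigma>" if "\<sigma> \<in> K" for \<sigma>
    using that by (auto simp: topspace_realization)
  ultimately show "openin (realization K) {z \<in> topspace (realization K). id z \<in> U}"
    unfolding openin_realization by (auto simp: topspace_realization)
qed

lemma rips_mono: "p \<le> q \<Longrightarrow> rips X p \<subseteq> rips X q"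
  by (auto simp: rips_def)

context geodesic begin

lemma D_mono:
  assumes "\<rho> \<le> \<rho>'"
  shows "D \<rho> \<subseteq> D \<rho>'"
proof -
  have "conj_small_loops \<rho> \<subseteq> conj_small_loops \<rho>'"
    using assms unfolding conj_small_loops_def by fastforce
  then show ?thesis
    unfolding D_eq by (rule X.mono_generate)
qed

text \<open>One loop is read at both scales. Along it the stars of the two complexes coincide, being
  given by the same nonvanishing coordinate, and the cocycle at scale \<open>q\<close> is the image
  of that at scale \<open>p\<close> because both use the same geodesics.\<close>

lemma \<Psi>_natural:
  assumes "0 < p" "p < q" and u: "u \<in> carrier (fundamental_group (realization (rips X p)) (vertex_point x0))"
  shows "rips_scale.\<Psi> X x0 q (fundamental_group_map (realization (rips X q)) id u) =
    natural_quotient X.\<pi> (D (3 * q / 2)) (rips_scale.\<Psi> X x0 p u)"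
proof -
  interpret P: rips_scale X x0 p
    by unfold_locales (rule assms)
  interpret Q: rips_scale X x0 q
    by unfold_locales (use assms in simp)
  let ?nat = "natural_quotient X.\<pi> (D (3 * q / 2))"
  have D: "D (3 * p / 2) \<subseteq> D (3 * q / 2)"
    using assms by (intro D_mono) simp
  have nat: "?nat \<in> hom P.Q Q.Q"
    by (rule natural_quotient_hom[OF X.group_axioms D_normal D_normal D])
  obtain c where c: "pathin P.RK c" "c 0 = vertex_point x0" "c 1 = vertex_point x0" "u = path_class P.RK c"
    using P.K.carrier_loop_class[OF u] by blast
  have m: "continuous_map P.RK Q.RK id"
    using assms by (intro continuous_map_realization_mono rips_mono) simp
  note c' = fundamental_group_map_id[OF m c(1)]
  have star: "c t \<in> open_star P.K v \<longleftrightarrow> c t \<in> open_star Q.K v" if "t \<in> {0..1}" for t v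
    using pathin_in_topspace[OF c(1)] pathin_in_topspace[OF c'(2)] that by (auto simp: open_star_def)
  have "Q.\<Psi> (fundamental_group_map Q.RK id u) = holonomy Q.Q (open_star Q.K) Q.G c x0 x0"
    using c c' Q.KQ.holonomy_map by simp
  also have "\<dots> = holonomy Q.Q (open_star P.K) Q.G c x0 x0"
    by (rule holonomy_chart_cong) (use star in blast)
  also have "\<dots> = holonomy Q.Q (open_star P.K) (\<lambda>u v. ?nat (P.G u v)) c x0 x0"
  proof (rule holonomy_cong)
    fix z u v assume "z \<in> open_star P.K u" "z \<in> open_star P.K v"
    then have "P.near u v"
      by (rule P.open_star_near)
    then have "X.loop_class (geo u v) \<in> carrier X.\<pi>"
      by (auto simp: P.near_def intro!: X.loop_class_carrier geo)
    then show "Q.G u v = ?nat (P.G u v)"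
      unfolding Q.G_def P.G_def Q.q_def P.q_def
      by (rule natural_quotient_rcoset[symmetric, OF X.group_axioms D_normal D_normal D])
  qed
  also have "\<dots> = ?nat (holonomy P.Q (open_star P.K) P.G c x0 x0)"
    by (rule P.KQ.holonomy_hom) (use c nat x0 Q.q.H.group_axioms in auto)
  also have "holonomy P.Q (open_star P.K) P.G c x0 x0 = P.\<Psi> u"
    using c P.KQ.holonomy_map by simp
  finally show ?thesis .
qed

end

section \<open>Singular chains with coefficients\<close>

declare One_nat_def [simp del]

lemma atMost_1: "{..1::nat} = {0, 1}"
  by auto

lemma gchain_set_zero [simp]: "0 \<in> gchain_set p T"
  by (simp add: gchain_set_def)

lemma gchain_set_add: "c \<in> gchain_set p T \<Longrightarrow> d \<in> gchain_set p T \<Longrightarrow> c + d \<in> gchain_set p T"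
  using keys_add[of c d] by (auto simp: gchain_set_def)

lemma gchain_set_uminus: "c \<in> gchain_set p T \<Longrightarrow> - c \<in> gchain_set p T"
  by (simp add: gchain_set_def subset_iff in_keys_iff)

lemma gchain_set_sum: "(\<And>i. i \<in> I \<Longrightarrow> c i \<in> gchain_set p T) \<Longrightarrow> sum c I \<in> gchain_set p T"
  by (induction I rule: infinite_finite_induct) (auto intro: gchain_set_add)

lemma gchain_set_single: "singular_simplex p T f \<Longrightarrow> Poly_Mapping.single f a \<in> gchain_set p T"
  by (simp add: gchain_set_def)

lemma poly_mapping_sum_single:
  "(\<Sum>f\<in>Poly_Mapping.keys c. Poly_Mapping.single f (Poly_Mapping.lookup c f)) = c"
proof -
  have "Poly_Mapping.lookup (\<Sum>f\<in>I. Poly_Mapping.single f (Poly_Mapping.lookup c f)) g =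
      (if g \<in> I then Poly_Mapping.lookup c g else 0)" if "finite I" for I g
    using that by (induction I rule: finite_induct) (auto simp: lookup_add lookup_single when_def)
  then show ?thesis
    by (intro poly_mapping_eqI) (auto simp: in_keys_iff)
qed

lemma gchain_induct [consumes 1, case_names zero single add]:
  assumes c: "c \<in> gchain_set p T" and "P 0"
    and single: "\<And>f a. singular_simplex p T f \<Longrightarrow> P (Poly_Mapping.single f a)"
    and add: "\<And>c d. c \<in> gchain_set p T \<Longrightarrow> d \<in> gchain_set p T \<Longrightarrow> P c \<Longrightarrow> P d \<Longrightarrow> P (c + d)"
  shows "P c"
proof -
  have "P (\<Sum>f\<in>I. Poly_Mapping.single f (Poly_Mapping.lookup c f))" if "finite I" "I \<subseteq> Poly_Mapping.keys c" for I
    using that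
  proof (induction I rule: finite_induct)
    case (insert f I)
    have s: "singular_simplex p T f" if "f \<in> Poly_Mapping.keys c" for f
      using that c by (auto simp: gchain_set_def)
    have "P (Poly_Mapping.single f (Poly_Mapping.lookup c f) + (\<Sum>f\<in>I. Poly_Mapping.single f (Poly_Mapping.lookup c f)))"
      using insert s by (intro add single gchain_set_single gchain_set_sum) auto
    then show ?case
      using insert by simp
  qed (simp add: \<open>P 0\<close>)
  from this[of "Poly_Mapping.keys c"] show ?thesis
    by (simp add: poly_mapping_sum_single)
qed

section \<open>The boundary operator and its values in degrees one and two\<close>

lemma gchain_boundary_zero [simp]: "gchain_boundary p 0 = 0"
  by (simp add: gchain_boundary_def)

lemma gchain_boundary_add:
  fixes c d :: "('a, 'g::ab_group_add) gchain"
  shows "gchain_boundary p (c + d) = gchain_boundary p c + gchain_boundary p d"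
proof -
  let ?F = "\<lambda>(f :: (nat \<Rightarrow> real) \<Rightarrow> 'a) (a :: 'g). \<Sum>k\<le>p. Poly_Mapping.single (singular_face p k f) (if even k then a else - a)"
  have "?F f (a + b) = ?F f a + ?F f b" for f a b
    by (subst sum.distrib[symmetric]) (rule sum.cong[OF refl], simp add: single_add[symmetric] algebra_simps)
  moreover have "?F f 0 = 0" for f
    by (simp cong: if_cong)
  ultimately have "(\<Sum>f\<in>Poly_Mapping.keys (c + d). ?F f (Poly_Mapping.lookup (c + d) f)) =
     (\<Sum>f\<in>Poly_Mapping.keys c. ?F f (Poly_Mapping.lookup c f)) + (\<Sum>f\<in>Poly_Mapping.keys d. ?F f (Poly_Mapping.lookup d f))"
    by (intro setsum_keys_plus_distrib)
  then show ?thesis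
    unfolding gchain_boundary_def by (cases "p = 0") simp_all
qed

lemma gchain_boundary_uminus: "gchain_boundary p (- c) = - gchain_boundary p c"
  using gchain_boundary_add[of p c "- c"] by (simp add: eq_neg_iff_add_eq_0 add.commute)

lemma gchain_boundary_diff: "gchain_boundary p (c - d) = gchain_boundary p c - gchain_boundary p d"
  using gchain_boundary_add[of p c "- d"] by (simp add: gchain_boundary_uminus)

lemma gchain_boundary_single:
  assumes "p > 0"
  shows "gchain_boundary p (Poly_Mapping.single f a) =
    (\<Sum>k\<le>p. Poly_Mapping.single (singular_face p k f) (if even k then a else - a))"
proof (cases "a = 0")
  case True
  then show ?thesis
    by (auto intro!: sum.neutral)
next
  case False
  then have keys: "Poly_Mapping.keys (Poly_Mapping.single f a) = {f}"
    by simp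
  show ?thesis
    using assms unfolding gchain_boundary_def keys by (simp add: if_distrib cong: if_cong)
qed

lemma gchain_boundary_in:
  assumes "c \<in> gchain_set (Suc p) T"
  shows "gchain_boundary (Suc p) c \<in> gchain_set p T"
  using assms
proof (induction rule: gchain_induct)
  case (single f a)
  then show ?case
    using singular_simplex_singular_face[OF single(1)] unfolding gchain_boundary_single[OF zero_less_Suc]
    by (intro gchain_set_sum gchain_set_single) simp
qed (auto simp: gchain_boundary_add intro: gchain_set_add)

definition corner :: "nat \<Rightarrow> nat \<Rightarrow> real" where
  "corner i = (\<lambda>j. if j = i then 1 else 0)"

definition point_simplex :: "'a \<Rightarrow> (nat \<Rightarrow> real) \<Rightarrow> 'a" where
  "point_simplex y = restrict (\<lambda>_. y) (standard_simplex 0)"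

lemma corner_in [simp]: "corner i \<in> standard_simplex p \<longleftrightarrow> i \<le> p"
  by (simp add: corner_def)

lemma standard_simplex_0_corner: "standard_simplex 0 = {corner 0}"
  by (simp add: standard_simplex_0 corner_def)

lemma simplical_face_corner:
  "simplical_face 0 (corner 0) = corner 1" "simplical_face 0 (corner 1) = corner 2"
  "simplical_face 1 (corner 0) = corner 0" "simplical_face 1 (corner 1) = corner 2"
  "simplical_face 2 (corner 0) = corner 0" "simplical_face 2 (corner 1) = corner 1"
  by (auto simp: simplical_face_def corner_def fun_eq_iff)

lemma singular_face_1:
  "singular_face 1 0 f = point_simplex (f (corner 1))" "singular_face 1 1 f = point_simplex (f (corner 0))"
proof -
  have "singular_face 1 k f = point_simplex (f (simplical_face k (corner 0)))" for k
  proof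
    fix u show "singular_face 1 k f u = point_simplex (f (simplical_face k (corner 0))) u"
      by (cases "u = corner 0") (simp_all add: singular_face_def point_simplex_def standard_simplex_0_corner One_nat_def)
  qed
  then show "singular_face 1 0 f = point_simplex (f (corner 1))" "singular_face 1 1 f = point_simplex (f (corner 0))"
    by (simp_all add: simplical_face_corner)
qed

lemma gchain_boundary_1:
  "gchain_boundary 1 (Poly_Mapping.single f a) =
    Poly_Mapping.single (point_simplex (f (corner 1))) a - Poly_Mapping.single (point_simplex (f (corner 0))) a"
  using singular_face_1[of f] by (simp add: gchain_boundary_single single_uminus atMost_1)

lemma gchain_boundary_2:
  "gchain_boundary 2 (Poly_Mapping.single f a) =
    Poly_Mapping.single (singular_face 2 0 f) a - Poly_Mapping.single (singular_face 2 1 f) a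
    + Poly_Mapping.single (singular_face 2 2 f) a"
proof -
  have "{..2::nat} = {0, 1, 2}"
    by auto
  then show ?thesis
    by (simp add: gchain_boundary_single single_uminus algebra_simps)
qed

text \<open>Each vertex of the triangle belongs to two of its edges, and the two contributions have
  opposite signs.\<close>

lemma gchain_boundary_boundary_2: "gchain_boundary 1 (gchain_boundary 2 (Poly_Mapping.single f a)) = 0"
proof -
  have "singular_face 2 k f (corner i) = f (simplical_face k (corner i))" if "i \<le> 1" for k i
    using that by (simp add: singular_face_def)
  then show ?thesis
    unfolding gchain_boundary_2 gchain_boundary_add gchain_boundary_diff gchain_boundary_1
    by (simp add: simplical_face_corner[simplified])
qed

section \<open>First homology with coefficients\<close>

lemma gboundary_set_1: "gboundary_set 1 T = gchain_boundary 2 ` gchain_set 2 T"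
  by (simp add: gboundary_set_def numeral_2_eq_2)

lemma gchain_boundary_in_1: "c \<in> gchain_set 2 T \<Longrightarrow> gchain_boundary 2 c \<in> gchain_set 1 T"
  using gchain_boundary_in[of c 1 T] by (simp add: numeral_2_eq_2)

lemma gboundary_set_zero [simp]: "0 \<in> gboundary_set 1 T"
  unfolding gboundary_set_1 by (rule image_eqI[of _ _ 0]) auto

lemma gboundary_set_add: "c \<in> gboundary_set 1 T \<Longrightarrow> d \<in> gboundary_set 1 T \<Longrightarrow> c + d \<in> gboundary_set 1 T"
  unfolding gboundary_set_1 by (auto simp flip: gchain_boundary_add intro!: imageI gchain_set_add)

lemma gboundary_set_uminus: "c \<in> gboundary_set 1 T \<Longrightarrow> - c \<in> gboundary_set 1 T"
  unfolding gboundary_set_1 by (auto simp flip: gchain_boundary_uminus intro!: imageI gchain_set_uminus)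

lemma gboundary_set_diff: "c \<in> gboundary_set 1 T \<Longrightarrow> d \<in> gboundary_set 1 T \<Longrightarrow> c - d \<in> gboundary_set 1 T"
  using gboundary_set_add[of c T "- d"] gboundary_set_uminus[of d T] by simp

lemma gcycle_carrier:
  "c \<in> carrier (gcycle_group p T) \<longleftrightarrow> c \<in> gchain_set p T \<and> gchain_boundary p c = 0"
  by (simp add: gcycle_group_def)

lemma gcycle_mult [simp]: "c \<otimes>\<^bsub>gcycle_group p T\<^esub> d = c + d"
  by (simp add: gcycle_group_def)

lemma gcycle_one [simp]: "\<one>\<^bsub>gcycle_group p T\<^esub> = 0"
  by (simp add: gcycle_group_def)

lemma comm_group_gcycle: "comm_group (gcycle_group p T :: ('a, 'g::ab_group_add) gchain monoid)"
proof (rule comm_groupI; (unfold gcycle_carrier gcycle_mult gcycle_one)?)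
  fix c :: "('a, 'g) gchain" assume "c \<in> gchain_set p T \<and> gchain_boundary p c = 0"
  then show "\<exists>y\<in>carrier (gcycle_group p T). y + c = 0"
    by (intro bexI[of _ "- c"]) (auto simp: gcycle_carrier gchain_set_uminus gchain_boundary_uminus)
qed (auto simp: gchain_set_add gchain_boundary_add add.assoc add.commute)

lemma gboundary_cycle: "c \<in> gboundary_set 1 T \<Longrightarrow> c \<in> carrier (gcycle_group 1 T)"
proof -
  assume "c \<in> gboundary_set 1 T"
  then obtain d where d: "d \<in> gchain_set 2 T" "c = gchain_boundary 2 d"
    by (auto simp: gboundary_set_1)
  have "gchain_boundary 1 (gchain_boundary 2 d) = 0"
    using d(1) by (induction rule: gchain_induct) (auto simp: gchain_boundary_boundary_2[simplified] gchain_boundary_add)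
  then show ?thesis
    using d gchain_boundary_in_1 by (auto simp: gcycle_carrier)
qed

lemma gcycle_inv: "c \<in> carrier (gcycle_group p T) \<Longrightarrow> inv\<^bsub>gcycle_group p T\<^esub> c = - c"
  by (rule group.inv_equality[OF comm_group.axioms(2)[OF comm_group_gcycle]])
     (auto simp: gcycle_carrier gchain_set_uminus gchain_boundary_uminus)

lemma subgroup_gboundary: "subgroup (gboundary_set 1 T) (gcycle_group 1 T)"
  by (rule subgroup.intro) (auto simp: gboundary_cycle gboundary_set_add gboundary_set_uminus gcycle_inv)

lemma comm_group_homology: "comm_group (homology_with_coeff TYPE('g::ab_group_add) 1 T)"
  unfolding homology_with_coeff_def
  by (rule comm_group.abelian_FactGroup[OF comm_group_gcycle subgroup_gboundary])

lemma gboundary_normal: "gboundary_set 1 T \<lhd> gcycle_group 1 T"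
  using comm_group.normal_iff_subgroup[OF comm_group_gcycle] subgroup_gboundary by blast

lemma homology_class_hom:
  "homology_class 1 T \<in> hom (gcycle_group 1 T) (homology_with_coeff TYPE('g::ab_group_add) 1 T)"
  using normal.r_coset_hom_Mod[OF gboundary_normal]
  unfolding homology_class_def homology_with_coeff_def .

lemma homology_carrier:
  "A \<in> carrier (homology_with_coeff TYPE('g::ab_group_add) 1 T) \<longleftrightarrow>
    (\<exists>c\<in>carrier (gcycle_group 1 T). A = homology_class 1 T c)"
  by (auto simp: homology_with_coeff_def carrier_FactGroup homology_class_def)

lemma homology_class_add:
  "c \<in> carrier (gcycle_group 1 T) \<Longrightarrow> d \<in> carrier (gcycle_group 1 T) \<Longrightarrow>
    homology_class 1 T (c + d) = homology_class 1 T c \<otimes>\<^bsub>homology_with_coeff TYPE('g::ab_group_add) 1 T\<^esub> homology_class 1 T d"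
  using hom_mult[OF homology_class_hom] by fastforce

lemma homology_class_alt: "homology_class 1 T c = (\<lambda>b. b + c) ` gboundary_set 1 T"
  by (auto simp: homology_class_def r_coset_def)

lemma homology_class_eq:
  assumes "c - d \<in> gboundary_set 1 T"
  shows "homology_class 1 T c = homology_class 1 T d"
proof -
  have *: "homology_class 1 T c \<subseteq> homology_class 1 T d" if "c - d \<in> gboundary_set 1 T" for c d
  proof
    fix x assume "x \<in> homology_class 1 T c"
    then obtain b where "b \<in> gboundary_set 1 T" "x = b + c"
      by (auto simp: homology_class_alt)
    then show "x \<in> homology_class 1 T d"
      using gboundary_set_add[OF _ that, of b] by (auto simp: homology_class_alt intro!: image_eqI[of _ _ "b + (c - d)"])
  qed
  show ?thesis
    using *[OF assms] *[of d c] gboundary_set_uminus[OF assms] by auto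
qed

section \<open>Paths as singular simplices\<close>

lemma powertop_real_euclidean: "powertop_real UNIV = (euclidean :: (nat \<Rightarrow> real) topology)"
  by (simp add: euclidean_product_topology)

lemma singular_simplex_alt:
  "singular_simplex p T f \<longleftrightarrow> continuous_map (top_of_set (standard_simplex p)) T f \<and> f \<in> extensional (standard_simplex p)"
  by (simp add: singular_simplex_def powertop_real_euclidean)

lemma singular_simplex_restrict:
  assumes "continuous_map (top_of_set (standard_simplex p)) T f"
  shows "singular_simplex p T (restrict f (standard_simplex p))"
  unfolding singular_simplex_alt using continuous_map_eq[OF assms, of "restrict f (standard_simplex p)"] by auto

lemma standard_simplex_1: "u \<in> standard_simplex 1 \<Longrightarrow> u = (\<lambda>i. if i = 0 then 1 - u 1 else if i = 1 then u 1 else 0) \<and> 0 \<le> u 1 \<and> u 1 \<le> 1"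
  by (auto simp: standard_simplex_def fun_eq_iff atMost_1)

text \<open>The inverse of \<open>path_simplex\<close>: the argument of \<open>f\<close> is the
  point of the 1-simplex whose second barycentric coordinate is \<open>t\<close>.\<close>

definition edge :: "((nat \<Rightarrow> real) \<Rightarrow> 'a) \<Rightarrow> real \<Rightarrow> 'a" where
  "edge f t = f (\<lambda>i. if i = 0 then 1 - t else if i = 1 then t else 0)"

lemma segment_in_simplex: "0 \<le> t \<Longrightarrow> t \<le> 1 \<Longrightarrow> (\<lambda>i. if i = 0 then 1 - t else if i = 1 then t else 0) \<in> standard_simplex 1"
  by (auto simp: standard_simplex_def atMost_1)

lemma edge_ends: "edge f 0 = f (corner 0)" "edge f 1 = f (corner 1)"
  by (auto simp: edge_def corner_def intro!: arg_cong[of _ _ f])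

lemma pathin_edge_simplex:
  assumes "singular_simplex 1 T f"
  shows "pathin T (edge f)"
proof -
  have "continuous_on {0..1} (\<lambda>t::real. \<lambda>i::nat. if i = 0 then 1 - t else if i = 1 then t else 0)"
  proof (rule continuous_on_coordinatewise_then_product)
    fix i :: nat show "continuous_on {0..1} (\<lambda>t::real. if i = 0 then 1 - t else if i = 1 then t else 0)"
      by (cases "i = 0"; cases "i = 1") (auto intro!: continuous_intros)
  qed
  then have "continuous_map (top_of_set {0..1}) (top_of_set (standard_simplex 1)) (\<lambda>t::real. \<lambda>i::nat. if i = 0 then 1 - t else if i = 1 then t else 0)"
    using segment_in_simplex by (auto simp: continuous_map_in_subtopology)
  from continuous_map_compose[OF this] show ?thesis
    using assms unfolding singular_simplex_alt pathin_def edge_def o_def by blast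
qed

lemma path_simplex_edge:
  assumes "singular_simplex 1 T f"
  shows "path_simplex (edge f) = f"
proof
  fix u
  show "path_simplex (edge f) u = f u"
  proof (cases "u \<in> standard_simplex 1")
    case True
    then have "(\<lambda>i. if i = 0 then 1 - u 1 else if i = 1 then u 1 else 0) = u"
      using standard_simplex_1[OF True] by metis
    then show ?thesis
      using True by (simp add: path_simplex_def edge_def)
  next
    case False
    then show ?thesis
      using assms by (simp add: path_simplex_def singular_simplex_def extensional_def)
  qed
qed

lemma edge_path_simplex: "0 \<le> t \<Longrightarrow> t \<le> 1 \<Longrightarrow> edge (path_simplex p) t = p t"
  using segment_in_simplex[of t] by (simp add: edge_def path_simplex_def)

lemma path_simplex_cong:
  "(\<And>t. 0 \<le> t \<Longrightarrow> t \<le> 1 \<Longrightarrow> p t = q t) \<Longrightarrow> path_simplex p = path_simplex q"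
  using standard_simplex_1 by (auto simp: path_simplex_def restrict_def fun_eq_iff)

lemma singular_simplex_path_simplex:
  assumes "pathin T p"
  shows "singular_simplex 1 T (path_simplex p)"
  unfolding path_simplex_def
proof (rule singular_simplex_restrict)
  have "continuous_map (top_of_set (standard_simplex 1)) (top_of_set {0..1}) (\<lambda>u. u 1)"
    using standard_simplex_1 continuous_on_subset[OF continuous_on_product_coordinates subset_UNIV]
    by (auto simp: continuous_map_in_subtopology)
  from continuous_map_compose[OF this] show "continuous_map (top_of_set (standard_simplex 1)) T (\<lambda>u. p (u 1))"
    using assms by (simp add: pathin_def o_def)
qed

definition path_chain :: "(real \<Rightarrow> 'a) \<Rightarrow> 'g \<Rightarrow> ('a, 'g::ab_group_add) gchain" where
  "path_chain p a = Poly_Mapping.single (path_simplex p) a"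

lemma path_chain_in: "pathin T p \<Longrightarrow> path_chain p a \<in> gchain_set 1 T"
  unfolding path_chain_def by (intro gchain_set_single singular_simplex_path_simplex)

lemma path_chain_boundary:
  "gchain_boundary 1 (path_chain p a) =
    Poly_Mapping.single (point_simplex (p 1)) a - Poly_Mapping.single (point_simplex (p 0)) a"
  unfolding path_chain_def gchain_boundary_1
  using edge_path_simplex[of 0 p] edge_path_simplex[of 1 p] by (simp add: edge_ends)

lemma path_chain_cycle: "pathin T p \<Longrightarrow> p 0 = p 1 \<Longrightarrow> path_chain p a \<in> carrier (gcycle_group 1 T)"
  unfolding gcycle_carrier path_chain_boundary by (simp add: path_chain_in)

lemma path_chain_add: "path_chain p (a + b) = path_chain p a + path_chain p b"
  by (simp add: path_chain_def single_add)

lemma path_chain_cong: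
  "(\<And>t. 0 \<le> t \<Longrightarrow> t \<le> 1 \<Longrightarrow> p t = q t) \<Longrightarrow> path_chain p a = path_chain q a"
  unfolding path_chain_def using path_simplex_cong by metis

lemma triangle_boundary:
  fixes S :: "'c::real_normed_vector set"
  assumes S: "convex S" and M: "continuous_map (top_of_set S) T M" and ABC: "A \<in> S" "B \<in> S" "C \<in> S"
  shows "path_chain (M \<circ> linepath B C) a - path_chain (M \<circ> linepath A C) a + path_chain (M \<circ> linepath A B) a
    \<in> gboundary_set 1 T"
proof -
  define h where "h u = u 0 *\<^sub>R A + u 1 *\<^sub>R B + u 2 *\<^sub>R C" for u :: "nat \<Rightarrow> real"
  define \<tau> where "\<tau> = restrict (M \<circ> h) (standard_simplex 2)"
  have sum2: "sum u {..2} = u 0 + u 1 + u 2" for u :: "nat \<Rightarrow> real"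
    by (simp add: numeral_2_eq_2 One_nat_def)
  have hS: "h u \<in> S" if "u \<in> standard_simplex 2" for u
  proof -
    have "h u \<in> convex hull {A, B, C}"
      unfolding convex_hull_3 h_def using that by (auto simp: standard_simplex_def sum2)
    then show ?thesis
      using hull_minimal[of "{A, B, C}" S convex] S ABC by auto
  qed
  have "continuous_on (standard_simplex 2) h"
    unfolding h_def
    by (intro continuous_intros continuous_on_subset[OF continuous_on_product_coordinates subset_UNIV])
  then have "continuous_map (top_of_set (standard_simplex 2)) (top_of_set S) h"
    using hS by (auto simp: continuous_map_in_subtopology)
  then have \<tau>: "singular_simplex 2 T \<tau>"
    unfolding \<tau>_def using M continuous_map_compose by (intro singular_simplex_restrict) blast
  have face: "singular_face 2 k \<tau> = path_simplex (M \<circ> linepath P Q)"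
    if k: "k \<le> 2" and h: "\<And>u. u \<in> standard_simplex 1 \<Longrightarrow> h (simplical_face k u) = u 0 *\<^sub>R P + u 1 *\<^sub>R Q" for k P Q
  proof
    fix u
    show "singular_face 2 k \<tau> u = path_simplex (M \<circ> linepath P Q) u"
    proof (cases "u \<in> standard_simplex 1")
      case True
      then have "simplical_face k u \<in> standard_simplex 2"
        using simplical_face_in_standard_simplex[of 2 k u] k by simp
      moreover have "u 0 = 1 - u 1"
        using standard_simplex_1[OF True] by metis
      ultimately show ?thesis
        using True h[OF True] by (simp add: singular_face_def path_simplex_def \<tau>_def linepath_def)
    qed (simp add: singular_face_def path_simplex_def)
  qed
  have "singular_face 2 0 \<tau> = path_simplex (M \<circ> linepath B C)" "singular_face 2 1 \<tau> = path_simplex (M \<circ> linepath A C)"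
    "singular_face 2 2 \<tau> = path_simplex (M \<circ> linepath A B)"
    by (rule face; simp add: h_def simplical_face_def One_nat_def)+
  then have "gchain_boundary 2 (Poly_Mapping.single \<tau> a) =
      path_chain (M \<circ> linepath B C) a - path_chain (M \<circ> linepath A C) a + path_chain (M \<circ> linepath A B) a"
    by (simp add: gchain_boundary_2 path_chain_def)
  then show ?thesis
    unfolding gboundary_set_1 using gchain_set_single[OF \<tau>] by (metis imageI)
qed

text \<open>A triangle collapsed to a point has three equal edges, which enter with signs plus,
  minus, plus.\<close>

lemma path_chain_const:
  assumes "y \<in> topspace T"
  shows "path_chain (\<lambda>_. y) a \<in> gboundary_set 1 T"
  using triangle_boundary[of "UNIV :: real set" T "\<lambda>_. y" 0 0 0 a] assms by (simp add: o_def)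

text \<open>This is the boundary of the flat triangle with vertices 0, 1/2, 1 in the interval,
  followed by the joined path.\<close>

lemma path_chain_join:
  assumes p: "pathin T p" "pathin T q" "p 1 = q 0"
  shows "path_chain (p +++ q) a - (path_chain p a + path_chain q a) \<in> gboundary_set 1 T"
proof -
  let ?m = "p +++ q"
  have "path_chain (?m \<circ> linepath (1/2) 1) a - path_chain (?m \<circ> linepath 0 1) a + path_chain (?m \<circ> linepath 0 (1/2)) a
    \<in> gboundary_set 1 T"
    using pathin_joinpaths[OF assms] unfolding pathin_def by (intro triangle_boundary) auto
  moreover have "path_chain (?m \<circ> linepath (1/2) 1) a = path_chain q a"
  proof (rule path_chain_cong)
    fix t :: real assume "0 \<le> t" "t \<le> 1"
    have "2 * linepath (1/2) (1::real) t - 1 = t" "linepath (1/2) (1::real) t \<le> 1/2 \<longleftrightarrow> t \<le> 0"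
      by (auto simp: linepath_def field_simps)
    then show "(?m \<circ> linepath (1/2) 1) t = q t"
      \<comment> \<open>At \<open>t = 0\<close> the joined path is still evaluated on its first
        half, hence the case distinction.\<close>
      using p(3) \<open>0 \<le> t\<close> by (cases "t = 0") (auto simp: joinpaths_def)
  qed
  moreover have "path_chain (?m \<circ> linepath 0 (1/2)) a = path_chain p a"
    by (rule path_chain_cong) (auto simp: joinpaths_def linepath_def)
  moreover have "?m \<circ> linepath 0 1 = ?m"
    by (auto simp: linepath_def)
  ultimately show ?thesis
    using gboundary_set_uminus by (fastforce simp: algebra_simps)
qed

text \<open>The square of the homotopy is cut along a diagonal, which cancels between the two
  triangles. The remaining sides are \<open>p\<close>, \<open>q\<close> and two constant paths, and
  the latter are boundaries.\<close>

lemma path_chain_homotopic: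
  assumes "homotopic_pathsin T p q"
  shows "path_chain p a - path_chain q a \<in> gboundary_set 1 T"
proof -
  obtain h where h: "continuous_map (prod_topology (top_of_set {0..1}) (top_of_set {0..1::real})) T h"
    "\<And>x. h (0::real, x) = p x" "\<And>x. h (1, x) = q x" "\<And>t. t \<in> {0..1} \<Longrightarrow> h (t, 0) = p 0 \<and> h (t, 1) = p 1"
    using assms unfolding homotopic_pathsin_def homotopic_with_def by blast
  have M: "continuous_map (top_of_set ({0..1} \<times> {0..1})) T h"
    using h(1) by (simp add: prod_topology_subtopology subtopology_subtopology Times_Int_Times)
  have conv: "convex ({0..1::real} \<times> {0..1::real})"
    by (intro convex_Times) auto
  note tri = triangle_boundary[OF conv M]
  have lp: "(h \<circ> linepath (0, 0) (0, 1)) = p" "(h \<circ> linepath (1, 0) (1, 1)) = q"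
    using h(2,3) by (auto simp: linepath_def fun_eq_iff)
  have c1: "path_chain (h \<circ> linepath (0, 1) (1, 1)) a = path_chain (\<lambda>_. p 1) a"
    by (rule path_chain_cong) (simp add: linepath_def h(4))
  have c0: "path_chain (h \<circ> linepath (0, 0) (1, 0)) a = path_chain (\<lambda>_. p 0) a"
    by (rule path_chain_cong) (simp add: linepath_def h(4))
  let ?d = "path_chain (h \<circ> linepath (0, 0) (1, 1)) a"
  have 1: "path_chain (\<lambda>_. p 1) a - ?d + path_chain p a \<in> gboundary_set 1 T"
    using tri[of "(0, 0)" "(0, 1)" "(1, 1)" a] by (simp add: lp c1)
  have 2: "path_chain q a - ?d + path_chain (\<lambda>_. p 0) a \<in> gboundary_set 1 T"
    using tri[of "(0, 0)" "(1, 0)" "(1, 1)" a] by (simp add: lp c0)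
  have 3: "path_chain (\<lambda>_. p 0) a \<in> gboundary_set 1 T" and 4: "path_chain (\<lambda>_. p 1) a \<in> gboundary_set 1 T"
    using path_chain_const[OF path_start_in_topspace[OF homotopic_pathsin_imp(1)[OF assms]]]
      path_chain_const[OF path_finish_in_topspace[OF homotopic_pathsin_imp(1)[OF assms]]] by auto
  from gboundary_set_diff[OF gboundary_set_add[OF gboundary_set_diff[OF 1 2] 3] 4]
  show ?thesis
    by (simp add: algebra_simps)
qed

section \<open>The Hurewicz map with coefficients\<close>

definition homologous :: "'a topology \<Rightarrow> ('a, 'g::ab_group_add) gchain \<Rightarrow> ('a, 'g) gchain \<Rightarrow> bool" where
  "homologous T c d \<longleftrightarrow> c - d \<in> gboundary_set 1 T"

lemma homologous_refl [simp]: "homologous T c c"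
  by (simp add: homologous_def)

lemma homologous_sym: "homologous T c d \<Longrightarrow> homologous T d c"
  unfolding homologous_def using gboundary_set_uminus by fastforce

lemma homologous_trans [trans]: "homologous T c d \<Longrightarrow> homologous T d e \<Longrightarrow> homologous T c e"
  unfolding homologous_def using gboundary_set_add[of "c - d" T "d - e"] by simp

lemma homologous_add:
  assumes "homologous T c d" "homologous T c' d'"
  shows "homologous T (c + c') (d + d')"
proof -
  have "(c - d) + (c' - d') \<in> gboundary_set 1 T"
    using assms unfolding homologous_def by (rule gboundary_set_add)
  then show ?thesis
    by (simp add: homologous_def algebra_simps)
qed

lemma homologous_uminus: "homologous T c d \<Longrightarrow> homologous T (- c) (- d)"
  unfolding homologous_def using gboundary_set_uminus[of "c - d" T] by (simp add: algebra_simps)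

lemma homologous_class: "homologous T c d \<Longrightarrow> homology_class 1 T c = homology_class 1 T d"
  unfolding homologous_def by (rule homology_class_eq)

lemma homologous_join:
  "pathin T p \<Longrightarrow> pathin T q \<Longrightarrow> p 1 = q 0 \<Longrightarrow> homologous T (path_chain (p +++ q) a) (path_chain p a + path_chain q a)"
  unfolding homologous_def by (rule path_chain_join)

lemma homologous_homotopic:
  "homotopic_pathsin T p q \<Longrightarrow> homologous T (path_chain p a) (path_chain q a)"
  unfolding homologous_def by (rule path_chain_homotopic)

lemma homologous_reverse:
  assumes p: "pathin T p"
  shows "homologous T (path_chain (reversepath p) a) (- path_chain p a)"
proof -
  have "homologous T (path_chain (reversepath p) a + path_chain p a) (path_chain (reversepath p +++ p) a)"
    by (rule homologous_sym, rule homologous_join) (use p pathin_reversepath in auto)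
  also have "homologous T \<dots> (path_chain (\<lambda>_. p 1) a)"
    by (rule homologous_homotopic[OF homotopic_pathsin_linv[OF p]])
  also have "homologous T \<dots> 0"
    unfolding homologous_def using path_chain_const[OF path_finish_in_topspace[OF p], of a] by simp
  finally show ?thesis
    by (simp add: homologous_def)
qed

text \<open>A singular triangle is read as a homotopy from two of its edges to the third. This turns
  boundaries in homology into relations in the fundamental group, the direction opposite to
  \<open>triangle_boundary\<close>.\<close>

lemma triangle_edges:
  assumes \<tau>: "singular_simplex 2 T \<tau>"
  shows "homotopic_pathsin T (edge (singular_face 2 2 \<tau>) +++ edge (singular_face 2 0 \<tau>)) (edge (singular_face 2 1 \<tau>))"
    and "singular_face 2 2 \<tau> (corner 1) = singular_face 2 0 \<tau> (corner 0)"
proof -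
  \<comment> \<open>\<open>b\<close> gives barycentric coordinates on the planar triangle: its
    corners (0,0), (1,0), (0,1) go to the vertices 0, 1, 2.\<close>
  define b :: "real \<times> real \<Rightarrow> nat \<Rightarrow> real" where
    "b z = (\<lambda>i. if i = 0 then 1 - fst z - snd z else if i = 1 then fst z else if i = 2 then snd z else 0)" for z
  define \<Delta> :: "(real \<times> real) set" where "\<Delta> = convex hull {(0, 0), (1, 0), (0, 1)}"
  have sum2: "sum u {..2} = u 0 + u 1 + u 2" for u :: "nat \<Rightarrow> real"
    by (simp add: numeral_2_eq_2 One_nat_def)
  have b: "b z \<in> standard_simplex 2" if "z \<in> \<Delta>" for z
  proof -
    have "0 \<le> fst z \<and> 0 \<le> snd z \<and> fst z + snd z \<le> 1"
      using that unfolding \<Delta>_def convex_hull_3 by auto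
    then show ?thesis
      by (auto simp: b_def standard_simplex_def sum2)
  qed
  have "continuous_on \<Delta> b"
    unfolding b_def
  proof (rule continuous_on_coordinatewise_then_product)
    fix i :: nat
    show "continuous_on \<Delta> (\<lambda>z. if i = 0 then 1 - fst z - snd z else if i = 1 then fst z else if i = 2 then snd z else 0)"
      by (cases "i = 0"; cases "i = 1"; cases "i = 2") (auto intro!: continuous_intros)
  qed
  then have "continuous_map (top_of_set \<Delta>) (top_of_set (standard_simplex 2)) b"
    using b by (auto simp: continuous_map_in_subtopology)
  then have M: "continuous_map (top_of_set \<Delta>) T (\<tau> \<circ> b)"
    using \<tau> unfolding singular_simplex_alt by (blast intro: continuous_map_compose)
  have vertices: "(0, 0) \<in> \<Delta>" "(1, 0) \<in> \<Delta>" "(0, 1) \<in> \<Delta>"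
    unfolding \<Delta>_def by (auto intro: hull_inc)
  have conv: "convex \<Delta>"
    by (simp add: \<Delta>_def convex_convex_hull)
  have seg: "path_image (linepath P Q) \<subseteq> \<Delta>" if "P \<in> \<Delta>" "Q \<in> \<Delta>" for P Q
    using that conv by (simp add: closed_segment_subset)
  let ?f = "linepath (0, 0) (1, 0) +++ linepath (1, 0) (0, 1) :: real \<Rightarrow> real \<times> real"
  have "path_image ?f \<subseteq> \<Delta>"
    by (intro subset_path_image_join seg vertices)
  then have hom: "homotopic_pathsin T ((\<tau> \<circ> b) \<circ> ?f) ((\<tau> \<circ> b) \<circ> linepath (0, 0) (0, 1))"
    by (intro homotopic_pathsin_convex[OF conv M]) (use seg vertices in \<open>auto intro!: path_join_imp\<close>)
  have face: "edge (singular_face 2 k \<tau>) t = (\<tau> \<circ> b \<circ> linepath P Q) t"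
    if "simplical_face k (\<lambda>i. if i = 0 then 1 - t else if i = 1 then t else 0) = b (linepath P Q t)" "0 \<le> t" "t \<le> 1" for k t P Q
    using that segment_in_simplex[of t] by (simp add: edge_def singular_face_def)
  have faces: "simplical_face 0 (\<lambda>i. if i = 0 then 1 - t else if i = 1 then t else 0) = b (1 - t, t)"
    "simplical_face 1 (\<lambda>i. if i = 0 then 1 - t else if i = 1 then t else 0) = b (0, t)"
    "simplical_face 2 (\<lambda>i. if i = 0 then 1 - t else if i = 1 then t else 0) = b (t, 0)" for t
  proof -
    have "simplical_face 0 (\<lambda>i. if i = 0 then 1 - t else if i = 1 then t else 0) i = b (1 - t, t) i \<and>
      simplical_face 1 (\<lambda>i. if i = 0 then 1 - t else if i = 1 then t else 0) i = b (0, t) i \<and>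
      simplical_face 2 (\<lambda>i. if i = 0 then 1 - t else if i = 1 then t else 0) i = b (t, 0) i" for i
    proof -
      consider "i = 0" | "i = 1" | "i = 2" | "i > 2"
        by linarith
      then show ?thesis
        by cases (auto simp: simplical_face_def b_def)
    qed
    then show "simplical_face 0 (\<lambda>i. if i = 0 then 1 - t else if i = 1 then t else 0) = b (1 - t, t)"
      "simplical_face 1 (\<lambda>i. if i = 0 then 1 - t else if i = 1 then t else 0) = b (0, t)"
      "simplical_face 2 (\<lambda>i. if i = 0 then 1 - t else if i = 1 then t else 0) = b (t, 0)"
      by blast+
  qed
  have 0: "edge (singular_face 2 0 \<tau>) t = (\<tau> \<circ> b \<circ> linepath (1, 0) (0, 1)) t"
    and 1: "edge (singular_face 2 1 \<tau>) t = (\<tau> \<circ> b \<circ> linepath (0, 0) (0, 1)) t"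
    and 2: "edge (singular_face 2 2 \<tau>) t = (\<tau> \<circ> b \<circ> linepath (0, 0) (1, 0)) t" if "0 \<le> t" "t \<le> 1" for t
    by (rule face; use that faces in \<open>simp add: linepath_def\<close>)+
  have pathin: "pathin T (\<tau> \<circ> b \<circ> linepath P Q)" if "P \<in> \<Delta>" "Q \<in> \<Delta>" for P Q
    by (rule pathin_compose_path[OF M]) (use seg that in auto)
  have "homotopic_pathsin T (edge (singular_face 2 2 \<tau>) +++ edge (singular_face 2 0 \<tau>))
      ((\<tau> \<circ> b \<circ> linepath (0, 0) (1, 0)) +++ (\<tau> \<circ> b \<circ> linepath (1, 0) (0, 1)))"
    using 0 2 pathin vertices
    by (intro homotopic_pathsin_join homotopic_pathsin_sym[OF homotopic_pathsin_eq]) auto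
  also have "(\<tau> \<circ> b \<circ> linepath (0, 0) (1, 0)) +++ (\<tau> \<circ> b \<circ> linepath (1, 0) (0, 1)) = (\<tau> \<circ> b) \<circ> ?f"
    by (simp add: path_compose_join)
  also note hom
  also have "homotopic_pathsin T ((\<tau> \<circ> b) \<circ> linepath (0, 0) (0, 1)) (edge (singular_face 2 1 \<tau>))"
    using 1 pathin vertices by (intro homotopic_pathsin_eq) auto
  finally show "homotopic_pathsin T (edge (singular_face 2 2 \<tau>) +++ edge (singular_face 2 0 \<tau>)) (edge (singular_face 2 1 \<tau>))" .
  show "singular_face 2 2 \<tau> (corner 1) = singular_face 2 0 \<tau> (corner 0)"
    using 0[of 0] 2[of 1] by (simp add: edge_ends)
qed

context based_space begin

lemma closed_up_homologous:
  assumes p: "pathin T p"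
  shows "homologous T (path_chain (closed_up p) a) (path_chain (\<gamma> (p 0)) a + (path_chain p a - path_chain (\<gamma> (p 1)) a))"
proof -
  have 0: "pathin T (\<gamma> (p 0))" "\<gamma> (p 0) 1 = p 0" and 1: "pathin T (\<gamma> (p 1))" "\<gamma> (p 1) 1 = p 1"
    using tether path_start_in_topspace[OF p] path_finish_in_topspace[OF p] by auto
  have "homologous T (path_chain (closed_up p) a) (path_chain (\<gamma> (p 0)) a + path_chain (p +++ reversepath (\<gamma> (p 1))) a)"
    unfolding closed_up_def using 0 1 p by (intro homologous_join) (auto intro!: pathin_joinpaths pathin_reversepath)
  also have "homologous T \<dots> (path_chain (\<gamma> (p 0)) a + (path_chain p a + path_chain (reversepath (\<gamma> (p 1))) a))"
    using 1 p by (intro homologous_add homologous_refl homologous_join) (auto intro!: pathin_reversepath)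
  also have "homologous T \<dots> (path_chain (\<gamma> (p 0)) a + (path_chain p a + - path_chain (\<gamma> (p 1)) a))"
    by (intro homologous_add homologous_refl homologous_reverse 1)
  finally show ?thesis
    by simp
qed

text \<open>Plays the role of the elementary tensor of \<open>u\<close> and
  \<open>a\<close>.\<close>

definition hurewicz :: "(real \<Rightarrow> 'a) set \<Rightarrow> 'g \<Rightarrow> ('a, 'g::ab_group_add) gchain set" where
  "hurewicz u a = homology_class 1 T (path_chain (SOME p. p \<in> u) a)"

lemma hurewicz_path_class:
  assumes "pathin T p"
  shows "hurewicz (path_class T p) a = homology_class 1 T (path_chain p a)"
proof -
  have "(SOME q. q \<in> path_class T p) \<in> path_class T p"
    by (rule someI[of _ p]) (rule path_class_self[OF assms])
  then have "homotopic_pathsin T p (SOME q. q \<in> path_class T p)"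
    by (simp add: path_class_def)
  then show ?thesis
    unfolding hurewicz_def by (rule homologous_class[OF homologous_homotopic[OF homotopic_pathsin_sym]])
qed

lemma hurewicz_loop_class:
  "pathin T p \<Longrightarrow> hurewicz (loop_class p) a = homology_class 1 T (path_chain (closed_up p) a)"
  unfolding loop_class_def by (intro hurewicz_path_class closed_up)

text \<open>Both ends of a closed path have the same tether, which enters with opposite signs. Hence
  free loops, such as the small loops that generate \<open>small_loops_H1\<close>, are Hurewicz
  classes too.\<close>

lemma hurewicz_free_loop:
  assumes "pathin T p" "p 0 = p 1"
  shows "hurewicz (loop_class p) a = homology_class 1 T (path_chain p a)"
  unfolding hurewicz_loop_class[OF assms(1)]
  by (rule homologous_class) (use closed_up_homologous[OF assms(1), of a] assms(2) in simp)

lemma hurewicz_closed: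
  "u \<in> carrier \<pi> \<Longrightarrow> hurewicz u a \<in> carrier (homology_with_coeff TYPE('g::ab_group_add) 1 T)"
  unfolding homology_carrier fundamental_group_carrier
  by (metis hurewicz_path_class path_chain_cycle)

lemma hurewicz_mult:
  assumes "u \<in> carrier \<pi>" "v \<in> carrier \<pi>"
  shows "hurewicz (u \<otimes>\<^bsub>\<pi>\<^esub> v) a =
    hurewicz u a \<otimes>\<^bsub>homology_with_coeff TYPE('g::ab_group_add) 1 T\<^esub> hurewicz v a"
proof -
  obtain p q where p: "u = path_class T p" "pathin T p" "p 0 = x0" "p 1 = x0"
    and q: "v = path_class T q" "pathin T q" "q 0 = x0" "q 1 = x0"
    using assms unfolding fundamental_group_carrier by blast
  have "hurewicz (u \<otimes>\<^bsub>\<pi>\<^esub> v) a = homology_class 1 T (path_chain (p +++ q) a)"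
    using p q by (simp add: fundamental_group_mult hurewicz_path_class pathin_joinpaths)
  also have "\<dots> = homology_class 1 T (path_chain p a + path_chain q a)"
    using p q by (intro homologous_class homologous_join) auto
  also have "\<dots> = homology_class 1 T (path_chain p a) \<otimes>\<^bsub>homology_with_coeff TYPE('g) 1 T\<^esub> homology_class 1 T (path_chain q a)"
    using p q by (intro homology_class_add path_chain_cycle) auto
  finally show ?thesis
    using p q by (simp add: hurewicz_path_class)
qed

lemma hurewicz_add:
  assumes "u \<in> carrier \<pi>"
  shows "hurewicz u (a + b) = hurewicz u a \<otimes>\<^bsub>homology_with_coeff TYPE('g::ab_group_add) 1 T\<^esub> hurewicz u b"
proof -
  obtain p where p: "u = path_class T p" "pathin T p" "p 0 = x0" "p 1 = x0"
    using assms unfolding fundamental_group_carrier by blast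
  then show ?thesis
    by (simp add: hurewicz_path_class path_chain_add homology_class_add path_chain_cycle)
qed

section \<open>Cycles as sums of based loops\<close>

definition loop_chain :: "('a, 'g::ab_group_add) gchain \<Rightarrow> ('a, 'g) gchain" where
  "loop_chain c = (\<Sum>f\<in>Poly_Mapping.keys c. path_chain (closed_up (edge f)) (Poly_Mapping.lookup c f))"

text \<open>Meant for 0-chains, whose simplices are determined by their value at
  \<open>corner 0\<close>: each point is replaced by its tether, as in a cone operator.\<close>

definition tether_chain :: "('a, 'g::ab_group_add) gchain \<Rightarrow> ('a, 'g) gchain" where
  "tether_chain c = (\<Sum>f\<in>Poly_Mapping.keys c. path_chain (\<gamma> (f (corner 0))) (Poly_Mapping.lookup c f))"

lemma path_chain_zero [simp]: "path_chain p 0 = 0"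
  by (simp add: path_chain_def)

lemma loop_chain_add: "loop_chain (c + d) = loop_chain c + loop_chain d"
  unfolding loop_chain_def by (rule setsum_keys_plus_distrib) (simp_all add: path_chain_add)

lemma tether_chain_add: "tether_chain (c + d) = tether_chain c + tether_chain d"
  unfolding tether_chain_def by (rule setsum_keys_plus_distrib) (simp_all add: path_chain_add)

lemma loop_chain_single: "loop_chain (Poly_Mapping.single f a) = path_chain (closed_up (edge f)) a"
  by (simp add: loop_chain_def)

lemma tether_chain_single: "tether_chain (Poly_Mapping.single f a) = path_chain (\<gamma> (f (corner 0))) a"
  by (simp add: tether_chain_def)

lemma tether_chain_diff: "tether_chain (c - d) = tether_chain c - tether_chain d"
  using tether_chain_add[of "c - d" d] by simp

lemma loop_chain_zero [simp]: "loop_chain 0 = 0"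
  by (simp add: loop_chain_def)

lemma tether_chain_zero [simp]: "tether_chain 0 = 0"
  by (simp add: tether_chain_def)

text \<open>Closing up an edge adds the tether of its start and subtracts that of its end. The
  correction depends only on the boundary and vanishes for a cycle, which is thus homologous to a
  sum of based loops.\<close>

lemma loop_chain_homologous:
  "c \<in> gchain_set 1 T \<Longrightarrow> homologous T (loop_chain c) (c - tether_chain (gchain_boundary 1 c))"
proof (induction rule: gchain_induct)
  case (single f a)
  let ?p = "edge f"
  have p: "pathin T ?p"
    by (rule pathin_edge_simplex[OF single])
  have c: "Poly_Mapping.single f a = path_chain ?p a"
    by (simp add: path_chain_def path_simplex_edge[OF single])
  have "tether_chain (gchain_boundary 1 (path_chain ?p a)) = path_chain (\<gamma> (?p 1)) a - path_chain (\<gamma> (?p 0)) a"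
    by (simp add: path_chain_boundary tether_chain_diff tether_chain_single point_simplex_def)
  then have "Poly_Mapping.single f a - tether_chain (gchain_boundary 1 (Poly_Mapping.single f a)) =
      path_chain (\<gamma> (?p 0)) a + (path_chain ?p a - path_chain (\<gamma> (?p 1)) a)"
    unfolding c by simp
  then show ?case
    using closed_up_homologous[OF p, of a] by (simp only: loop_chain_single)
next
  case (add c d)
  then show ?case
    using homologous_add[OF add.IH] by (simp add: loop_chain_add gchain_boundary_add tether_chain_add algebra_simps)
qed simp

text \<open>The classes \<open>hurewicz u a\<close> generate the homology group, since a cycle may
  be replaced by its loop chain. The induction runs over all 1-chains: the terms of a cycle are not
  cycles, but their loop chains are.\<close>

lemma homology_hom_eq:
  assumes "group B" and h: "h \<in> hom (homology_with_coeff TYPE('g::ab_group_add) 1 T) B"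
    and h': "h' \<in> hom (homology_with_coeff TYPE('g) 1 T) B"
    and eq: "\<And>u a. u \<in> carrier \<pi> \<Longrightarrow> h (hurewicz u a) = h' (hurewicz u a)"
    and A: "A \<in> carrier (homology_with_coeff TYPE('g) 1 T)"
  shows "h A = h' A"
proof -
  let ?H = "homology_with_coeff TYPE('g) 1 T"
  interpret H: comm_group ?H
    by (rule comm_group_homology)
  obtain c where c: "c \<in> carrier (gcycle_group 1 T)" "A = homology_class 1 T c"
    using A by (auto simp: homology_carrier)
  have "loop_chain c \<in> carrier (gcycle_group 1 T) \<and> h (homology_class 1 T (loop_chain c)) = h' (homology_class 1 T (loop_chain c))"
    if "c \<in> gchain_set 1 T" for c :: "('a, 'g) gchain"
    using that
  proof (induction rule: gchain_induct)
    case zero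
    have "homology_class 1 T (0 :: ('a, 'g) gchain) = \<one>\<^bsub>?H\<^esub>"
      by (simp add: homology_with_coeff_def homology_class_alt)
    then show ?case
      using hom_one[OF h H.is_group \<open>group B\<close>] hom_one[OF h' H.is_group \<open>group B\<close>] by (simp add: gcycle_carrier)
  next
    case (single f a)
    note p = pathin_edge_simplex[OF single]
    show ?case
      using eq[OF loop_class_carrier[OF p], of a] closed_up[OF p]
      by (simp add: loop_chain_single hurewicz_loop_class[OF p] path_chain_cycle)
  next
    case (add c d)
    have "loop_chain c + loop_chain d \<in> carrier (gcycle_group 1 T)"
      using add.IH by (simp add: gcycle_carrier gchain_set_add gchain_boundary_add)
    moreover have "homology_class 1 T (loop_chain c) \<in> carrier ?H" "homology_class 1 T (loop_chain d) \<in> carrier ?H"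
      using add.IH unfolding homology_carrier by auto
    ultimately show ?case
      using add.IH hom_mult[OF h] hom_mult[OF h'] by (simp add: loop_chain_add homology_class_add)
  qed
  moreover have "A = homology_class 1 T (loop_chain c)"
    using loop_chain_homologous[of c] c homologous_class[OF homologous_sym] by (simp add: gcycle_carrier)
  ultimately show ?thesis
    using c by (auto simp: gcycle_carrier)
qed

text \<open>In other words, the first homology group is the tensor product of the abelianized fundamental group
  with the coefficients.\<close>

lemma homology_universal:
  assumes "comm_group B"
    and closed: "\<And>u a. u \<in> carrier \<pi> \<Longrightarrow> \<beta> u (a::'g::ab_group_add) \<in> carrier B"
    and mult: "\<And>u v a. u \<in> carrier \<pi> \<Longrightarrow> v \<in> carrier \<pi> \<Longrightarrow> \<beta> (u \<otimes>\<^bsub>\<pi>\<^esub> v) a = \<beta> u a \<otimes>\<^bsub>B\<^esub> \<beta> v a"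
    and add: "\<And>u a b. u \<in> carrier \<pi> \<Longrightarrow> \<beta> u (a + b) = \<beta> u a \<otimes>\<^bsub>B\<^esub> \<beta> u b"
  obtains h where "h \<in> hom (homology_with_coeff TYPE('g) 1 T) B" "\<And>u a. u \<in> carrier \<pi> \<Longrightarrow> h (hurewicz u a) = \<beta> u a"
proof -
  interpret B: comm_group B
    by fact
  have \<beta>0: "\<beta> u 0 = \<one>\<^bsub>B\<^esub>" if "u \<in> carrier \<pi>" for u
    using add[OF that, of 0 0] closed[OF that, of 0] B.r_cancel_one by fastforce
  have \<beta>m: "\<beta> u a \<otimes>\<^bsub>B\<^esub> \<beta> u (- a) = \<one>\<^bsub>B\<^esub>" if "u \<in> carrier \<pi>" for u a
    using add[OF that, of a "- a"] \<beta>0[OF that] by simp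
  define e where "e f = loop_class (edge f)" for f :: "(nat \<Rightarrow> real) \<Rightarrow> 'a"
  have e: "e f \<in> carrier \<pi>" if "singular_simplex 1 T f" for f
    unfolding e_def using that by (intro loop_class_carrier pathin_edge_simplex)
  \<comment> \<open>\<open>F\<close> evaluates \<open>\<beta>\<close> on the closed-up edges and
    makes sense for every 1-chain. It descends to homology once it is trivial on boundaries of
    triangles.\<close>
  define F where "F c = finprod B (\<lambda>f. \<beta> (e f) (Poly_Mapping.lookup c f)) (Poly_Mapping.keys c)"
    for c :: "('a, 'g) gchain"
  have \<beta>e: "\<beta> (e f) a \<in> carrier B" if "f \<in> Poly_Mapping.keys c" "c \<in> gchain_set 1 T" for f a and c :: "('a, 'g) gchain"
    using that e closed by (auto simp: gchain_set_def)
  have F_closed: "F c \<in> carrier B" if "c \<in> gchain_set 1 T" for c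
    unfolding F_def using \<beta>e[OF _ that] by (intro B.finprod_closed) auto
  have F_ext: "F c = finprod B (\<lambda>f. \<beta> (e f) (Poly_Mapping.lookup c f)) I"
    if "finite I" "Poly_Mapping.keys c \<subseteq> I" "I \<subseteq> singular_simplex_set 1 T" for c I
    unfolding F_def
    by (rule B.finprod_mono_neutral_cong_left) (use that e closed \<beta>0 in \<open>auto simp: in_keys_iff\<close>)
  have F_add: "F (c + d) = F c \<otimes>\<^bsub>B\<^esub> F d" if "c \<in> gchain_set 1 T" "d \<in> gchain_set 1 T" for c d
  proof -
    let ?I = "Poly_Mapping.keys c \<union> Poly_Mapping.keys d"
    have I: "finite ?I" "?I \<subseteq> singular_simplex_set 1 T"
      using that by (auto simp: gchain_set_def)
    have in_I: "\<beta> (e f) a \<in> carrier B" "e f \<in> carrier \<pi>" if "f \<in> ?I" for f a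
      using that I e closed by auto
    have "F (c + d) = finprod B (\<lambda>f. \<beta> (e f) (Poly_Mapping.lookup (c + d) f)) ?I"
      using I keys_add[of c d] by (intro F_ext) auto
    also have "\<dots> = finprod B (\<lambda>f. \<beta> (e f) (Poly_Mapping.lookup c f) \<otimes>\<^bsub>B\<^esub> \<beta> (e f) (Poly_Mapping.lookup d f)) ?I"
      by (rule B.finprod_cong') (use in_I add in \<open>auto simp: lookup_add\<close>)
    also have "\<dots> = finprod B (\<lambda>f. \<beta> (e f) (Poly_Mapping.lookup c f)) ?I \<otimes>\<^bsub>B\<^esub> finprod B (\<lambda>f. \<beta> (e f) (Poly_Mapping.lookup d f)) ?I"
      by (rule B.finprod_multf) (use in_I in auto)
    also have "\<dots> = F c \<otimes>\<^bsub>B\<^esub> F d"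
      using I by (simp add: F_ext[of ?I c] F_ext[of ?I d])
    finally show ?thesis .
  qed
  have F_single: "F (Poly_Mapping.single f a) = \<beta> (e f) a" if "singular_simplex 1 T f" for f a
  proof -
    have "F (Poly_Mapping.single f a) = finprod B (\<lambda>g. \<beta> (e g) (Poly_Mapping.lookup (Poly_Mapping.single f a) g)) {f}"
      using that by (intro F_ext) auto
    then show ?thesis
      using that e closed by simp
  qed
  have F_zero: "F 0 = \<one>\<^bsub>B\<^esub>"
    by (simp add: F_def)
  have F_boundary: "F (gchain_boundary 2 (Poly_Mapping.single \<tau> a)) = \<one>\<^bsub>B\<^esub>" if \<tau>: "singular_simplex 2 T \<tau>" for \<tau> a
  proof -
    have s: "singular_simplex 1 T (singular_face 2 k \<tau>)" if "k \<le> 2" for k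
      using singular_simplex_singular_face[OF \<tau>, of k] that by (simp add: numeral_2_eq_2 One_nat_def)
    let ?f = "\<lambda>k. singular_face 2 k \<tau>"
    note c = e[OF s[of 0]] e[OF s[of 1]] e[OF s[of 2]]
    note ps = pathin_edge_simplex[OF s[of 0]] pathin_edge_simplex[OF s[of 2]]
    have "e (?f 1) = e (?f 2) \<otimes>\<^bsub>\<pi>\<^esub> e (?f 0)"
      unfolding e_def loop_class_homotopic[OF triangle_edges(1)[OF \<tau>], symmetric]
      by (rule loop_class_join) (use ps triangle_edges(2)[OF \<tau>] in \<open>auto simp: edge_ends\<close>)
    \<comment> \<open>The relation among the three edges is applied with the coefficient
      \<open>- a\<close>, which is the one carried by the middle face. The factors then cancel in
      pairs \<open>a\<close>, \<open>- a\<close>.\<close>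
    then have 1: "\<beta> (e (?f 1)) (- a) = \<beta> (e (?f 2)) (- a) \<otimes>\<^bsub>B\<^esub> \<beta> (e (?f 0)) (- a)"
      using c mult by simp
    have "gchain_boundary 2 (Poly_Mapping.single \<tau> a) = Poly_Mapping.single (?f 0) a + Poly_Mapping.single (?f 1) (- a) + Poly_Mapping.single (?f 2) a"
      by (simp add: gchain_boundary_2 single_uminus)
    then have "F (gchain_boundary 2 (Poly_Mapping.single \<tau> a)) = \<beta> (e (?f 0)) a \<otimes>\<^bsub>B\<^esub> \<beta> (e (?f 1)) (- a) \<otimes>\<^bsub>B\<^esub> \<beta> (e (?f 2)) a"
      using s by (simp add: F_add F_single gchain_set_single gchain_set_add)
    also have "\<dots> = (\<beta> (e (?f 0)) a \<otimes>\<^bsub>B\<^esub> \<beta> (e (?f 0)) (- a)) \<otimes>\<^bsub>B\<^esub> (\<beta> (e (?f 2)) a \<otimes>\<^bsub>B\<^esub> \<beta> (e (?f 2)) (- a))"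
      unfolding 1 using c closed by (simp add: B.m_ac)
    also have "\<dots> = \<one>\<^bsub>B\<^esub>"
      using c \<beta>m by simp
    finally show ?thesis .
  qed
  have "F (gchain_boundary 2 d) = \<one>\<^bsub>B\<^esub>" if "d \<in> gchain_set 2 T" for d
    using that
  proof (induction rule: gchain_induct)
    case (add c d)
    then show ?case
      by (simp add: gchain_boundary_add F_add gchain_boundary_in_1)
  qed (simp_all add: F_zero F_boundary)
  then have kernel: "gboundary_set 1 T \<subseteq> kernel (gcycle_group 1 T) B F"
    using gboundary_cycle unfolding kernel_def gboundary_set_1 by auto
  interpret C: comm_group "gcycle_group 1 T :: ('a, 'g) gchain monoid"
    by (rule comm_group_gcycle)
  interpret F: group_hom "gcycle_group 1 T" B F
    by unfold_locales (auto simp: hom_def gcycle_carrier F_closed F_add)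
  obtain h where h: "h \<in> hom (gcycle_group 1 T Mod gboundary_set 1 T) B"
    "\<And>c. c \<in> carrier (gcycle_group 1 T) \<Longrightarrow> h (gboundary_set 1 T #>\<^bsub>gcycle_group 1 T\<^esub> c) = F c"
    using F.FactGroup_universal_kernel[OF gboundary_normal kernel] by blast
  show ?thesis
  proof
    show "h \<in> hom (homology_with_coeff TYPE('g) 1 T) B"
      using h(1) by (simp add: homology_with_coeff_def)
    fix u and a :: 'g assume "u \<in> carrier \<pi>"
    then obtain p where p: "pathin T p" "p 0 = x0" "p 1 = x0" "u = path_class T p" "u = loop_class p"
      by (rule carrier_loop_class)
    have "h (hurewicz u a) = F (path_chain p a)"
      using h(2)[OF path_chain_cycle[of T p a]] p by (simp add: hurewicz_path_class homology_class_def)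
    also have "\<dots> = \<beta> (e (path_simplex p)) a"
      unfolding path_chain_def by (rule F_single[OF singular_simplex_path_simplex[OF p(1)]])
    also have "e (path_simplex p) = u"
      unfolding e_def p(5) using edge_path_simplex
      by (intro loop_class_eq[symmetric] p(1)) (simp add: edge_path_simplex)
    finally show "h (hurewicz u a) = \<beta> u a" .
  qed
qed

end

section \<open>Homology of Rips complexes\<close>

lemma singular_simplex_map_id:
  "continuous_map S T id \<Longrightarrow> singular_simplex p S f \<Longrightarrow> singular_simplex p T f"
  unfolding singular_simplex_def using continuous_map_compose[of _ S f T id] by auto

lemma gchain_set_map_id: "continuous_map S T id \<Longrightarrow> gchain_set p S \<subseteq> gchain_set p T"
  using singular_simplex_map_id by (fastforce simp: gchain_set_def)

lemma gchain_map_id: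
  assumes "c \<in> gchain_set p T"
  shows "gchain_map p id c = c"
proof -
  have "simplex_map p id f = f" if "f \<in> Poly_Mapping.keys c" for f
    using that assms by (auto simp: gchain_set_def simplex_map_def singular_simplex_def extensional_restrict)
  then have "gchain_map p id c = (\<Sum>f\<in>Poly_Mapping.keys c. Poly_Mapping.single f (Poly_Mapping.lookup c f))"
    unfolding gchain_map_def by (intro sum.cong) auto
  then show ?thesis
    by (simp add: poly_mapping_sum_single)
qed

lemma homology_map_id:
  assumes id: "continuous_map S T id" and c: "c \<in> carrier (gcycle_group 1 S)"
  shows "homology_map 1 T id (homology_class 1 S c) = homology_class 1 T c"
    and "c \<in> carrier (gcycle_group 1 T)"
proof -
  have "homology_class 1 T (gchain_map 1 id c') = homology_class 1 T c" if c': "c' \<in> homology_class 1 S c" for c'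
  proof -
    obtain b where b: "b \<in> gboundary_set 1 S" "c' = b + c"
      using c' by (auto simp: homology_class_alt)
    then have "c' \<in> gchain_set 1 S"
      using c gboundary_cycle[OF b(1)] by (auto simp: gcycle_carrier gchain_set_add)
    moreover have "b \<in> gboundary_set 1 T"
      using b(1) gchain_set_map_id[OF id, of 2] by (auto simp: gboundary_set_1)
    ultimately show ?thesis
      using b(2) by (simp add: gchain_map_id homology_class_eq)
  qed
  then have "homology_map 1 T id (homology_class 1 S c) = (\<Union>c'\<in>homology_class 1 S c. homology_class 1 T c)"
    unfolding homology_map_def by (rule SUP_cong[OF refl])
  also have "\<dots> = homology_class 1 T c"
  proof -
    have "homology_class 1 S c \<noteq> {}"
      using gboundary_set_zero[of S] unfolding homology_class_alt by blast
    then show ?thesis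
      by simp
  qed
  finally show "homology_map 1 T id (homology_class 1 S c) = homology_class 1 T c" .
  show "c \<in> carrier (gcycle_group 1 T)"
    using c gchain_set_map_id[OF id, of 1] by (auto simp: gcycle_carrier)
qed

lemma homology_map_id_hom:
  assumes id: "continuous_map S T id"
  shows "homology_map 1 T id \<in> hom (homology_with_coeff TYPE('g::ab_group_add) 1 S) (homology_with_coeff TYPE('g) 1 T)"
proof (rule homI)
  fix A assume "A \<in> carrier (homology_with_coeff TYPE('g) 1 S)"
  then obtain c where c: "c \<in> carrier (gcycle_group 1 S)" "A = homology_class 1 S c"
    by (auto simp: homology_carrier)
  then show "homology_map 1 T id A \<in> carrier (homology_with_coeff TYPE('g) 1 T)"
    using homology_map_id[OF id c(1)] by (auto simp: homology_carrier)
  fix B assume "B \<in> carrier (homology_with_coeff TYPE('g) 1 S)"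
  then obtain d where d: "d \<in> carrier (gcycle_group 1 S)" "B = homology_class 1 S d"
    by (auto simp: homology_carrier)
  have cd: "c + d \<in> carrier (gcycle_group 1 S)"
    using c d by (auto simp: gcycle_carrier gchain_set_add gchain_boundary_add)
  show "homology_map 1 T id (A \<otimes>\<^bsub>homology_with_coeff TYPE('g) 1 S\<^esub> B) =
      homology_map 1 T id A \<otimes>\<^bsub>homology_with_coeff TYPE('g) 1 T\<^esub> homology_map 1 T id B"
    using homology_map_id[OF id c(1)] homology_map_id[OF id d(1)] homology_map_id[OF id cd] c d
    by (simp add: homology_class_add[symmetric])
qed

context geodesic begin

section \<open>The subgroup of small loops in homology\<close>

lemma small_loops_H1_alt:
  "small_loops_H1 TYPE('g::ab_group_add) X \<rho> = generate (homology_with_coeff TYPE('g) 1 TX)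
    {homology_class 1 TX (path_chain \<beta> (a :: 'g)) | \<beta> a. pathin TX \<beta> \<and> \<beta> 0 = \<beta> 1 \<and>
      (\<forall>s\<in>{0..1}. \<forall>t\<in>{0..1}. dist (\<beta> s) (\<beta> t) < \<rho>)}"
proof -
  have "(path \<beta> \<and> path_image \<beta> \<subseteq> X \<and> pathstart \<beta> = pathfinish \<beta> \<and> diameter (path_image \<beta>) < \<rho>) \<longleftrightarrow>
    (pathin TX \<beta> \<and> \<beta> 0 = \<beta> 1 \<and> (\<forall>s\<in>{0..1}. \<forall>t\<in>{0..1}. dist (\<beta> s) (\<beta> t) < \<rho>))" for \<beta>
    using diameter_loop_less_iff[of \<beta> \<rho>] by (auto simp: pathin_top_of_set pathstart_def pathfinish_def)
  then show ?thesis
    unfolding small_loops_H1_def path_chain_def by simp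
qed

lemma small_loop_in_H1:
  assumes "pathin TX \<beta>" "\<beta> 0 = \<beta> 1" "\<And>s t. s \<in> {0..1} \<Longrightarrow> t \<in> {0..1} \<Longrightarrow> dist (\<beta> s) (\<beta> t) < \<rho>"
  shows "homology_class 1 TX (path_chain \<beta> (a :: 'g::ab_group_add)) \<in> small_loops_H1 TYPE('g) X \<rho>"
  unfolding small_loops_H1_alt using assms by (intro generate.incl) blast

lemma small_loops_H1_subgroup:
  "subgroup (small_loops_H1 TYPE('g::ab_group_add) X \<rho>) (homology_with_coeff TYPE('g) 1 TX)"
  unfolding small_loops_H1_alt
  by (rule group.generate_is_subgroup[OF comm_group.axioms(2)[OF comm_group_homology]])
     (auto simp: homology_carrier intro!: path_chain_cycle)

lemma small_loops_H1_normal: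
  "small_loops_H1 TYPE('g::ab_group_add) X \<rho> \<lhd> homology_with_coeff TYPE('g) 1 TX"
  using comm_group.normal_iff_subgroup[OF comm_group_homology] small_loops_H1_subgroup by blast

lemma small_loops_H1_mono:
  assumes "\<rho> \<le> \<rho>'"
  shows "small_loops_H1 TYPE('g::ab_group_add) X \<rho> \<subseteq> small_loops_H1 TYPE('g) X \<rho>'"
  unfolding small_loops_H1_alt
  by (rule group.mono_generate[OF comm_group.axioms(2)[OF comm_group_homology]]) (use assms in \<open>blast intro: less_le_trans\<close>)

text \<open>For fixed \<open>a\<close> the Hurewicz map is a homomorphism into an abelian group, so
  the conjugating path drops out and a generator goes to the class of a small free loop.\<close>

lemma hurewicz_D:
  assumes n: "n \<in> D \<rho>"
  shows "X.hurewicz n (a :: 'g::ab_group_add) \<in> small_loops_H1 TYPE('g) X \<rho>"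
proof -
  let ?H = "homology_with_coeff TYPE('g) 1 TX" and ?S = "small_loops_H1 TYPE('g) X \<rho>"
  interpret H: comm_group ?H
    by (rule comm_group_homology)
  interpret S: subgroup ?S ?H
    by (rule small_loops_H1_subgroup)
  interpret h: group_hom X.\<pi> ?H "\<lambda>u. X.hurewicz u a"
    by unfold_locales (auto simp: hom_def X.hurewicz_closed X.hurewicz_mult)
  have "subgroup {u \<in> carrier X.\<pi>. X.hurewicz u a \<in> ?S} X.\<pi>"
    by (rule subgroup.intro) auto
  moreover have "conj_small_loops \<rho> \<subseteq> {u \<in> carrier X.\<pi>. X.hurewicz u a \<in> ?S}"
  proof
    fix A assume A: "A \<in> conj_small_loops \<rho>"
    then obtain \<alpha> \<beta> where *: "pathin TX \<alpha>" "pathin TX \<beta>" "\<beta> 0 = \<alpha> 1" "\<beta> 1 = \<alpha> 1"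
      "\<forall>s\<in>{0..1}. \<forall>t\<in>{0..1}. dist (\<beta> s) (\<beta> t) < \<rho>"
      "A = X.loop_class \<alpha> \<otimes>\<^bsub>X.\<pi>\<^esub> X.loop_class \<beta> \<otimes>\<^bsub>X.\<pi>\<^esub> inv\<^bsub>X.\<pi>\<^esub> (X.loop_class \<alpha>)"
      unfolding conj_small_loops_iff by blast
    have "X.hurewicz A a = X.hurewicz (X.loop_class \<alpha>) a \<otimes>\<^bsub>?H\<^esub> X.hurewicz (X.loop_class \<beta>) a \<otimes>\<^bsub>?H\<^esub> inv\<^bsub>?H\<^esub> X.hurewicz (X.loop_class \<alpha>) a"
      using * by simp
    also have "\<dots> = X.hurewicz (X.loop_class \<beta>) a"
      using * H.m_comm[of "X.hurewicz (X.loop_class \<alpha>) a"] by (simp add: H.m_assoc)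
    also have "\<dots> \<in> ?S"
      using * small_loop_in_H1[of \<beta> \<rho> a] by (simp add: X.hurewicz_free_loop)
    finally show "A \<in> {u \<in> carrier X.\<pi>. X.hurewicz u a \<in> ?S}"
      using A conj_small_loops_carrier by auto
  qed
  ultimately have "D \<rho> \<subseteq> {u \<in> carrier X.\<pi>. X.hurewicz u a \<in> ?S}"
    unfolding D_eq by (intro X.generate_subgroup_incl)
  then show ?thesis
    using n by auto
qed

end

section \<open>The isomorphism in homology at one scale\<close>

context rips_scale begin

text \<open>Two lifts of one element of the quotient differ by an element of \<open>N\<close>, whose
  Hurewicz class is a combination of small loops. The choice of a lift is therefore invisible in the
  coset.\<close>

lemma hurewicz_coset:
  assumes x: "x \<in> carrier X.\<pi>" "x' \<in> carrier X.\<pi>" and eq: "q x = q x'"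
  shows "small_loops_H1 TYPE('g::ab_group_add) X (3 * r / 2) #>\<^bsub>homology_with_coeff TYPE('g) 1 TX\<^esub> X.hurewicz x a =
    small_loops_H1 TYPE('g) X (3 * r / 2) #>\<^bsub>homology_with_coeff TYPE('g) 1 TX\<^esub> X.hurewicz x' a"
proof -
  let ?H = "homology_with_coeff TYPE('g) 1 TX" and ?S = "small_loops_H1 TYPE('g) X (3 * r / 2)"
  interpret H: comm_group ?H
    by (rule comm_group_homology)
  interpret N: normal N X.\<pi>
    by (rule D_normal)
  define n where "n = x \<otimes>\<^bsub>X.\<pi>\<^esub> inv\<^bsub>X.\<pi>\<^esub> x'"
  have "x \<in> N #>\<^bsub>X.\<pi>\<^esub> x'"
    using X.rcos_self[OF x(1) N.is_subgroup] eq by (simp add: q_def)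
  then have n: "n \<in> N"
    unfolding n_def by (rule N.rcos_module_imp[OF X.is_group x(2)])
  have "x = n \<otimes>\<^bsub>X.\<pi>\<^esub> x'"
    using x by (simp add: n_def X.m_assoc)
  then have "X.hurewicz x a = X.hurewicz n a \<otimes>\<^bsub>?H\<^esub> X.hurewicz x' a"
    using n x by (simp add: X.hurewicz_mult)
  moreover have "X.hurewicz n a \<in> ?S"
    by (rule hurewicz_D[OF n])
  ultimately have "X.hurewicz x a \<in> ?S #>\<^bsub>?H\<^esub> X.hurewicz x' a"
    by (auto simp: r_coset_def)
  then show ?thesis
    by (rule H.repr_independence[OF _ X.hurewicz_closed[OF x(2)] small_loops_H1_subgroup, symmetric])
qed

text \<open>The universal property turns \<open>\<Psi>\<close> and \<open>\<Phi>\<close> into maps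
  of homology in both directions. The second conclusion determines \<open>h\<close> on generators by
  means of any lift \<open>x\<close>, the form in which naturality can be verified.\<close>

lemma homology_iso:
  obtains h where
    "h \<in> iso (homology_with_coeff TYPE('g::ab_group_add) 1 RK)
      (homology_with_coeff TYPE('g) 1 TX Mod small_loops_H1 TYPE('g) X (3 * r / 2))"
    "\<And>u x a. u \<in> carrier K.\<pi> \<Longrightarrow> x \<in> carrier X.\<pi> \<Longrightarrow> q x = \<Psi> u \<Longrightarrow>
      h (K.hurewicz u a) = small_loops_H1 TYPE('g) X (3 * r / 2) #>\<^bsub>homology_with_coeff TYPE('g) 1 TX\<^esub> X.hurewicz x a"
proof -
  let ?H = "homology_with_coeff TYPE('g) 1 TX" and ?S = "small_loops_H1 TYPE('g) X (3 * r / 2)"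
  let ?HK = "homology_with_coeff TYPE('g) 1 RK"
  let ?c = "\<lambda>y. ?S #>\<^bsub>?H\<^esub> y"
  interpret H: comm_group ?H
    by (rule comm_group_homology)
  interpret HK: comm_group ?HK
    by (rule comm_group_homology)
  have HS: "comm_group (?H Mod ?S)"
    by (rule H.abelian_FactGroup[OF small_loops_H1_subgroup])
  interpret HS: comm_group "?H Mod ?S"
    by (rule HS)
  have c: "?c \<in> hom ?H (?H Mod ?S)"
    by (rule normal.r_coset_hom_Mod[OF small_loops_H1_normal])
  have \<Psi>: "\<Psi> \<in> hom K.\<pi> Q"
    by (rule KQ.holonomy_map_hom)
  \<comment> \<open>\<open>rep u\<close> is an arbitrary lift of \<open>\<Psi> u\<close>. It is
    multiplicative only modulo \<open>N\<close>, and \<open>hurewicz_coset\<close> makes that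
    sufficient.\<close>
  define rep where "rep u = (SOME x. x \<in> carrier X.\<pi> \<and> q x = \<Psi> u)" for u
  have rep: "rep u \<in> carrier X.\<pi>" "q (rep u) = \<Psi> u" if "u \<in> carrier K.\<pi>" for u
  proof -
    have "\<Psi> u \<in> carrier Q"
      using hom_in_carrier[OF \<Psi> that] .
    then have "\<exists>x. x \<in> carrier X.\<pi> \<and> q x = \<Psi> u"
      unfolding carrier_FactGroup q_def by fastforce
    from someI_ex[OF this] show "rep u \<in> carrier X.\<pi>" "q (rep u) = \<Psi> u"
      unfolding rep_def by auto
  qed
  obtain h where h: "h \<in> hom ?HK (?H Mod ?S)"
    "\<And>u a. u \<in> carrier K.\<pi> \<Longrightarrow> h (K.hurewicz u a) = ?c (X.hurewicz (rep u) a)"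
  proof (rule K.homology_universal[OF HS, where \<beta> = "\<lambda>u a. ?c (X.hurewicz (rep u) a)"])
    fix u :: "(real \<Rightarrow> 'a \<Rightarrow> real) set" and a :: 'g assume u: "u \<in> carrier K.\<pi>"
    show "?c (X.hurewicz (rep u) a) \<in> carrier (?H Mod ?S)"
      by (rule hom_in_carrier[OF c X.hurewicz_closed[OF rep(1)[OF u]]])
    show "?c (X.hurewicz (rep u) (a + b)) = ?c (X.hurewicz (rep u) a) \<otimes>\<^bsub>?H Mod ?S\<^esub> ?c (X.hurewicz (rep u) b)" for b
      by (simp only: X.hurewicz_add[OF rep(1)[OF u]] hom_mult[OF c X.hurewicz_closed[OF rep(1)[OF u]] X.hurewicz_closed[OF rep(1)[OF u]]])
    fix v assume v: "v \<in> carrier K.\<pi>"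
    note uv = K.m_closed[OF u v]
    have "q (rep (u \<otimes>\<^bsub>K.\<pi>\<^esub> v)) = q (rep u \<otimes>\<^bsub>X.\<pi>\<^esub> rep v)"
      using rep[OF u] rep[OF v] rep[OF uv] hom_mult[OF \<Psi> u v] by (simp del: mult_FactGroup)
    then have "?c (X.hurewicz (rep (u \<otimes>\<^bsub>K.\<pi>\<^esub> v)) a) = ?c (X.hurewicz (rep u \<otimes>\<^bsub>X.\<pi>\<^esub> rep v) a)"
      using rep[OF u] rep[OF v] rep[OF uv] by (intro hurewicz_coset) auto
    also have "\<dots> = ?c (X.hurewicz (rep u) a) \<otimes>\<^bsub>?H Mod ?S\<^esub> ?c (X.hurewicz (rep v) a)"
      by (simp only: X.hurewicz_mult[OF rep(1)[OF u] rep(1)[OF v]]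
        hom_mult[OF c X.hurewicz_closed[OF rep(1)[OF u]] X.hurewicz_closed[OF rep(1)[OF v]]])
    finally show "?c (X.hurewicz (rep (u \<otimes>\<^bsub>K.\<pi>\<^esub> v)) a) =
        ?c (X.hurewicz (rep u) a) \<otimes>\<^bsub>?H Mod ?S\<^esub> ?c (X.hurewicz (rep v) a)" .
  qed blast
  have h_spec: "h (K.hurewicz u a) = ?c (X.hurewicz x a)"
    if "u \<in> carrier K.\<pi>" "x \<in> carrier X.\<pi>" "q x = \<Psi> u" for u x a
    using h(2)[OF that(1)] hurewicz_coset[OF rep(1)[OF that(1)] that(2)] rep(2)[OF that(1)] that(3) by simp
  obtain k where k: "k \<in> hom ?H ?HK" "\<And>x a. x \<in> carrier X.\<pi> \<Longrightarrow> k (X.hurewicz x a) = K.hurewicz (\<Phi> x) a"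
    by (rule X.homology_universal[OF HK.comm_group_axioms, where \<beta> = "\<lambda>x a. K.hurewicz (\<Phi> x) a"])
       (auto simp: K.hurewicz_closed K.hurewicz_mult K.hurewicz_add)
  interpret k: group_hom ?H ?HK k
    by unfold_locales (rule k(1))
  \<comment> \<open>A generator of the subgroup is the Hurewicz class of a small free loop, and
    \<open>\<Phi>\<close> already kills the class of this loop in the fundamental group.\<close>
  have "?S \<subseteq> kernel ?H ?HK k"
    unfolding small_loops_H1_alt
  proof (rule H.generate_subgroup_incl[OF _ k.subgroup_kernel], clarify)
    fix \<beta> and a :: 'g
    assume \<beta>: "pathin TX \<beta>" "\<beta> 0 = \<beta> 1" "\<forall>s\<in>{0..1}. \<forall>t\<in>{0..1}. dist (\<beta> s) (\<beta> t) < 3 * r / 2"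
    interpret a: group_hom K.\<pi> ?HK "\<lambda>u. K.hurewicz u a"
      by unfold_locales (auto simp: hom_def K.hurewicz_closed K.hurewicz_mult)
    have "k (homology_class 1 TX (path_chain \<beta> a)) = K.hurewicz (\<Phi> (X.loop_class \<beta>)) a"
      using k(2)[OF X.loop_class_carrier[OF \<beta>(1)], of a] by (simp add: X.hurewicz_free_loop \<beta>)
    also have "\<Phi> (X.loop_class \<beta>) = \<one>\<^bsub>K.\<pi>\<^esub>"
      using \<beta> by (intro \<Phi>_small_loop) auto
    finally show "homology_class 1 TX (path_chain \<beta> a) \<in> kernel ?H ?HK k"
      using path_chain_cycle[OF \<beta>(1,2), of a] by (auto simp: kernel_def homology_carrier)
  qed
  then obtain k' where k': "k' \<in> hom (?H Mod ?S) ?HK" "\<And>y. y \<in> carrier ?H \<Longrightarrow> k' (?c y) = k y"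
    using k.FactGroup_universal_kernel[OF small_loops_H1_normal] by blast
  have left: "k' (h A) = A" if A: "A \<in> carrier ?HK" for A
  proof -
    obtain \<Phi>' where \<Phi>': "\<And>a. a \<in> carrier X.\<pi> \<Longrightarrow> \<Phi>' (q a) = \<Phi> a" "\<And>u. u \<in> carrier K.\<pi> \<Longrightarrow> \<Phi>' (\<Psi> u) = u"
      using \<Phi>_\<Psi> by metis
    have "(k' \<circ> h) A = id A"
    proof (rule K.homology_hom_eq[OF HK.is_group _ _ _ A])
      show "k' \<circ> h \<in> hom ?HK ?HK"
        by (rule hom_compose[OF h(1) k'(1)])
      show "id \<in> hom ?HK ?HK"
        by (auto simp: hom_def)
      fix u :: "(real \<Rightarrow> 'a \<Rightarrow> real) set" and a :: 'g assume u: "u \<in> carrier K.\<pi>"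
      have "(k' \<circ> h) (K.hurewicz u a) = k (X.hurewicz (rep u) a)"
        using h(2)[OF u] k'(2)[OF X.hurewicz_closed[OF rep(1)[OF u]]] by simp
      also have "\<dots> = K.hurewicz (\<Phi> (rep u)) a"
        by (rule k(2)[OF rep(1)[OF u]])
      also have "\<Phi> (rep u) = u"
        using \<Phi>'(1)[OF rep(1)[OF u]] \<Phi>'(2)[OF u] rep(2)[OF u] by simp
      finally show "(k' \<circ> h) (K.hurewicz u a) = id (K.hurewicz u a)"
        by simp
    qed
    then show ?thesis
      by simp
  qed
  have right: "h (k y) = ?c y" if y: "y \<in> carrier ?H" for y
  proof -
    have "(h \<circ> k) y = ?c y"
    proof (rule X.homology_hom_eq[OF HS.is_group hom_compose[OF k(1) h(1)] c _ y])
      fix x and a :: 'g assume x: "x \<in> carrier X.\<pi>"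
      show "(h \<circ> k) (X.hurewicz x a) = ?c (X.hurewicz x a)"
        using k(2)[OF x] h_spec[OF \<Phi>.hom_closed[OF x] x \<Psi>_\<Phi>[OF x, symmetric]] by simp
    qed
    then show ?thesis
      by simp
  qed
  have "inj_on h (carrier ?HK)"
    by (rule inj_on_inverseI[of _ k']) (rule left)
  moreover have "h ` carrier ?HK = carrier (?H Mod ?S)"
  proof
    show "h ` carrier ?HK \<subseteq> carrier (?H Mod ?S)"
      using hom_in_carrier[OF h(1)] by blast
    show "carrier (?H Mod ?S) \<subseteq> h ` carrier ?HK"
      unfolding carrier_FactGroup using right k.hom_closed by (metis image_subsetI imageI)
  qed
  ultimately have "h \<in> iso ?HK (?H Mod ?S)"
    using h(1) by (simp add: iso_def bij_betw_def)
  then show ?thesis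
    using that h_spec by blast
qed

end

section \<open>Compatibility with the bonding maps in homology\<close>

context geodesic begin

text \<open>It suffices to compare both composites on Hurewicz classes, where \<open>hp\<close> and
  \<open>hq\<close> are known through lifts. By naturality of \<open>\<Psi>\<close>, a lift
  \<open>x\<close> for \<open>u\<close> at scale \<open>p\<close> is also a lift at scale
  \<open>q\<close> for the image of \<open>u\<close>.\<close>

lemma homology_natural:
  fixes hp hq and p q :: real
  defines "HX \<equiv> homology_with_coeff TYPE('g::ab_group_add) 1 TX"
    and "S \<equiv> \<lambda>r. small_loops_H1 TYPE('g) X (3 * r / 2)"
    and "R \<equiv> \<lambda>r. realization (rips X r)"
  assumes pq: "0 < p" "p < q"
    and hp: "hp \<in> hom (homology_with_coeff TYPE('g) 1 (R p)) (HX Mod S p)"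
      "\<And>u x a. u \<in> carrier (fundamental_group (R p) (vertex_point x0)) \<Longrightarrow> x \<in> carrier X.\<pi> \<Longrightarrow>
        rips_scale.q X x0 p x = rips_scale.\<Psi> X x0 p u \<Longrightarrow>
        hp (based_space.hurewicz (R p) u a) = S p #>\<^bsub>HX\<^esub> X.hurewicz x a"
    and hq: "hq \<in> hom (homology_with_coeff TYPE('g) 1 (R q)) (HX Mod S q)"
      "\<And>u x a. u \<in> carrier (fundamental_group (R q) (vertex_point x0)) \<Longrightarrow> x \<in> carrier X.\<pi> \<Longrightarrow>
        rips_scale.q X x0 q x = rips_scale.\<Psi> X x0 q u \<Longrightarrow>
        hq (based_space.hurewicz (R q) u a) = S q #>\<^bsub>HX\<^esub> X.hurewicz x a"
    and A: "A \<in> carrier (homology_with_coeff TYPE('g) 1 (R p))"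
  shows "hq (homology_map 1 (R q) id A) = natural_quotient HX (S q) (hp A)"
proof -
  interpret P: rips_scale X x0 p
    by unfold_locales (rule pq)
  interpret Q: rips_scale X x0 q
    by unfold_locales (use pq in simp)
  interpret HX: comm_group HX
    unfolding HX_def by (rule comm_group_homology)
  have m: "continuous_map (R p) (R q) id"
    unfolding R_def using pq by (intro continuous_map_realization_mono rips_mono) simp
  have normal: "S r \<lhd> HX" for r
    unfolding HX_def S_def by (rule small_loops_H1_normal)
  have mono: "S p \<subseteq> S q"
    unfolding S_def using pq by (intro small_loops_H1_mono) simp
  have D: "D (3 * p / 2) \<subseteq> D (3 * q / 2)"
    using pq by (intro D_mono) simp
  have "(hq \<circ> homology_map 1 (R q) id) A = (natural_quotient HX (S q) \<circ> hp) A"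
  proof (rule P.K.homology_hom_eq[OF normal.factorgroup_is_group[OF normal[of q]] _ _ _ A[unfolded R_def]])
    show "hq \<circ> homology_map 1 (R q) id \<in> hom (homology_with_coeff TYPE('g) 1 P.RK) (HX Mod S q)"
      using hom_compose[OF homology_map_id_hom[OF m] hq(1)] by (simp add: R_def)
    show "natural_quotient HX (S q) \<circ> hp \<in> hom (homology_with_coeff TYPE('g) 1 P.RK) (HX Mod S q)"
      using hom_compose[OF hp(1) natural_quotient_hom[OF HX.is_group normal normal mono]] by (simp add: R_def)
    fix u :: "(real \<Rightarrow> 'a \<Rightarrow> real) set" and a :: 'g assume u: "u \<in> carrier P.K.\<pi>"
    then obtain c where c: "pathin P.RK c" "c 0 = vertex_point x0" "c 1 = vertex_point x0" "u = path_class P.RK c"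
      by (auto simp: fundamental_group_carrier)
    have u': "fundamental_group_map (R q) id u = path_class (R q) c" "pathin (R q) c"
      using fundamental_group_map_id[OF m] c by (auto simp: R_def)
    then have u'_in: "path_class (R q) c \<in> carrier Q.K.\<pi>"
      using c by (auto simp: R_def intro!: path_class_in_carrier)
    have "P.\<Psi> u \<in> carrier P.Q"
      using hom_in_carrier[OF P.KQ.holonomy_map_hom u] .
    then obtain x where x: "x \<in> carrier X.\<pi>" "P.q x = P.\<Psi> u"
      unfolding carrier_FactGroup P.q_def by fastforce
    have "Q.\<Psi> (path_class (R q) c) = natural_quotient X.\<pi> (D (3 * q / 2)) (P.q x)"
      using \<Psi>_natural[OF pq u] u'(1) x(2) by (simp add: R_def)
    also have "\<dots> = Q.q x"
      unfolding P.q_def Q.q_def by (rule natural_quotient_rcoset[OF X.is_group D_normal D_normal D x(1)])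
    finally have x': "Q.q x = Q.\<Psi> (path_class (R q) c)"
      by simp
    have "P.K.hurewicz u a = homology_class 1 (R p) (path_chain c a)"
      using P.K.hurewicz_path_class[OF c(1)] c(4) by (simp add: R_def)
    moreover have "path_chain c a \<in> carrier (gcycle_group 1 (R p))"
      using c by (simp add: R_def path_chain_cycle)
    ultimately have "homology_map 1 (R q) id (P.K.hurewicz u a) = homology_class 1 (R q) (path_chain c a)"
      using homology_map_id(1)[OF m] by simp
    also have "\<dots> = Q.K.hurewicz (path_class (R q) c) a"
      using Q.K.hurewicz_path_class[of c a] u'(2) by (simp add: R_def)
    finally have "(hq \<circ> homology_map 1 (R q) id) (P.K.hurewicz u a) = S q #>\<^bsub>HX\<^esub> X.hurewicz x a"
      using hq(2)[OF _ x(1) x', of a] u'_in by (simp add: R_def)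
    also have "\<dots> = natural_quotient HX (S q) (S p #>\<^bsub>HX\<^esub> X.hurewicz x a)"
      using X.hurewicz_closed[OF x(1)]
      by (intro natural_quotient_rcoset[symmetric, OF HX.is_group normal normal mono]) (simp add: HX_def)
    also have "\<dots> = (natural_quotient HX (S q) \<circ> hp) (P.K.hurewicz u a)"
      using hp(2)[OF _ x(1,2), of a] u by (simp add: R_def)
    finally show "(hq \<circ> homology_map 1 (R q) id) (P.K.hurewicz u a) = (natural_quotient HX (S q) \<circ> hp) (P.K.hurewicz u a)" .
  qed
  then show ?thesis
    by simp
qed

end

theorem theorem5p9:
  fixes X :: "'a::metric_space set" and x0 :: 'a
  assumes "geodesic_space X" and "x0 \<in> X"
  shows
    "persistence_isomorphic
       (\<lambda>r. fundamental_group (realization (rips X r)) (vertex_point x0))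
       (\<lambda>p q. fundamental_group_map (realization (rips X q)) id)
       (\<lambda>r. fundamental_group (top_of_set X) x0 Mod small_loops_pi1 X x0 (3 * r / 2))
       (\<lambda>p q. natural_quotient (fundamental_group (top_of_set X) x0)
                (small_loops_pi1 X x0 (3 * q / 2)))
     \<and>
     persistence_isomorphic
       (\<lambda>r. homology_with_coeff TYPE('g::ab_group_add) 1 (realization (rips X r)))
       (\<lambda>p q. homology_map 1 (realization (rips X q)) id)
       (\<lambda>r. homology_with_coeff TYPE('g) 1 (top_of_set X) Mod
              small_loops_H1 TYPE('g) X (3 * r / 2))
       (\<lambda>p q. natural_quotient (homology_with_coeff TYPE('g) 1 (top_of_set X))
                (small_loops_H1 TYPE('g) X (3 * q / 2)))"
proof
  interpret geodesic X x0
    by unfold_locales (rule assms)+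
  have scale: "rips_scale X x0 r" if "r > 0" for r
    by unfold_locales (rule that)
  show "persistence_isomorphic
       (\<lambda>r. fundamental_group (realization (rips X r)) (vertex_point x0))
       (\<lambda>p q. fundamental_group_map (realization (rips X q)) id)
       (\<lambda>r. X.\<pi> Mod D (3 * r / 2))
       (\<lambda>p q. natural_quotient X.\<pi> (D (3 * q / 2)))"
    unfolding persistence_isomorphic_def
    using rips_scale.\<Psi>_iso[OF scale] \<Psi>_natural
    by (intro exI[of _ "\<lambda>r. rips_scale.\<Psi> X x0 r"]) blast
  \<comment> \<open>\<open>spec\<close> keeps the values on Hurewicz classes together with the
    isomorphism property, so that maps chosen separately for each \<open>r\<close> still commute
    with the bonding maps.\<close>
  define spec where "spec r h \<longleftrightarrow>
      h \<in> iso (homology_with_coeff TYPE('g) 1 (realization (rips X r)))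
        (homology_with_coeff TYPE('g) 1 TX Mod small_loops_H1 TYPE('g) X (3 * r / 2)) \<and>
      (\<forall>u x a. u \<in> carrier (fundamental_group (realization (rips X r)) (vertex_point x0)) \<longrightarrow> x \<in> carrier X.\<pi> \<longrightarrow>
        rips_scale.q X x0 r x = rips_scale.\<Psi> X x0 r u \<longrightarrow>
        h (based_space.hurewicz (realization (rips X r)) u a) =
          small_loops_H1 TYPE('g) X (3 * r / 2) #>\<^bsub>homology_with_coeff TYPE('g) 1 TX\<^esub> X.hurewicz x a)" for r h
  have "\<exists>h. spec r h" if "r > 0" for r
    using rips_scale.homology_iso[OF scale[OF that]] unfolding spec_def by metis
  then obtain h where h: "\<And>r. r > 0 \<Longrightarrow> spec r (h r)"
    by metis
  show "persistence_isomorphic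
       (\<lambda>r. homology_with_coeff TYPE('g) 1 (realization (rips X r)))
       (\<lambda>p q. homology_map 1 (realization (rips X q)) id)
       (\<lambda>r. homology_with_coeff TYPE('g) 1 TX Mod small_loops_H1 TYPE('g) X (3 * r / 2))
       (\<lambda>p q. natural_quotient (homology_with_coeff TYPE('g) 1 TX) (small_loops_H1 TYPE('g) X (3 * q / 2)))"
    unfolding persistence_isomorphic_def
  proof (intro exI[of _ h] conjI allI impI ballI)
    fix r :: real assume "r > 0"
    then show "h r \<in> iso (homology_with_coeff TYPE('g) 1 (realization (rips X r)))
        (homology_with_coeff TYPE('g) 1 TX Mod small_loops_H1 TYPE('g) X (3 * r / 2))"
      using h[of r] unfolding spec_def by blast
  next
    fix p q :: real and A assume pq: "0 < p" "p < q"
      and A: "A \<in> carrier (homology_with_coeff TYPE('g) 1 (realization (rips X p)))"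
    have p: "spec p (h p)" and q: "spec q (h q)"
      using h pq by auto
    show "h q (homology_map 1 (realization (rips X q)) id A) =
        natural_quotient (homology_with_coeff TYPE('g) 1 TX) (small_loops_H1 TYPE('g) X (3 * q / 2)) (h p A)"
      by (rule homology_natural[OF pq _ _ _ _ A]) (use p q in \<open>auto simp: spec_def iso_def\<close>)
  qed
qed

end
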